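(* Let $N\in(1,\infty)$, let $X$ be a proper, essentially nonbranching, complete, geodesic metric space with a Radon measure $\mathfrak m$, let $I\subseteq\mathbb R$ be an interval and let $f:I\to[0,\infty)$ be smooth with $\partial I=f^{-1}(\{0\})$. If ${}^-I\times_f^NX$ (the Lorentzian generalized cone ${}^-I\times_fX$ equipped with the measure $f(t)^N\,dt\otimes\mathfrak m$) satisfies the condition $\mathsf{TCD}_p(0,N+1)$ for some $p\in(0,1)$, and there exists a future directed timelike geodesic line in ${}^-I\times_fX$, then $I=\mathbb R$ and $f\equiv c$ is constant. Especially, ${}^-I\times_f^NX={}^-\mathbb R\times X$.
   Context: $\partial I$ is the set of endpoints of $I$. A future directed timelike geodesic line is a timelike curve $\gamma:\mathbb R\to{}^-I\times_fX$ such that $\gamma|_{[-L,L]}$ is a future directed timelike maximal geodesic for every $L>0$. ${}^-\mathbb R\times X$ denotes the Lorentzian product (constant warping function). $X$ is essentially nonbranching if for all $\mathfrak m$-absolutely continuous $\mu,\nu$ with finite second moments, every probability measure $\boldsymbol\pi$ on the space of constant speed minimizing geodesics $[0,1]\to X$ whose endpoint marginal $(\mathsf e_0,\mathsf e_1)_\sharp\boldsymbol\pi$ is an optimal coupling of $\mu,\nu$ for the cost $\mathsf d^2$ is concentrated on a Borel set of geodesics in which two elements coinciding on $[0,t]$ for some $t\in(0,1)$ coincide on $[0,1]$. Here $\mathsf e_t(\gamma)=\gamma_t$. Lorentzian generalized cone ${}^-I\times_fX$. It is assumed that $f^{-1}(\{0\})\subseteq\{\inf I,\sup I\}$ and $\int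 1/f=\infty$ near an endpoint where $f$ vanishes. The underlying set $Y$ is $I\times X$ with $\{t\}\times X$ collapsed to a point whenever $f(t)=0$, with the metric $\mathsf d_Y$ given by the infimum of $\int\sqrt{\dot\alpha^2+(f\circ\alpha)^2v_\beta^2}$ over absolutely continuous connecting curves $(\alpha,\beta)$, $v_\beta$ being the metric speed of $\beta$. An absolutely continuous curve $\gamma=(\alpha,\beta)$ with $\alpha$ strictly monotone is causal (timelike) if $-\dot\alpha^2+(f\circ\alpha)^2v_\beta^2\le0$ ($<0$) a.e., and future directed if $\alpha$ is strictly increasing; $L(\gamma)=\int\sqrt{\dot\alpha^2-(f\circ\alpha)^2v_\beta^2}$. Write $y\ll y'$ ($y\le y'$) if there is a future directed timelike (causal) curve from $y$ to $y'$ (or $y=y'$ for $\le$). The time separation $\tau(y,y')$ is the supremum of $L(\gamma)$ over future directed causal curves from $y$ to $y'$, and $0$ if there are none. A maximal geodesic is a curve realizing $\tau$ between its points and parametrized proportionally to $\tau$-arclength. $\mathsf{TCD}_p(0,N+1)$ for $Y$ with measure $\mathfrak n=f(t)^N\,dt\otimes\mathfrak m$: a coupling of $\mu,\nu$ is causal if concentrated on $\{x\le y\}$, chronological if concentrated on $\{x\ll y\}$, and a causal coupling is $p$-optimal if it maximizes $\int\tau^p\,d\pi$ among causal couplings; $(\mu_0,\mu_1)$ is timelike $p$-dualizable if some $p$-optimal coupling is chronological. The condition requires that for every timelike $p$-dualizable pair of compactly supported $\mu_i=\rho_i\mathfrak n$ there is a probability measure $\boldsymbol\pi$ on the set of continuous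 $\gamma:[0,1]\to Y$ with $\tau(\gamma_s,\gamma_t)=(t-s)\tau(\gamma_0,\gamma_1)$ for $s<t$, $\tau(\gamma_0,\gamma_1)>0$, such that $\pi=(\mathsf e_0,\mathsf e_1)_\sharp\boldsymbol\pi$ is a $p$-optimal chronological coupling of $\mu_0,\mu_1$, and for all $t\in[0,1]$ and $N'\ge N+1$ $$\int\rho_t^{1-\frac1{N'}}\,d\mathfrak n\ge\int\Big[(1-t)\rho_0(x_0)^{-\frac1{N'}}+t\,\rho_1(x_1)^{-\frac1{N'}}\Big]d\pi(x_0,x_1),$$ $\rho_t$ being the density of the $\mathfrak n$-absolutely continuous part of $(\mathsf e_t)_\sharp\boldsymbol\pi$. *)

theory Defs
  imports "HOL-Probability.Probability_Measure"
begin

definition proper_space :: "'a::metric_space itself \<Rightarrow> bool" where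
  "proper_space _ \<longleftrightarrow> (\<forall>(x::'a) r. compact (cball x r))"

definition geodesic_space :: "'a::metric_space itself \<Rightarrow> bool" where
  "geodesic_space _ \<longleftrightarrow> (\<forall>x y::'a. \<exists>\<gamma>::real \<Rightarrow> 'a. \<gamma> 0 = x \<and> \<gamma> 1 = y \<and>
     (\<forall>s\<in>{0..1}. \<forall>t\<in>{0..1}. dist (\<gamma> s) (\<gamma> t) = \<bar>t - s\<bar> * dist x y))"

definition radon_measure :: "'a::metric_space measure \<Rightarrow> bool" where
  "radon_measure M \<longleftrightarrow> sets M = sets borel \<and>
     (\<forall>K. compact K \<longrightarrow> emeasure M K < \<infinity>) \<and>
     (\<forall>B\<in>sets borel. emeasure M B = (SUP K\<in>{K. K \<subseteq> B \<and> compact K}. emeasure M K))"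

text \<open>Absolute continuity of metric-space valued curves, in the \<open>L\<^sup>1\<close>-upper-gradient form.\<close>

definition abs_cont_curve :: "real \<Rightarrow> real \<Rightarrow> (real \<Rightarrow> 'a::metric_space) \<Rightarrow> bool" where
  "abs_cont_curve a b \<gamma> \<longleftrightarrow> (\<exists>g. set_integrable lborel {a..b} g \<and>
     (\<forall>s t. a \<le> s \<and> s \<le> t \<and> t \<le> b \<longrightarrow> dist (\<gamma> s) (\<gamma> t) \<le> (LINT r:{s..t}|lborel. g r)))"

text \<open>For an absolutely continuous curve the limit exists almost everywhere.\<close>

definition metric_speed :: "(real \<Rightarrow> 'a::metric_space) \<Rightarrow> real \<Rightarrow> real" where
  "metric_speed \<gamma> t = Lim (at t) (\<lambda>s. dist (\<gamma> s) (\<gamma> t) / \<bar>s - t\<bar>)"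

text \<open>Smoothness on an interval that may contain its endpoints, where derivatives are one-sided.\<close>

definition smooth_on_interval :: "real set \<Rightarrow> (real \<Rightarrow> real) \<Rightarrow> bool" where
  "smooth_on_interval I f \<longleftrightarrow> (\<exists>D :: nat \<Rightarrow> real \<Rightarrow> real. (\<forall>t\<in>I. D 0 t = f t) \<and>
     (\<forall>n. \<forall>t\<in>I. (D n has_real_derivative D (Suc n) t) (at t within I)))"

definition borel_of :: "'a topology \<Rightarrow> 'a measure" where
  "borel_of T = sigma (topspace T) {U. openin T U}"

text \<open>The space \<open>C([0,1], M)\<close> with the topology of uniform convergence; its elements are
  functions on the reals that are \<open>undefined\<close> outside \<open>[0,1]\<close>.\<close>

definition path_space :: "'a metric \<Rightarrow> (real \<Rightarrow> 'a) topology" where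
  "path_space M = mtopology_of (cfunspace (top_of_set {0..1}) M)"

definition prob_measures_on :: "'a topology \<Rightarrow> 'a set \<Rightarrow> 'a measure set" where
  "prob_measures_on T G = {P. prob_space P \<and> sets P = sets (borel_of (subtopology T G))}"

definition coupling :: "'a measure \<Rightarrow> 'b measure \<Rightarrow> ('a \<times> 'b) measure \<Rightarrow> bool" where
  "coupling \<mu> \<nu> \<pi> \<longleftrightarrow> sets \<pi> = sets (\<mu> \<Otimes>\<^sub>M \<nu>) \<and> distr \<pi> \<mu> fst = \<mu> \<and> distr \<pi> \<nu> snd = \<nu>"

definition Geo :: "(real \<Rightarrow> 'a::metric_space) set" where
  "Geo = {\<gamma> \<in> topspace (path_space euclidean_metric).
     \<forall>s\<in>{0..1}. \<forall>t\<in>{0..1}. dist (\<gamma> s) (\<gamma> t) = \<bar>t - s\<bar> * dist (\<gamma> 0) (\<gamma> 1)}"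

definition finite_second_moment :: "'a::metric_space measure \<Rightarrow> bool" where
  "finite_second_moment \<mu> \<longleftrightarrow> (\<exists>x\<^sub>0. (\<integral>\<^sup>+x. ennreal ((dist x\<^sub>0 x)\<^sup>2) \<partial>\<mu>) < \<infinity>)"

definition optimal_coupling_sq ::
    "'a::metric_space measure \<Rightarrow> 'a measure \<Rightarrow> ('a \<times> 'a) measure \<Rightarrow> bool" where
  "optimal_coupling_sq \<mu> \<nu> \<pi> \<longleftrightarrow> coupling \<mu> \<nu> \<pi> \<and>
     (\<forall>\<pi>'. coupling \<mu> \<nu> \<pi>' \<longrightarrow>
        (\<integral>\<^sup>+(x, y). ennreal ((dist x y)\<^sup>2) \<partial>\<pi>) \<le> (\<integral>\<^sup>+(x, y). ennreal ((dist x y)\<^sup>2) \<partial>\<pi>'))"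

definition essentially_nonbranching :: "'a::metric_space measure \<Rightarrow> bool" where
  "essentially_nonbranching M \<longleftrightarrow>
     (\<forall>\<mu> \<nu>. prob_space \<mu> \<and> sets \<mu> = sets borel \<and> absolutely_continuous M \<mu> \<and> finite_second_moment \<mu> \<and>
            prob_space \<nu> \<and> sets \<nu> = sets borel \<and> absolutely_continuous M \<nu> \<and> finite_second_moment \<nu> \<longrightarrow>
       (\<forall>P\<in>prob_measures_on (path_space euclidean_metric) Geo.
          optimal_coupling_sq \<mu> \<nu> (distr P (borel \<Otimes>\<^sub>M borel) (\<lambda>\<gamma>. (\<gamma> 0, \<gamma> 1))) \<longrightarrow>
          (\<exists>\<Gamma>\<in>sets P. emeasure P \<Gamma> = 1 \<and>
             (\<forall>\<gamma>\<in>\<Gamma>. \<forall>\<gamma>'\<in>\<Gamma>. (\<exists>t\<in>{0<..<1}. \<forall>s\<in>{0..t}. \<gamma> s = \<gamma>' s) \<longrightarrow> (\<forall>s\<in>{0..1}. \<gamma> s = \<gamma>' s)))))"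

record 'y lorentz_space =
  metr :: "'y metric"
  chron :: "'y \<Rightarrow> 'y \<Rightarrow> bool"
  caus :: "'y \<Rightarrow> 'y \<Rightarrow> bool"
  tsep :: "'y \<Rightarrow> 'y \<Rightarrow> real"
  vol :: "'y measure"

definition top_of :: "'y lorentz_space \<Rightarrow> 'y topology" where
  "top_of S = mtopology_of (metr S)"

definition causal_coupling ::
    "'y lorentz_space \<Rightarrow> 'y measure \<Rightarrow> 'y measure \<Rightarrow> ('y \<times> 'y) measure \<Rightarrow> bool" where
  "causal_coupling S \<mu> \<nu> \<pi> \<longleftrightarrow> coupling \<mu> \<nu> \<pi> \<and> (AE (x, y) in \<pi>. caus S x y)"

definition chronological_coupling ::
    "'y lorentz_space \<Rightarrow> 'y measure \<Rightarrow> 'y measure \<Rightarrow> ('y \<times> 'y) measure \<Rightarrow> bool" where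
  "chronological_coupling S \<mu> \<nu> \<pi> \<longleftrightarrow> coupling \<mu> \<nu> \<pi> \<and> (AE (x, y) in \<pi>. chron S x y)"

definition p_optimal ::
    "real \<Rightarrow> 'y lorentz_space \<Rightarrow> 'y measure \<Rightarrow> 'y measure \<Rightarrow> ('y \<times> 'y) measure \<Rightarrow> bool" where
  "p_optimal p S \<mu> \<nu> \<pi> \<longleftrightarrow> causal_coupling S \<mu> \<nu> \<pi> \<and>
     (\<forall>\<pi>'. causal_coupling S \<mu> \<nu> \<pi>' \<longrightarrow>
        (\<integral>\<^sup>+(x, y). ennreal (tsep S x y powr p) \<partial>\<pi>') \<le> (\<integral>\<^sup>+(x, y). ennreal (tsep S x y powr p) \<partial>\<pi>))"

definition timelike_p_dualizable ::
    "real \<Rightarrow> 'y lorentz_space \<Rightarrow> 'y measure \<Rightarrow> 'y measure \<Rightarrow> bool" where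
  "timelike_p_dualizable p S \<mu> \<nu> \<longleftrightarrow>
     (\<exists>\<pi>. p_optimal p S \<mu> \<nu> \<pi> \<and> chronological_coupling S \<mu> \<nu> \<pi>)"

definition TGeo :: "'y lorentz_space \<Rightarrow> (real \<Rightarrow> 'y) set" where
  "TGeo S = {\<gamma> \<in> topspace (path_space (metr S)). 0 < tsep S (\<gamma> 0) (\<gamma> 1) \<and>
     (\<forall>s\<in>{0..1}. \<forall>t\<in>{0..1}. s < t \<longrightarrow> tsep S (\<gamma> s) (\<gamma> t) = (t - s) * tsep S (\<gamma> 0) (\<gamma> 1))}"

definition compactly_supported_density ::
    "'y lorentz_space \<Rightarrow> 'y measure \<Rightarrow> ('y \<Rightarrow> real) \<Rightarrow> bool" where
  "compactly_supported_density S \<mu> \<rho> \<longleftrightarrow> prob_space \<mu> \<and>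
     \<rho> \<in> borel_measurable (vol S) \<and> (\<forall>y. 0 \<le> \<rho> y) \<and> \<mu> = density (vol S) (\<lambda>y. ennreal (\<rho> y)) \<and>
     (\<exists>K. compactin (top_of S) K \<and> (AE y in \<mu>. y \<in> K))"

text \<open>\<open>\<rho>\<close> is the density of the absolutely continuous part in the Lebesgue decomposition of
  \<open>\<mu>\<close> with respect to \<open>M\<close>; the singular part is the restriction of \<open>\<mu>\<close> to the null set \<open>Z\<close>.\<close>

definition ac_density :: "'y measure \<Rightarrow> 'y measure \<Rightarrow> ('y \<Rightarrow> real) \<Rightarrow> bool" where
  "ac_density M \<mu> \<rho> \<longleftrightarrow> \<rho> \<in> borel_measurable M \<and> (\<forall>y. 0 \<le> \<rho> y) \<and>
     (\<exists>Z\<in>null_sets M. \<forall>A\<in>sets M. emeasure \<mu> (A - Z) = (\<integral>\<^sup>+y\<in>A. ennreal (\<rho> y) \<partial>M))"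

text \<open>\<open>TCD\<^sub>p(0,D)\<close>. The densities are evaluated with \<open>0 powr r = 0\<close>; on the right-hand side
  this concerns only a \<open>\<pi>\<close>-null set.\<close>

definition TCD_zero :: "real \<Rightarrow> real \<Rightarrow> 'y lorentz_space \<Rightarrow> bool" where
  "TCD_zero p D S \<longleftrightarrow>
     (\<forall>\<mu>\<^sub>0 \<mu>\<^sub>1 \<rho>\<^sub>0 \<rho>\<^sub>1.
        compactly_supported_density S \<mu>\<^sub>0 \<rho>\<^sub>0 \<and> compactly_supported_density S \<mu>\<^sub>1 \<rho>\<^sub>1 \<and>
        timelike_p_dualizable p S \<mu>\<^sub>0 \<mu>\<^sub>1 \<longrightarrow>
        (\<exists>P\<in>prob_measures_on (path_space (metr S)) (TGeo S).
           let B = borel_of (top_of S); \<pi> = distr P (B \<Otimes>\<^sub>M B) (\<lambda>\<gamma>. (\<gamma> 0, \<gamma> 1)) in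
             p_optimal p S \<mu>\<^sub>0 \<mu>\<^sub>1 \<pi> \<and> chronological_coupling S \<mu>\<^sub>0 \<mu>\<^sub>1 \<pi> \<and>
             (\<forall>t\<in>{0..1}. \<exists>\<rho>. ac_density (vol S) (distr P B (\<lambda>\<gamma>. \<gamma> t)) \<rho> \<and>
                (\<forall>N'\<ge>D.
                   (\<integral>\<^sup>+y. ennreal (\<rho> y powr (1 - 1 / N')) \<partial>vol S) \<ge>
                   (\<integral>\<^sup>+(x\<^sub>0, x\<^sub>1). ennreal ((1 - t) * \<rho>\<^sub>0 x\<^sub>0 powr (- 1 / N') + t * \<rho>\<^sub>1 x\<^sub>1 powr (- 1 / N')) \<partial>\<pi>)))))"

definition cone_rel :: "real set \<Rightarrow> (real \<Rightarrow> real) \<Rightarrow> ((real \<times> 'a) \<times> (real \<times> 'a)) set" where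
  "cone_rel I f = {((s, x), (t, y)). s \<in> I \<and> s = t \<and> (x = y \<or> f s = 0)}"

definition cone_pt :: "real set \<Rightarrow> (real \<Rightarrow> real) \<Rightarrow> real \<times> 'a \<Rightarrow> (real \<times> 'a) set" where
  "cone_pt I f q = cone_rel I f `` {q}"

definition cone_points :: "real set \<Rightarrow> (real \<Rightarrow> real) \<Rightarrow> (real \<times> 'a) set set" where
  "cone_points I f = (I \<times> UNIV) // cone_rel I f"

text \<open>Curves in the cone are given by components \<open>\<alpha>\<close>, \<open>\<beta>\<close> on \<open>[a,b]\<close>; membership of
  \<open>(\<alpha> a, \<beta> a)\<close> in an equivalence class says that the curve starts at that point of the cone.\<close>

definition ac_curve ::
    "real set \<Rightarrow> real \<Rightarrow> real \<Rightarrow> (real \<Rightarrow> real) \<Rightarrow> (real \<Rightarrow> 'a::metric_space) \<Rightarrow> bool" where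
  "ac_curve I a b \<alpha> \<beta> \<longleftrightarrow> a < b \<and> \<alpha> ` {a..b} \<subseteq> I \<and> abs_cont_curve a b \<alpha> \<and> abs_cont_curve a b \<beta>"

text \<open>Outside the set of points the value 0 is forced by the conventions of the type \<open>metric\<close>,
  which requires nonnegativity and symmetry everywhere. Integrals over curves are taken with respect
  to the completed measure, since the derivatives are only defined almost everywhere.\<close>

definition cone_dist ::
    "real set \<Rightarrow> (real \<Rightarrow> real) \<Rightarrow> (real \<times> 'a::metric_space) set \<Rightarrow> (real \<times> 'a) set \<Rightarrow> real" where
  "cone_dist I f y y' =
     (if y \<in> cone_points I f \<and> y' \<in> cone_points I f
      then Inf {l. \<exists>a b \<alpha> \<beta>. ac_curve I a b \<alpha> \<beta> \<and> (\<alpha> a, \<beta> a) \<in> y \<and> (\<alpha> b, \<beta> b) \<in> y' \<and>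
                l = (LINT t:{a..b}|lebesgue. sqrt ((deriv \<alpha> t)\<^sup>2 + (f (\<alpha> t))\<^sup>2 * (metric_speed \<beta> t)\<^sup>2))}
      else 0)"

definition fd_causal_curve ::
    "real set \<Rightarrow> (real \<Rightarrow> real) \<Rightarrow> real \<Rightarrow> real \<Rightarrow> (real \<Rightarrow> real) \<Rightarrow> (real \<Rightarrow> 'a::metric_space) \<Rightarrow> bool" where
  "fd_causal_curve I f a b \<alpha> \<beta> \<longleftrightarrow> ac_curve I a b \<alpha> \<beta> \<and> strict_mono_on {a..b} \<alpha> \<and>
     (AE t in lborel. t \<in> {a..b} \<longrightarrow> - (deriv \<alpha> t)\<^sup>2 + (f (\<alpha> t))\<^sup>2 * (metric_speed \<beta> t)\<^sup>2 \<le> 0)"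

definition fd_timelike_curve ::
    "real set \<Rightarrow> (real \<Rightarrow> real) \<Rightarrow> real \<Rightarrow> real \<Rightarrow> (real \<Rightarrow> real) \<Rightarrow> (real \<Rightarrow> 'a::metric_space) \<Rightarrow> bool" where
  "fd_timelike_curve I f a b \<alpha> \<beta> \<longleftrightarrow> ac_curve I a b \<alpha> \<beta> \<and> strict_mono_on {a..b} \<alpha> \<and>
     (AE t in lborel. t \<in> {a..b} \<longrightarrow> - (deriv \<alpha> t)\<^sup>2 + (f (\<alpha> t))\<^sup>2 * (metric_speed \<beta> t)\<^sup>2 < 0)"

definition lorentz_length ::
    "(real \<Rightarrow> real) \<Rightarrow> real \<Rightarrow> real \<Rightarrow> (real \<Rightarrow> real) \<Rightarrow> (real \<Rightarrow> 'a::metric_space) \<Rightarrow> real" where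
  "lorentz_length f a b \<alpha> \<beta> =
     (LINT t:{a..b}|lebesgue. sqrt ((deriv \<alpha> t)\<^sup>2 - (f (\<alpha> t))\<^sup>2 * (metric_speed \<beta> t)\<^sup>2))"

definition cone_chron ::
    "real set \<Rightarrow> (real \<Rightarrow> real) \<Rightarrow> (real \<times> 'a::metric_space) set \<Rightarrow> (real \<times> 'a) set \<Rightarrow> bool" where
  "cone_chron I f y y' \<longleftrightarrow>
     (\<exists>a b \<alpha> \<beta>. fd_timelike_curve I f a b \<alpha> \<beta> \<and> (\<alpha> a, \<beta> a) \<in> y \<and> (\<alpha> b, \<beta> b) \<in> y')"

definition cone_caus ::
    "real set \<Rightarrow> (real \<Rightarrow> real) \<Rightarrow> (real \<times> 'a::metric_space) set \<Rightarrow> (real \<times> 'a) set \<Rightarrow> bool" where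
  "cone_caus I f y y' \<longleftrightarrow> y = y' \<or>
     (\<exists>a b \<alpha> \<beta>. fd_causal_curve I f a b \<alpha> \<beta> \<and> (\<alpha> a, \<beta> a) \<in> y \<and> (\<alpha> b, \<beta> b) \<in> y')"

text \<open>The set of lengths is bounded above by the difference of the time coordinates, so the real
  supremum is the genuine one.\<close>

definition cone_tsep ::
    "real set \<Rightarrow> (real \<Rightarrow> real) \<Rightarrow> (real \<times> 'a::metric_space) set \<Rightarrow> (real \<times> 'a) set \<Rightarrow> real" where
  "cone_tsep I f y y' =
     (let A = {lorentz_length f a b \<alpha> \<beta> | a b \<alpha> \<beta>.
                 fd_causal_curve I f a b \<alpha> \<beta> \<and> (\<alpha> a, \<beta> a) \<in> y \<and> (\<alpha> b, \<beta> b) \<in> y'}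
      in if A = {} then 0 else Sup A)"

definition cone_metric :: "real set \<Rightarrow> (real \<Rightarrow> real) \<Rightarrow> (real \<times> 'a::metric_space) set metric" where
  "cone_metric I f = metric (cone_points I f, cone_dist I f)"

definition cone_vol ::
    "real set \<Rightarrow> (real \<Rightarrow> real) \<Rightarrow> real \<Rightarrow> 'a::metric_space measure \<Rightarrow> (real \<times> 'a) set measure" where
  "cone_vol I f N M =
     distr (density (restrict_space lborel I) (\<lambda>t. ennreal (f t powr N)) \<Otimes>\<^sub>M M)
       (borel_of (mtopology_of (cone_metric I f))) (cone_pt I f)"

definition lorentz_cone ::
    "real set \<Rightarrow> (real \<Rightarrow> real) \<Rightarrow> real \<Rightarrow> 'a::metric_space measure \<Rightarrow> (real \<times> 'a) set lorentz_space" where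
  "lorentz_cone I f N M =
     \<lparr> metr = cone_metric I f, chron = cone_chron I f, caus = cone_caus I f,
       tsep = cone_tsep I f, vol = cone_vol I f N M \<rparr>"

text \<open>The Lorentzian product of the real line and \<open>X\<close>: the warping function is a constant \<open>c\<close>.\<close>

definition lorentz_product ::
    "real \<Rightarrow> real \<Rightarrow> 'a::metric_space measure \<Rightarrow> (real \<times> 'a) set lorentz_space" where
  "lorentz_product c N M = lorentz_cone UNIV (\<lambda>_. c) N M"

definition maximal_geodesic ::
    "real set \<Rightarrow> (real \<Rightarrow> real) \<Rightarrow> real \<Rightarrow> real \<Rightarrow> (real \<Rightarrow> real) \<Rightarrow> (real \<Rightarrow> 'a::metric_space) \<Rightarrow> bool" where
  "maximal_geodesic I f a b \<alpha> \<beta> \<longleftrightarrow>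
     (\<forall>s t. a \<le> s \<and> s < t \<and> t \<le> b \<longrightarrow>
        lorentz_length f s t \<alpha> \<beta> = cone_tsep I f (cone_pt I f (\<alpha> s, \<beta> s)) (cone_pt I f (\<alpha> t, \<beta> t))) \<and>
     (\<exists>k. \<forall>s t. a \<le> s \<and> s < t \<and> t \<le> b \<longrightarrow> lorentz_length f s t \<alpha> \<beta> = k * (t - s))"

definition fd_timelike_line ::
    "real set \<Rightarrow> (real \<Rightarrow> real) \<Rightarrow> (real \<Rightarrow> (real \<times> 'a::metric_space) set) \<Rightarrow> bool" where
  "fd_timelike_line I f \<gamma> \<longleftrightarrow>
     (\<exists>\<alpha> \<beta>. (\<forall>t. \<gamma> t = cone_pt I f (\<alpha> t, \<beta> t)) \<and>
        (\<forall>L>0. fd_timelike_curve I f (- L) L \<alpha> \<beta> \<and> maximal_geodesic I f (- L) L \<alpha> \<beta>))"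

text \<open>Standing assumption on generalized cones: \<open>1/f\<close> is not integrable near an endpoint of
  \<open>I\<close> where \<open>f\<close> vanishes.\<close>

definition inverse_nonintegrable_at_zeros :: "real set \<Rightarrow> (real \<Rightarrow> real) \<Rightarrow> bool" where
  "inverse_nonintegrable_at_zeros I f \<longleftrightarrow>
     (\<forall>e\<in>I. f e = 0 \<longrightarrow>
        (\<forall>\<epsilon>>0. (\<integral>\<^sup>+t\<in>I \<inter> {e - \<epsilon><..<e + \<epsilon>}. ennreal (1 / f t) \<partial>lborel) = \<infinity>))"

end

(*
  The line is used only to show that I is the whole real axis: the proper time of a curve is at most
  the difference of its time coordinates, while along the line it grows linearly.  Hence f is
  positive and (t, x) |-> {(t, x)} identifies the cone with the product of the line and X.

  For the rest it suffices to test the curvature condition on the normalized product measures over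
  two slabs [a, a + d] x K and [a + s, a + s + d] x K.  The time separation is at most the difference
  of the time coordinates, with equality only for points over the same point of X, and r^p is concave.
  So translation by s is optimal, and every optimal transport is vertical.  The midpoint measure
  therefore lives on [a + s/2, a + s/2 + d] x K, and Jensen's inequality for N' = N + 1 gives, as
  d tends to 0, that f^(N/(N+1)) is midpoint concave.  A positive function with this property on the
  whole real line is constant.
*)
theory Submission
  imports Defs
begin

section \<open>Lebesgue differentiation on the line\<close>

text \<open>Lengths are integrals of \<open>deriv\<close> and \<open>metric_speed\<close>, which are
  arbitrary values where the limits fail, while absolute continuity only provides an integrable
  bound on distances. Nothing can be said about a length before both limits are known to exist
  almost everywhere and to integrate back to increments and distances; this is why the proof starts
  with Lebesgue differentiation. The time separation causes two more difficulties. It is a supremum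
  that need not be attained, so its equality case cannot look at a maximizing curve; it rests on
  upper bounds for the length that are linear in time increment and spatial distance, with a free
  parameter Q. And it is never shown to be measurable: equality in the transport cost is analysed
  for an arbitrary integrand lying below a measurable one. The slabs carry the uniform measure for
  dt times m, not for the weighted volume, so that a time translation moves one to the other
  although f varies. The weight then sits in the density, which is proportional to f^(-N), and its
  power -1/(N+1) is the origin of the exponent N/(N+1).\<close>

lemma set_integrable_lborel:
  fixes g :: "real \<Rightarrow> real"
  assumes "integrable lborel g" "A \<in> sets borel"
  shows "set_integrable lborel A g"
  unfolding set_integrable_def by (rule integrable_mult_indicator) (use assms in auto)

text \<open>The set G where g < p lies in an open U such that the integral of |g - p| over U - G is
  tiny. By Vitali the exceptional points are covered, up to a null set, by disjoint intervals in U
  on which g has mean above q. Each of them has excess over p at least (q - p) times its length, and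
  all this excess must come from U - G, so the total length is small.\<close>

lemma negligible_upper_density:
  fixes g :: "real \<Rightarrow> real"
  assumes int: "integrable lborel g" and pq: "p < q"
  shows "negligible {t \<in> {-k<..<k}. g t < p \<and>
    (\<forall>d>0. \<exists>u v. u < v \<and> t \<in> {u..v} \<and> v - u < d \<and> q * (v - u) < (LINT r:{u..v}|lborel. g r))}"
    (is "negligible ?E")
  unfolding negligible_outer_le
proof (intro allI impI)
  fix e :: real assume e: "e > 0"
  have [measurable]: "g \<in> borel_measurable borel"
    using int by (simp add: borel_measurable_integrable)
  define G where "G = {t \<in> {-k<..<k}. g t < p}"
  have [measurable]: "G \<in> sets borel" unfolding G_def by measurable
  \<comment> \<open>The cut-off to (-k, k) makes the constant p integrable, so that \<kappa> below
    is a finite measure and outer regularity gives a strict gap.\<close>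
  define h where "h t = indicator {-k<..<k} t * \<bar>g t - p\<bar>" for t
  have hm[measurable]: "h \<in> borel_measurable borel" unfolding h_def by measurable
  have "integrable lborel (indicat_real {-k<..<k})"
    by (cases "-k \<le> k") (simp_all add: integrable_indicator_iff)
  then have "set_integrable lborel {-k<..<k} (\<lambda>t. g t - p)"
    by (intro set_integral_diff(1) integrable_mult_indicator[OF _ int, folded set_integrable_def])
      (auto simp: set_integrable_def)
  then have "integrable lborel (\<lambda>t. \<bar>indicator {-k<..<k} t *\<^sub>R (g t - p)\<bar>)"
    unfolding set_integrable_def by (rule integrable_abs)
  then have hint: "integrable lborel h"
    by (simp add: h_def[abs_def] abs_mult)
  have h0: "h t \<ge> 0" for t unfolding h_def by simp
  define \<kappa> where "\<kappa> = density lborel (\<lambda>t. ennreal (h t))"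
  have fin: "emeasure \<kappa> UNIV \<noteq> \<infinity>"
    unfolding \<kappa>_def using hint h0
    by (subst emeasure_density) (auto simp: nn_integral_eq_integral)
  interpret \<kappa>: finite_measure \<kappa> by standard (use fin in \<open>simp add: \<kappa>_def\<close>)
  \<comment> \<open>The selected intervals will satisfy (q - p) * length <= \<eta>, which makes
    their total length at most e.\<close>
  define \<eta> where "\<eta> = e * (q - p)"
  have \<eta>: "\<eta> > 0" using e pq by (simp add: \<eta>_def)
  have "(INF U \<in> {U. G \<subseteq> U \<and> open U}. emeasure \<kappa> U) < emeasure \<kappa> G + ennreal \<eta>"
    using \<eta> \<kappa>.emeasure_finite by (subst outer_regular[symmetric]) (auto simp: \<kappa>_def less_top ennreal_zero_less_top)
  then obtain U0 where U0: "G \<subseteq> U0" "open U0" "emeasure \<kappa> U0 < emeasure \<kappa> G + ennreal \<eta>"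
    by (auto simp: INF_less_iff)
  define U where "U = U0 \<inter> {-k<..<k}"
  have U: "G \<subseteq> U" "open U" "U \<subseteq> {-k<..<k}" using U0 by (auto simp: U_def G_def)
  have Ub[measurable]: "U \<in> sets borel" using U by auto
  have "emeasure \<kappa> U \<le> emeasure \<kappa> U0" by (rule emeasure_mono) (use U0 in \<open>auto simp: U_def \<kappa>_def\<close>)
  then have lt: "emeasure \<kappa> U < emeasure \<kappa> G + ennreal \<eta>" using U0(3) by simp
  have "measure \<kappa> (U - G) = measure \<kappa> U - measure \<kappa> G"
    by (rule \<kappa>.finite_measure_Diff) (use U in \<open>auto simp: \<kappa>_def\<close>)
  moreover have "measure \<kappa> U < measure \<kappa> G + \<eta>"
    using lt \<eta> by (simp add: \<kappa>.emeasure_eq_measure ennreal_plus[symmetric] ennreal_less_iff del: ennreal_plus)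
  moreover have "measure \<kappa> (U - G) = (LINT t:U-G|lborel. h t)"
    unfolding \<kappa>_def measure_def using h0 hint
    by (subst emeasure_density)
      (auto simp: set_lebesgue_integral_def integral_eq_nn_integral mult.commute ennreal_mult' ennreal_indicator
            intro!: arg_cong[where f=enn2real] nn_integral_cong)
  ultimately have UG: "(LINT t:U-G|lborel. h t) < \<eta>" by simp
  define K where "K = {(u,v). u < v \<and> {u..v} \<subseteq> U \<and> q * (v - u) < (LINT r:{u..v}|lborel. g r)}"
  define c r where "c = (\<lambda>(u,v). (u+v)/2 :: real)" and "r = (\<lambda>(u,v). (v-u)/2 :: real)"
  have cb: "cball (c i) (r i) = {fst i..snd i}" for i
    by (auto simp: c_def r_def cball_eq_atLeastAtMost field_simps split: prod.split)
  obtain C where C: "countable C" "C \<subseteq> K"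
     "pairwise (\<lambda>i j. disjnt (cball (c i) (r i)) (cball (c j) (r j))) C"
     "negligible (?E - (\<Union>i \<in> C. cball (c i) (r i)))"
  proof (rule Vitali_covering_theorem_cballs)
    show "0 < r i" if "i \<in> K" for i using that by (auto simp: K_def r_def)
  next
    fix x d :: real assume x: "x \<in> ?E" and d: "0 < d"
    then have "x \<in> U" using U by (auto simp: G_def)
    then obtain d' where d': "d' > 0" "ball x d' \<subseteq> U" using U(2) open_contains_ball by blast
    obtain u v where uv: "u < v" "x \<in> {u..v}" "v - u < min d d'" "q * (v - u) < (LINT r:{u..v}|lborel. g r)"
      using x d d'(1) by (auto dest!: spec[of _ "min d d'"])
    have "{u..v} \<subseteq> ball x d'" using uv by (auto simp: dist_real_def)
    then have "(u,v) \<in> K" using uv d' by (auto simp: K_def)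
    moreover have "x \<in> cball (c (u,v)) (r (u,v))" unfolding cb using uv by simp
    moreover have "r (u,v) < d" using uv by (auto simp: r_def)
    ultimately show "\<exists>i. i \<in> K \<and> x \<in> cball (c i) (r i) \<and> r i < d" by blast
  qed
  define J where "J i = {fst i..snd i}" for i :: "real \<times> real"
  have disj: "J i \<inter> J j = {}" if "i \<in> C" "j \<in> C" "i \<noteq> j" for i j
    using C(3) that unfolding J_def cb by (auto simp: pairwise_def disjnt_def)
  have bound: "measure lebesgue (\<Union>i\<in>F. J i) \<le> e" if F: "F \<subseteq> C" "finite F" for F
  proof -
    have FK: "fst i < snd i" "J i \<subseteq> U" "q * (snd i - fst i) < (LINT r:J i|lborel. g r)" if "i \<in> F" for i
      using subsetD[OF C(2) subsetD[OF F(1) that]] by (auto simp: K_def J_def split: prod.splits)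
    have dF: "disjoint_family_on J F" unfolding disjoint_family_on_def using disj F(1) by blast
    note si = set_integrable_lborel[OF int]
    have siJ: "set_integrable lborel (J i) (\<lambda>t. g t - p)" for i
      by (intro set_integral_diff si) (auto simp: J_def set_integrable_def integrable_indicator_iff emeasure_lborel_Icc_eq)
    have "measure lebesgue (\<Union>i\<in>F. J i) = (\<Sum>i\<in>F. snd i - fst i)"
    proof -
      have "measure lebesgue (\<Union>i\<in>F. J i) = (\<Sum>i\<in>F. measure lebesgue (J i))"
        by (rule measure_finite_Union) (use F dF in \<open>auto simp: J_def[abs_def] emeasure_lborel_Icc_eq\<close>)
      also have "\<dots> = (\<Sum>i\<in>F. snd i - fst i)"
        by (rule sum.cong) (use FK in \<open>auto simp: J_def less_imp_le\<close>)
      finally show ?thesis .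
    qed
    moreover have "(q - p) * (\<Sum>i\<in>F. snd i - fst i) \<le> (\<Sum>i\<in>F. LINT t:J i|lborel. g t - p)"
    proof (unfold sum_distrib_left, rule sum_mono)
      fix i assume i: "i \<in> F"
      have "(LINT t:J i|lborel. g t - p) = (LINT t:J i|lborel. g t) - p * (snd i - fst i)"
        by (subst set_integral_diff(2)[OF si])
          (use FK[OF i] in \<open>auto simp: J_def set_integrable_def set_lebesgue_integral_def less_imp_le integrable_indicator_iff emeasure_lborel_Icc_eq\<close>)
      then show "(q - p) * (snd i - fst i) \<le> (LINT t:J i|lborel. g t - p)"
        using FK(3)[OF i] by (simp add: algebra_simps)
    qed
    moreover have "(\<Sum>i\<in>F. LINT t:J i|lborel. g t - p) = (LINT t:(\<Union>i\<in>F. J i)|lborel. g t - p)"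
      by (rule set_integral_finite_Union[symmetric]) (use F dF siJ in \<open>auto simp: J_def[abs_def]\<close>)
    \<comment> \<open>On G the integrand g - p is negative, so discarding G can only increase the
      integral.\<close>
    moreover have "(LINT t:(\<Union>i\<in>F. J i)|lborel. g t - p) \<le> (LINT t:U-G|lborel. h t)"
      unfolding set_lebesgue_integral_def
    proof (rule integral_mono)
      show "integrable lborel (\<lambda>x. indicat_real (\<Union> (J ` F)) x *\<^sub>R (g x - p))"
        using set_integrable_UN[of F lborel J "\<lambda>t. g t - p"] F siJ by (auto simp: set_integrable_def J_def)
      show "integrable lborel (\<lambda>x. indicat_real (U - G) x *\<^sub>R h x)"
        by (rule integrable_mult_indicator) (use hint in auto)
      fix t
      show "indicat_real (\<Union> (J ` F)) t *\<^sub>R (g t - p) \<le> indicat_real (U - G) t *\<^sub>R h t"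
      proof (cases "t \<in> \<Union>(J ` F)")
        case True
        then have "t \<in> U" using FK by blast
        then show ?thesis using True U(3) by (auto simp: G_def h_def indicator_def)
      qed (use h0 in auto)
    qed
    ultimately have "(q - p) * measure lebesgue (\<Union>i\<in>F. J i) \<le> \<eta>" using UG by simp
    then show ?thesis using pq by (simp add: \<eta>_def mult.commute)
  qed
  have bound': "measure lebesgue (\<Union>\<E>) \<le> e" if "\<E> \<subseteq> J ` C" "finite \<E>" for \<E>
    using that bound by (metis finite_subset_image)
  have Jl: "D \<in> lmeasurable" if "D \<in> J ` C" for D using that by (auto simp: J_def)
  have M: "\<Union>(J`C) \<in> lmeasurable" "measure lebesgue (\<Union>(J`C)) \<le> e"
    by (rule fmeasurable_Union_bound, use bound' C(1) Jl in auto)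
      (rule measure_Union_bound, use bound' C(1) Jl in auto)
  define Nn where "Nn = ?E - \<Union>(J`C)"
  have Nn: "negligible Nn" using C(4) unfolding cb J_def Nn_def .
  show "\<exists>T. ?E \<subseteq> T \<and> T \<in> lmeasurable \<and> measure lebesgue T \<le> e"
  proof (intro exI[of _ "\<Union>(J`C) \<union> Nn"] conjI)
    show "?E \<subseteq> \<Union>(J`C) \<union> Nn" by (auto simp: Nn_def)
    show "\<Union>(J`C) \<union> Nn \<in> lmeasurable" using M Nn negligible_imp_measurable by (intro fmeasurable.Un) auto
    show "measure lebesgue (\<Union>(J`C) \<union> Nn) \<le> e"
      using M Nn by (simp add: measure_Un_null_set negligible_iff_null_sets fmeasurableD)
  qed
qed

text \<open>If the means overshoot g t + \<epsilon> at arbitrarily small scales, then t is an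
  exceptional point of the previous lemma for some rational p < q between g t and g t + \<epsilon>
  and some natural k, hence lies in a countable union of null sets.\<close>

lemma lebesgue_differentiation_upper:
  fixes g :: "real \<Rightarrow> real"
  assumes int: "integrable lborel g"
  shows "AE t in lborel. \<forall>\<epsilon>>0. \<exists>d>0. \<forall>u v. u < v \<and> t \<in> {u..v} \<and> v - u < d \<longrightarrow>
    (LINT r:{u..v}|lborel. g r) \<le> (g t + \<epsilon>) * (v - u)"
proof -
  define E where "E k p q = {t \<in> {-k<..<k}. g t < p \<and>
    (\<forall>d>0. \<exists>u v. u < v \<and> t \<in> {u..v} \<and> v - u < d \<and> q * (v - u) < (LINT r:{u..v}|lborel. g r))}" for k p q
  define I where "I = {(k :: nat, p, q). p \<in> \<rat> \<and> q \<in> \<rat> \<and> p < (q::real)}"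
  have "countable ((UNIV :: nat set) \<times> (\<rat> :: real set) \<times> (\<rat> :: real set))"
    by (intro countable_SIGMA) (auto simp: countable_rat)
  then have "countable I" by (rule countable_subset[rotated]) (auto simp: I_def)
  then have "negligible (\<Union>((\<lambda>(k, p, q). E (real k) p q) ` I))"
    by (intro negligible_countable_Union)
      (unfold I_def E_def, auto intro!: negligible_upper_density[OF int] simp del: greaterThanLessThan_iff atLeastAtMost_iff)
  then have "AE t in lebesgue. t \<notin> \<Union>((\<lambda>(k, p, q). E (real k) p q) ` I)"
    by (intro AE_not_in) (simp add: negligible_iff_null_sets)
  then have "AE t in lborel. t \<notin> \<Union>((\<lambda>(k, p, q). E (real k) p q) ` I)"
    by (simp add: AE_completion_iff)
  then show ?thesis
  proof (eventually_elim, intro allI impI)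
    fix t \<epsilon> :: real assume t: "t \<notin> \<Union>((\<lambda>(k, p, q). E (real k) p q) ` I)" and e: "\<epsilon> > 0"
    obtain q where q: "q \<in> \<rat>" "g t < q" "q < g t + \<epsilon>" using Rats_dense_in_real[of "g t" "g t + \<epsilon>"] e by auto
    obtain p where p: "p \<in> \<rat>" "g t < p" "p < q" using Rats_dense_in_real[of "g t" q] q by auto
    obtain k :: nat where k: "\<bar>t\<bar> < real k" using reals_Archimedean2 by blast
    have "t \<notin> E (real k) p q" using t p q by (auto simp: I_def)
    then obtain d where d: "d > 0" "\<And>u v. u < v \<Longrightarrow> t \<in> {u..v} \<Longrightarrow> v - u < d \<Longrightarrow> \<not> q * (v - u) < (LINT r:{u..v}|lborel. g r)"
      using k p unfolding E_def by auto
    show "\<exists>d>0. \<forall>u v. u < v \<and> t \<in> {u..v} \<and> v - u < d \<longrightarrow> (LINT r:{u..v}|lborel. g r) \<le> (g t + \<epsilon>) * (v - u)"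
    proof (intro exI[of _ d] conjI allI impI d(1))
      fix u v assume uv: "u < v \<and> t \<in> {u..v} \<and> v - u < d"
      then have "(LINT r:{u..v}|lborel. g r) \<le> q * (v - u)" using d(2)[of u v] by auto
      also have "\<dots> \<le> (g t + \<epsilon>) * (v - u)" using q uv by (intro mult_right_mono) auto
      finally show "(LINT r:{u..v}|lborel. g r) \<le> (g t + \<epsilon>) * (v - u)" .
    qed
  qed
qed

text \<open>The intervals need not be centred at t; having t as an endpoint is the case needed for
  difference quotients.\<close>

definition lebesgue_point :: "(real \<Rightarrow> real) \<Rightarrow> real \<Rightarrow> bool" where
  "lebesgue_point g t \<longleftrightarrow> (\<forall>\<epsilon>>0. \<exists>d>0. \<forall>u v. u < v \<and> t \<in> {u..v} \<and> v - u < d \<longrightarrow>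
    \<bar>(LINT r:{u..v}|lborel. g r) - g t * (v - u)\<bar> \<le> \<epsilon> * (v - u))"

lemma AE_lebesgue_point:
  assumes int: "integrable lborel g"
  shows "AE t in lborel. lebesgue_point g t"
  unfolding lebesgue_point_def
  using lebesgue_differentiation_upper[OF int]
    lebesgue_differentiation_upper[OF integrable_minus[OF int]]
proof (eventually_elim, intro allI impI)
  fix t \<epsilon> :: real
  assume *: "\<forall>\<epsilon>>0. \<exists>d>0. \<forall>u v. u < v \<and> t \<in> {u..v} \<and> v - u < d \<longrightarrow>
      (LINT r:{u..v}|lborel. g r) \<le> (g t + \<epsilon>) * (v - u)"
    "\<forall>\<epsilon>>0. \<exists>d>0. \<forall>u v. u < v \<and> t \<in> {u..v} \<and> v - u < d \<longrightarrow>
      (LINT r:{u..v}|lborel. - g r) \<le> (- g t + \<epsilon>) * (v - u)"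
    and e: "\<epsilon> > 0"
  obtain d where d: "d > 0" "\<And>u v. u < v \<and> t \<in> {u..v} \<and> v - u < d \<Longrightarrow>
      (LINT r:{u..v}|lborel. g r) \<le> (g t + \<epsilon>) * (v - u)" using *(1) e by metis
  obtain d' where d': "d' > 0" "\<And>u v. u < v \<and> t \<in> {u..v} \<and> v - u < d' \<Longrightarrow>
      (LINT r:{u..v}|lborel. - g r) \<le> (- g t + \<epsilon>) * (v - u)" using *(2) e by metis
  show "\<exists>d>0. \<forall>u v. u < v \<and> t \<in> {u..v} \<and> v - u < d \<longrightarrow>
    \<bar>(LINT r:{u..v}|lborel. g r) - g t * (v - u)\<bar> \<le> \<epsilon> * (v - u)"
  proof (intro exI[of _ "min d d'"] conjI allI impI)
    fix u v assume "u < v \<and> t \<in> {u..v} \<and> v - u < min d d'"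
    then have "(LINT r:{u..v}|lborel. g r) \<le> (g t + \<epsilon>) * (v - u)"
      "(LINT r:{u..v}|lborel. - g r) \<le> (- g t + \<epsilon>) * (v - u)" using d(2) d'(2) by auto
    then show "\<bar>(LINT r:{u..v}|lborel. g r) - g t * (v - u)\<bar> \<le> \<epsilon> * (v - u)"
      by (simp add: set_lebesgue_integral_def algebra_simps abs_le_iff)
  qed (use d d' in auto)
qed

section \<open>Functions with integrably bounded increments are indefinite integrals\<close>

lemma set_lborel_integral_Ioc_Icc:
  fixes g :: "real \<Rightarrow> real"
  assumes "g \<in> borel_measurable borel"
  shows "(LINT r:{s<..t}|lborel. g r) = (LINT r:{s..t}|lborel. g r)"
proof (rule set_integral_cong_set)
  show "AE x in lborel. (x \<in> {s..t}) = (x \<in> {s<..t})"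
    using AE_lborel_singleton[of s] by eventually_elim auto
qed (use assms in \<open>auto simp: set_borel_measurable_def\<close>)

lemma set_lborel_integral_Icc_split:
  fixes g :: "real \<Rightarrow> real"
  assumes "set_integrable lborel {a..c} g" "a \<le> b" "b \<le> c" and m: "g \<in> borel_measurable borel"
  shows "(LINT r:{a..c}|lborel. g r) = (LINT r:{a..b}|lborel. g r) + (LINT r:{b..c}|lborel. g r)"
proof -
  have "{a..c} = {a..b} \<union> {b<..c}" using assms by auto
  then have "(LINT r:{a..c}|lborel. g r) = (LINT r:{a..b}|lborel. g r) + (LINT r:{b<..c}|lborel. g r)"
    using assms by (auto intro!: set_integral_Un set_integrable_subset[OF assms(1)])
  then show ?thesis using set_lborel_integral_Ioc_Icc[OF m] by simp
qed

text \<open>Continuity of the indefinite integral at s. It later yields right continuity of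
  distribution functions and continuity of absolutely continuous curves.\<close>

lemma small_set_integral:
  fixes g :: "real \<Rightarrow> real"
  assumes int: "integrable lborel g" and g0: "\<And>t. g t \<ge> 0" and e: "e > 0"
  obtains d where "d > 0" "\<And>u v. s \<in> {u..v} \<Longrightarrow> v - u < d \<Longrightarrow> (LINT r:{u..v}|lborel. g r) < e"
proof -
  have m: "g \<in> borel_measurable borel"
    using int by (simp add: borel_measurable_integrable)
  define G where "G x = (LINT r:{s-1..x}|lborel. g r)" for x
  have io: "g integrable_on {s-1..s+1}"
    by (rule set_borel_integral_eq_integral) (use set_integrable_lborel[OF int] in auto)
  have "continuous_on {s-1..s+1} (\<lambda>x. integral {s-1..x} g)"
    by (rule indefinite_integral_continuous_1[OF io])
  moreover have "integral {s-1..x} g = G x" for x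
    unfolding G_def using set_borel_integral_eq_integral(2)[OF set_integrable_lborel[OF int]] by simp
  ultimately have "continuous_on {s-1..s+1} G" by simp
  then obtain d where d: "d > 0" "\<And>x. x \<in> {s-1..s+1} \<Longrightarrow> dist x s < d \<Longrightarrow> dist (G x) (G s) < e/2"
    unfolding continuous_on_iff using e by (metis add_cancel_right_left atLeastAtMost_iff diff_add_cancel diff_le_eq half_gt_zero le_add_same_cancel1 zero_less_one_class.zero_le_one)
  show thesis
  proof (rule that[of "min d 1"])
    fix u v assume uv: "s \<in> {u..v}" "v - u < min d 1"
    then have *: "dist (G v) (G s) < e/2" "dist (G u) (G s) < e/2"
      using d(2)[of v] d(2)[of u] by (auto simp: dist_real_def)
    have "G v = G u + (LINT r:{u..v}|lborel. g r)"
      unfolding G_def by (rule set_lborel_integral_Icc_split)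
        (use uv set_integrable_lborel[OF int] m in auto)
    then show "(LINT r:{u..v}|lborel. g r) < e" using * unfolding dist_real_def by linarith
  qed (use d in auto)
qed

text \<open>The measures with distribution functions \<open>\<integral>g + \<phi>\<close> and \<open>\<integral>g - \<phi>\<close> add up to the measure with
  density \<open>2g\<close>, so the first of them has a Radon-Nikodym density.\<close>

lemma integral_representation_nonneg:
  fixes \<phi> g :: "real \<Rightarrow> real"
  assumes int: "integrable lborel g" and g0: "\<And>t. g t \<ge> 0"
    and le: "\<And>s t. s \<le> t \<Longrightarrow> \<bar>\<phi> t - \<phi> s\<bar> \<le> (LINT r:{s..t}|lborel. g r)"
  shows "\<exists>w. integrable lborel w \<and> (\<forall>s t. s \<le> t \<longrightarrow> \<phi> t - \<phi> s = (LINT r:{s..t}|lborel. w r))"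
proof -
  have [measurable]: "g \<in> borel_measurable borel"
    using int by (simp add: borel_measurable_integrable)
  note si = set_integrable_lborel[OF int]
  define G where "G t = (LINT r:{..t}|lborel. g r)" for t
  have G: "G t - G s = (LINT r:{s..t}|lborel. g r)" if "s \<le> t" for s t
  proof -
    have "{..t} = {..s} \<union> {s<..t}" using that by auto
    then have "G t = G s + (LINT r:{s<..t}|lborel. g r)" unfolding G_def
      using that by (auto intro!: set_integral_Un si)
    then show ?thesis by (simp add: set_lborel_integral_Ioc_Icc)
  qed
  \<comment> \<open>Used for c = 1 and c = -1; the bound on the increments of \<phi> makes both
    functions nondecreasing.\<close>
  define F where "F c t = G t + c * \<phi> t" for c t :: real
  have Fle: "\<bar>c * \<phi> t - c * \<phi> s\<bar> \<le> G t - G s" if "s \<le> t" "\<bar>c\<bar> = 1" for c s t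
    using le[OF that(1)] G[OF that(1)] that(2) by (auto simp: right_diff_distrib[symmetric] abs_mult)
  have Fmono: "F c s \<le> F c t" if "s \<le> t" "\<bar>c\<bar> = 1" for c s t
    using Fle[OF that] by (simp add: F_def abs_le_iff)
  have Fc: "continuous (at_right a) (F c)" if "\<bar>c\<bar> = 1" for a c
    unfolding continuous_within tendsto_iff
  proof (intro allI impI)
    fix e :: real assume "0 < e"
    then obtain b where b: "b > 0" "\<And>u v. a \<in> {u..v} \<Longrightarrow> v - u < b \<Longrightarrow> (LINT r:{u..v}|lborel. g r) < e/2"
      using small_set_integral[OF int g0, of "e/2" a] by auto
    show "\<forall>\<^sub>F x in at_right a. dist (F c x) (F c a) < e"
      unfolding eventually_at_right_field
    proof (intro exI[of _ "a + b"] conjI allI impI)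
      fix x assume x: "a < x" "x < a + b"
      have "G x - G a < e/2" using b(2)[of a x] G[of a x] x by simp
      then show "dist (F c x) (F c a) < e"
        using Fle[of a x c] that x by (simp add: F_def dist_real_def)
    qed (use b in simp)
  qed
  define \<nu> where "\<nu> c = interval_measure (F c)" for c
  define \<kappa> where "\<kappa> = density lborel (\<lambda>t. ennreal (2 * g t))"
  have \<nu>Ioc: "emeasure (\<nu> c) {s<..t} = ennreal (F c t - F c s)" if "s \<le> t" "\<bar>c\<bar> = 1" for c s t
    unfolding \<nu>_def by (rule emeasure_interval_measure_Ioc) (use that Fmono Fc in auto)
  have \<kappa>Ioc: "emeasure \<kappa> {s<..t} = ennreal (2 * (G t - G s))" if "s \<le> t" for s t
  proof -
    have "emeasure \<kappa> {s<..t} = (\<integral>\<^sup>+x. ennreal (indicator {s<..t} x *\<^sub>R (2 * g x)) \<partial>lborel)"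
      unfolding \<kappa>_def by (subst emeasure_density) (auto intro!: nn_integral_cong simp: indicator_def)
    also have "\<dots> = ennreal (LINT x:{s<..t}|lborel. 2 * g x)"
      unfolding set_lebesgue_integral_def
      by (rule nn_integral_eq_integral) (use integrable_mult_right[OF si[of "{s<..t}", unfolded set_integrable_def], of 2] g0 in \<open>auto simp: ac_simps\<close>)
    also have "(LINT x:{s<..t}|lborel. 2 * g x) = 2 * (G t - G s)"
      using that by (simp add: G set_lborel_integral_Ioc_Icc)
    finally show ?thesis .
  qed
  have \<kappa>fin: "emeasure \<kappa> UNIV < \<infinity>"
    unfolding \<kappa>_def using int g0
    by (subst emeasure_density) (auto simp: nn_integral_eq_integral less_top[symmetric])
  have basic: "emeasure (\<nu> 1) {s<..t} + emeasure (\<nu> (-1)) {s<..t} = emeasure \<kappa> {s<..t}" for s t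
  proof (cases "s \<le> t")
    case True
    then show ?thesis using Fmono[OF True, of 1] Fmono[OF True, of "-1"]
      by (simp add: \<nu>Ioc \<kappa>Ioc ennreal_plus[symmetric] del: ennreal_plus) (simp add: F_def)
  qed simp
  have sets_eq[simp]: "sets (\<nu> c) = sets borel" "sets \<kappa> = sets borel" "space (\<nu> c) = UNIV" "space \<kappa> = UNIV" for c
    by (auto simp: \<nu>_def \<kappa>_def)
  have total: "emeasure (\<nu> 1) UNIV + emeasure (\<nu> (-1)) UNIV = emeasure \<kappa> UNIV"
  proof -
    have lim: "(\<lambda>n. emeasure M {-real n<..real n}) \<longlonglongrightarrow> emeasure M UNIV" if "sets M = sets borel" for M
    proof -
      have "(\<Union>n. {-real n<..real n}) = UNIV"
      proof (intro set_eqI iffI UNIV_I)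
        fix x :: real
        obtain n :: nat where "\<bar>x\<bar> < real n" using reals_Archimedean2 by blast
        then show "x \<in> (\<Union>n. {-real n<..real n})" by (intro UN_I[of n]) auto
      qed
      moreover have "incseq (\<lambda>n. {-real n<..real n})" unfolding incseq_def by force
      ultimately show ?thesis using Lim_emeasure_incseq[of "\<lambda>n. {-real n<..real n}" M] that by (simp add: image_subset_iff)
    qed
    have "(\<lambda>n. emeasure \<kappa> {-real n<..real n}) \<longlonglongrightarrow> emeasure (\<nu> 1) UNIV + emeasure (\<nu> (-1)) UNIV"
      unfolding basic[symmetric] by (intro tendsto_add lim) auto
    then show ?thesis using lim[of \<kappa>] LIMSEQ_unique by auto
  qed
  \<comment> \<open>Half-open intervals form an intersection-stable generator, so their equality
    extends to all Borel sets. The complement case subtracts and therefore needs the total masses to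
    agree and to be finite.\<close>
  have sum: "emeasure (\<nu> 1) A + emeasure (\<nu> (-1)) A = emeasure \<kappa> A" if "A \<in> sets borel" for A
  proof -
    have "Int_stable (range (\<lambda>(a, b). {a<..b::real}))"
      by (auto simp: Int_stable_def)
    moreover have "range (\<lambda>(a, b). {a<..b::real}) \<subseteq> Pow UNIV" by simp
    moreover have "A \<in> sigma_sets UNIV (range (\<lambda>(a, b). {a <.. b::real}))"
      using that by (simp add: borel_sigma_sets_Ioc)
    ultimately show ?thesis
    proof (induction rule: sigma_sets_induct_disjoint)
      case (compl B)
      have B: "B \<in> sets borel" using compl(1) by (simp add: borel_sigma_sets_Ioc)
      have fin: "emeasure (\<nu> 1) B \<noteq> \<infinity>" "emeasure (\<nu> (-1)) B \<noteq> \<infinity>" "emeasure \<kappa> B \<noteq> \<infinity>"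
      proof -
        have "emeasure \<kappa> B \<le> emeasure \<kappa> UNIV" by (rule emeasure_mono) auto
        then show 1: "emeasure \<kappa> B \<noteq> \<infinity>" using \<kappa>fin by (auto simp: less_top[symmetric] top_unique)
        show "emeasure (\<nu> 1) B \<noteq> \<infinity>" "emeasure (\<nu> (-1)) B \<noteq> \<infinity>" using 1 compl(2)[symmetric] by auto
      qed
      have c: "emeasure M (UNIV - B) = emeasure M UNIV - emeasure M B" if "sets M = sets borel" "emeasure M B \<noteq> \<infinity>" for M :: "real measure"
        using emeasure_compl[of B M] that B sets_eq_imp_space_eq[OF that(1)] by simp
      have *: "emeasure (\<nu> d) B \<le> emeasure (\<nu> d) UNIV" for d by (rule emeasure_mono) auto
      have fin': "emeasure (\<nu> 1) UNIV \<noteq> \<infinity>" "emeasure (\<nu> (-1)) UNIV \<noteq> \<infinity>"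
        using \<kappa>fin total[symmetric] by auto
      have "emeasure (\<nu> 1) UNIV - emeasure (\<nu> 1) B + (emeasure (\<nu> (-1)) UNIV - emeasure (\<nu> (-1)) B)
         = emeasure (\<nu> 1) UNIV + emeasure (\<nu> (-1)) UNIV - (emeasure (\<nu> 1) B + emeasure (\<nu> (-1)) B)"
        using *[of 1] *[of "-1"] fin fin'
        by (cases "emeasure (\<nu> 1) UNIV"; cases "emeasure (\<nu> (-1)) UNIV"; cases "emeasure (\<nu> 1) B"; cases "emeasure (\<nu> (-1)) B")
          (auto simp: ennreal_minus ennreal_plus[symmetric] simp del: ennreal_plus)
      then show ?case using c fin total compl(2) by simp
    next
      case (union A)
      then have "range A \<subseteq> sets borel" by (simp add: borel_sigma_sets_Ioc)
      then have "emeasure M (\<Union>i. A i) = (\<Sum>i. emeasure M (A i))" if "sets M = sets borel" for M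
        using suminf_emeasure[of A M] union(1) that by simp
      then show ?case using union(3) by (simp add: suminf_add)
    qed (use basic in auto)
  qed
  \<comment> \<open>\<open>sum\<close> shows that the measure is dominated by \<kappa>, which has a
    density.\<close>
  have "absolutely_continuous lborel (\<nu> 1)"
    unfolding absolutely_continuous_def
  proof
    fix A :: "real set" assume A: "A \<in> null_sets lborel"
    then have "A \<in> null_sets \<kappa>" unfolding \<kappa>_def
      by (subst null_sets_density_iff) (auto dest: AE_not_in)
    then show "A \<in> null_sets (\<nu> 1)" using sum[of A] by (auto simp: null_sets_def)
  qed
  then obtain f where f[measurable]: "f \<in> borel_measurable lborel" and fd: "density lborel f = \<nu> 1"
    using sigma_finite_measure.Radon_Nikodym[OF sigma_finite_lborel, of "\<nu> 1"] by auto
  have fin: "(\<integral>\<^sup>+x. f x \<partial>lborel) \<noteq> \<infinity>"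
  proof -
    have "(\<integral>\<^sup>+x. f x \<partial>lborel) = emeasure (density lborel f) UNIV" by (subst emeasure_density) auto
    also have "\<dots> \<le> emeasure \<kappa> UNIV" unfolding fd total[symmetric] by simp
    finally show ?thesis using \<kappa>fin by (auto simp: less_top[symmetric] top_unique)
  qed
  then have ff: "AE x in lborel. f x \<noteq> \<infinity>" by (intro nn_integral_noteq_infinite) auto
  define w where "w x = enn2real (f x)" for x
  have [measurable]: "w \<in> borel_measurable borel" unfolding w_def using f by measurable
  have wf: "AE x in lborel. ennreal (w x) = f x"
    using ff by eventually_elim (simp add: w_def less_top)
  have wint: "integrable lborel w"
  proof (rule integrableI_nonneg)
    have "(\<integral>\<^sup>+x. ennreal (w x) \<partial>lborel) = (\<integral>\<^sup>+x. f x \<partial>lborel)" by (rule nn_integral_cong_AE[OF wf])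
    then show "(\<integral>\<^sup>+x. ennreal (w x) \<partial>lborel) < \<infinity>" using fin by (simp add: less_top)
  qed (auto simp: w_def)
  note siw = set_integrable_lborel[OF wint]
  have F1: "F 1 t - F 1 s = (LINT r:{s..t}|lborel. w r)" if "s \<le> t" for s t
  proof -
    have "ennreal (F 1 t - F 1 s) = emeasure (density lborel f) {s<..t}" using \<nu>Ioc[OF that, of 1] fd by simp
    also have "\<dots> = (\<integral>\<^sup>+x. f x * indicator {s<..t} x \<partial>lborel)" by (subst emeasure_density) auto
    also have "\<dots> = (\<integral>\<^sup>+x. ennreal (indicator {s<..t} x *\<^sub>R w x) \<partial>lborel)"
      by (rule nn_integral_cong_AE) (use wf in \<open>eventually_elim, auto simp: indicator_def\<close>)
    also have "\<dots> = ennreal (LINT x:{s<..t}|lborel. w x)"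
      unfolding set_lebesgue_integral_def
      by (rule nn_integral_eq_integral) (use siw[of "{s<..t}"] in \<open>auto simp: set_integrable_def w_def\<close>)
    finally have "F 1 t - F 1 s = (LINT x:{s<..t}|lborel. w x)"
      using Fmono[OF that, of 1] by (subst (asm) ennreal_inj) (auto simp: set_lebesgue_integral_def w_def intro!: integral_nonneg_AE)
    then show ?thesis using wint by (simp add: set_lborel_integral_Ioc_Icc borel_measurable_integrable)
  qed
  \<comment> \<open>w is the density belonging to G + \<phi>, hence g has to be subtracted to
    represent \<phi>.\<close>
  show ?thesis
  proof (intro exI[of _ "\<lambda>x. w x - g x"] conjI allI impI)
    fix s t :: real assume st: "s \<le> t"
    have "\<phi> t - \<phi> s = (F 1 t - F 1 s) - (G t - G s)" by (simp add: F_def)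
    also have "\<dots> = (LINT r:{s..t}|lborel. w r - g r)"
      using F1[OF st] G[OF st] by (subst set_integral_diff(2)) (auto intro: si siw)
    finally show "\<phi> t - \<phi> s = (LINT r:{s..t}|lborel. w r - g r)" .
  qed (use wint int in auto)
qed

section \<open>Absolutely continuous curves\<close>

lemma lebesgue_pointE:
  assumes "lebesgue_point g t" "\<epsilon> > 0"
  obtains d where "d > 0" "\<And>s. s \<noteq> t \<Longrightarrow> \<bar>s - t\<bar> < d \<Longrightarrow>
    \<bar>(LINT r:{min s t..max s t}|lborel. g r) - g t * \<bar>s - t\<bar>\<bar> \<le> \<epsilon> * \<bar>s - t\<bar>"
proof -
  obtain d where d: "d > 0" and *: "\<And>u v. u < v \<Longrightarrow> t \<in> {u..v} \<Longrightarrow> v - u < d \<Longrightarrow>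
    \<bar>(LINT r:{u..v}|lborel. g r) - g t * (v - u)\<bar> \<le> \<epsilon> * (v - u)"
    using assms(1)[unfolded lebesgue_point_def, rule_format, OF assms(2)] by meson
  show thesis
  proof (rule that[OF d])
    fix s assume s: "s \<noteq> t" "\<bar>s - t\<bar> < d"
    have "max s t - min s t = \<bar>s - t\<bar>" by auto
    then show "\<bar>(LINT r:{min s t..max s t}|lborel. g r) - g t * \<bar>s - t\<bar>\<bar> \<le> \<epsilon> * \<bar>s - t\<bar>"
      using *[of "min s t" "max s t"] s by auto
  qed
qed

lemma set_integral_mono_lborel:
  fixes f g :: "real \<Rightarrow> real"
  assumes "integrable lborel f" "integrable lborel g" "\<And>t. f t \<le> g t" "A \<in> sets borel"
  shows "(LINT t:A|lborel. f t) \<le> (LINT t:A|lborel. g t)"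
  by (rule set_integral_mono) (use assms set_integrable_lborel in auto)

lemma set_integral_nonneg_lborel:
  fixes g :: "real \<Rightarrow> real"
  assumes "\<And>t. 0 \<le> g t"
  shows "0 \<le> (LINT t:A|lborel. g t)"
  using assms by (auto simp: set_lebesgue_integral_def intro!: integral_nonneg_AE)

lemma set_integral_mono_set_lborel:
  fixes g :: "real \<Rightarrow> real"
  assumes "integrable lborel g" "\<And>t. 0 \<le> g t" "A \<subseteq> B" "A \<in> sets borel" "B \<in> sets borel"
  shows "(LINT t:A|lborel. g t) \<le> (LINT t:B|lborel. g t)"
  unfolding set_lebesgue_integral_def
  by (rule integral_mono)
    (use assms set_integrable_lborel[OF assms(1)] in \<open>auto simp: set_integrable_def indicator_def\<close>)

lemma abs_set_integral_le_lborel: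
  fixes g h :: "real \<Rightarrow> real"
  assumes "integrable lborel g" "integrable lborel h" "AE t in lborel. \<bar>g t\<bar> \<le> h t" "A \<in> sets borel"
  shows "\<bar>LINT t:A|lborel. g t\<bar> \<le> (LINT t:A|lborel. h t)"
proof -
  have "\<bar>LINT t:A|lborel. g t\<bar> \<le> (LINT t:A|lborel. \<bar>g t\<bar>)"
    using integral_abs_bound[of lborel "\<lambda>t. indicator A t *\<^sub>R g t"]
    by (simp add: set_lebesgue_integral_def abs_mult)
  also have "\<dots> \<le> (LINT t:A|lborel. h t)"
    unfolding set_lebesgue_integral_def
    by (rule integral_mono_AE)
      (use assms set_integrable_lborel[OF _ assms(4)] in \<open>auto simp: set_integrable_def indicator_def\<close>)
  finally show ?thesis .
qed

text \<open>A relation that includes existence of the limit, which an equation with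
  \<open>metric_speed\<close> would not assert.\<close>

definition has_metric_speed :: "(real \<Rightarrow> 'a::metric_space) \<Rightarrow> real \<Rightarrow> real \<Rightarrow> bool" where
  "has_metric_speed \<gamma> m t \<longleftrightarrow> ((\<lambda>s. dist (\<gamma> s) (\<gamma> t) / \<bar>s - t\<bar>) \<longlongrightarrow> m) (at t)"

text \<open>Precomposition with this projection onto [a, b] extends a curve constantly to the whole
  line, where the integral representation is stated.\<close>

definition clamp_to :: "real \<Rightarrow> real \<Rightarrow> real \<Rightarrow> real" where
  "clamp_to a b t = max a (min b t)"

lemma clamp_to_id [simp]: "t \<in> {a..b} \<Longrightarrow> clamp_to a b t = t"
  by (auto simp: clamp_to_def)

lemma abs_cont_curve_extend:
  assumes ac: "abs_cont_curve a b \<gamma>" and ab: "a \<le> b"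
  obtains g where "integrable lborel g" "\<And>t. 0 \<le> g t"
    "\<And>s t. s \<le> t \<Longrightarrow> dist (\<gamma> (clamp_to a b s)) (\<gamma> (clamp_to a b t)) \<le> (LINT r:{s..t}|lborel. g r)"
proof -
  obtain g where g: "set_integrable lborel {a..b} g"
    "\<And>s t. a \<le> s \<Longrightarrow> s \<le> t \<Longrightarrow> t \<le> b \<Longrightarrow> dist (\<gamma> s) (\<gamma> t) \<le> (LINT r:{s..t}|lborel. g r)"
    using ac unfolding abs_cont_curve_def by blast
  define h where "h t = \<bar>indicator {a..b} t *\<^sub>R g t\<bar>" for t
  have h: "integrable lborel h" unfolding h_def
    by (rule integrable_abs) (use g in \<open>simp add: set_integrable_def\<close>)
  have h0: "h t \<ge> 0" for t by (simp add: h_def)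
  show thesis
  proof (rule that[OF h h0])
    fix s t :: real assume st: "s \<le> t"
    let ?c = "clamp_to a b"
    show "dist (\<gamma> (?c s)) (\<gamma> (?c t)) \<le> (LINT r:{s..t}|lborel. h r)"
    proof (cases "?c s = ?c t")
      case True
      then show ?thesis using set_integral_nonneg_lborel[of h, OF h0] by simp
    next
      case False
      then have c: "a \<le> ?c s" "?c s \<le> ?c t" "?c t \<le> b" "{?c s..?c t} \<subseteq> {s..t}"
        using st ab by (auto simp: clamp_to_def max_def min_def split: if_splits)
      have "dist (\<gamma> (?c s)) (\<gamma> (?c t)) \<le> (LINT r:{?c s..?c t}|lborel. g r)"
        using c by (intro g)
      also have "\<dots> = (LINT r:{?c s..?c t}|lborel. indicator {a..b} r *\<^sub>R g r)"
        unfolding set_lebesgue_integral_def using c by (intro Bochner_Integration.integral_cong) (auto simp: indicator_def)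
      also have "\<dots> \<le> (LINT r:{?c s..?c t}|lborel. h r)"
        by (rule set_integral_mono_lborel) (use g h in \<open>auto simp: set_integrable_def h_def\<close>)
      also have "\<dots> \<le> (LINT r:{s..t}|lborel. h r)"
        by (rule set_integral_mono_set_lborel) (use h h0 c in auto)
      finally show ?thesis .
    qed
  qed
qed

lemma abs_cont_curve_derivative:
  fixes \<alpha> :: "real \<Rightarrow> real"
  assumes ac: "abs_cont_curve a b \<alpha>" and ab: "a \<le> b"
  obtains w where "integrable lborel w"
    "AE t\<in>{a..b} in lborel. (\<alpha> has_real_derivative w t) (at t)"
    "\<And>s t. a \<le> s \<Longrightarrow> s \<le> t \<Longrightarrow> t \<le> b \<Longrightarrow> \<alpha> t - \<alpha> s = (LINT r:{s..t}|lborel. w r)"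
proof -
  obtain g where g: "integrable lborel g" "\<And>t. 0 \<le> g t"
    "\<And>s t. s \<le> t \<Longrightarrow> dist (\<alpha> (clamp_to a b s)) (\<alpha> (clamp_to a b t)) \<le> (LINT r:{s..t}|lborel. g r)"
    using abs_cont_curve_extend[OF ac ab] by metis
  obtain w where w: "integrable lborel w"
    and *: "\<And>s t. s \<le> t \<Longrightarrow> \<alpha> (clamp_to a b t) - \<alpha> (clamp_to a b s) = (LINT r:{s..t}|lborel. w r)"
    using integral_representation_nonneg[OF g(1,2), of "\<alpha> \<circ> clamp_to a b"] g(3)
    by (auto simp: dist_real_def abs_minus_commute)
  have eq: "\<alpha> t - \<alpha> s = (LINT r:{s..t}|lborel. w r)" if "a \<le> s" "s \<le> t" "t \<le> b" for s t
    using *[of s t] that by simp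
  \<comment> \<open>The curve is arbitrary outside [a, b], so two-sided limits may fail at the
    endpoints; these are discarded as null sets.\<close>
  have "AE t\<in>{a..b} in lborel. (\<alpha> has_real_derivative w t) (at t)"
    using AE_lebesgue_point[OF w] AE_lborel_singleton[of a] AE_lborel_singleton[of b]
  proof (eventually_elim, intro impI)
    fix t assume t: "lebesgue_point w t" "t \<noteq> a" "t \<noteq> b" "t \<in> {a..b}"
    show "(\<alpha> has_real_derivative w t) (at t)"
      unfolding has_field_derivative_iff
    proof (rule LIM_I)
      fix e :: real assume e: "0 < e"
      obtain d where d: "d > 0" "\<And>s. s \<noteq> t \<Longrightarrow> \<bar>s - t\<bar> < d \<Longrightarrow>
         \<bar>(LINT r:{min s t..max s t}|lborel. w r) - w t * \<bar>s - t\<bar>\<bar> \<le> e/2 * \<bar>s - t\<bar>"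
        using lebesgue_pointE[OF t(1), of "e/2"] e by auto
      show "\<exists>\<delta>>0. \<forall>x. x \<noteq> t \<and> norm (x - t) < \<delta> \<longrightarrow> norm ((\<alpha> x - \<alpha> t) / (x - t) - w t) < e"
      proof (intro exI[of _ "min d (min (t - a) (b - t))"] conjI allI impI)
        fix x assume x: "x \<noteq> t \<and> norm (x - t) < min d (min (t - a) (b - t))"
        then have "\<bar>x - t\<bar> < t - a" "\<bar>x - t\<bar> < b - t" by auto
        then have xab: "a \<le> x" "x \<le> b" by linarith+
        have "(\<alpha> x - \<alpha> t) = sgn (x - t) * (LINT r:{min x t..max x t}|lborel. w r)"
          using eq[of t x] eq[of x t] x xab t(4) by (cases "x < t") (auto simp: min_def max_def)
        then have "\<bar>(\<alpha> x - \<alpha> t) - w t * (x - t)\<bar> = \<bar>sgn (x - t) * ((LINT r:{min x t..max x t}|lborel. w r) - w t * \<bar>x - t\<bar>)\<bar>"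
          by (simp add: algebra_simps sgn_mult_abs linordered_idom_class.abs_sgn)
        also have "\<dots> \<le> e/2 * \<bar>x - t\<bar>" using d(2)[of x] x by (simp add: abs_mult abs_sgn_eq)
        also have "\<dots> < e * \<bar>x - t\<bar>" using x e by simp
        finally have "\<bar>((\<alpha> x - \<alpha> t) - w t * (x - t)) / (x - t)\<bar> < e"
          using x by (simp add: abs_divide field_simps)
        moreover have "((\<alpha> x - \<alpha> t) - w t * (x - t)) / (x - t) = (\<alpha> x - \<alpha> t) / (x - t) - w t"
          using x by (simp add: field_simps)
        ultimately show "norm ((\<alpha> x - \<alpha> t) / (x - t) - w t) < e" by simp
      qed (use d t in auto)
    qed
  qed
  then show thesis using that w eq by blast
qed

text \<open>The metric speed is the supremum of the derivatives of the functions \<open>t \<mapsto> d(\<gamma> t, \<gamma> r)\<close> with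
  \<open>r\<close> rational: their increments recover all distances along the curve.\<close>

lemma abs_cont_curve_metric_speed:
  fixes \<gamma> :: "real \<Rightarrow> 'a::metric_space"
  assumes ac: "abs_cont_curve a b \<gamma>" and ab: "a \<le> b"
  obtains m where "integrable lborel m" "\<And>t. 0 \<le> m t"
    "AE t\<in>{a..b} in lborel. has_metric_speed \<gamma> (m t) t"
    "\<And>s t. a \<le> s \<Longrightarrow> s \<le> t \<Longrightarrow> t \<le> b \<Longrightarrow> dist (\<gamma> s) (\<gamma> t) \<le> (LINT r:{s..t}|lborel. m r)"
proof -
  obtain g where g: "integrable lborel g" "\<And>t. 0 \<le> g t"
    "\<And>s t. s \<le> t \<Longrightarrow> dist (\<gamma> (clamp_to a b s)) (\<gamma> (clamp_to a b t)) \<le> (LINT r:{s..t}|lborel. g r)"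
    using abs_cont_curve_extend[OF ac ab] by metis
  have gm[measurable]: "g \<in> borel_measurable borel"
    using g(1) by (simp add: borel_measurable_integrable)
  define \<delta> where "\<delta> = \<gamma> \<circ> clamp_to a b"
  have \<delta>le: "dist (\<delta> s) (\<delta> t) \<le> (LINT r:{s..t}|lborel. g r)" if "s \<le> t" for s t
    using g(3)[OF that] by (simp add: \<delta>_def)
  define r where "r = from_nat_into (\<rat> :: real set)"
  have r: "range r = \<rat>" unfolding r_def
    by (rule range_from_nat_into) (use countable_rat Rats_0 in auto)
  define \<phi> where "\<phi> n t = dist (\<delta> t) (\<delta> (r n))" for n t
  have \<phi>le: "\<bar>\<phi> n t - \<phi> n s\<bar> \<le> dist (\<delta> s) (\<delta> t)" for n s t
    unfolding \<phi>_def using dist_triangle[of "\<delta> s" "\<delta> (r n)" "\<delta> t"] dist_triangle[of "\<delta> t" "\<delta> (r n)" "\<delta> s"]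
    by (simp add: dist_commute abs_le_iff)
  have "\<forall>n. \<exists>w. integrable lborel w \<and> (\<forall>s t. s \<le> t \<longrightarrow> \<phi> n t - \<phi> n s = (LINT r:{s..t}|lborel. w r))"
    using order_trans[OF \<phi>le \<delta>le] by (intro allI integral_representation_nonneg[OF g(1,2)])
  then obtain w where w: "\<And>n. integrable lborel (w n)"
    and \<phi>w: "\<And>n s t. s \<le> t \<Longrightarrow> \<phi> n t - \<phi> n s = (LINT r:{s..t}|lborel. w n r)"
    by metis
  have [measurable]: "w n \<in> borel_measurable borel" for n
    using w by (simp add: borel_measurable_integrable)
  \<comment> \<open>The cap g t keeps the supremum finite at every t; by \<open>wle\<close> it is
    inactive almost everywhere.\<close>
  define m where "m t = (SUP n. min \<bar>w n t\<bar> (g t))" for t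
  have bdd: "bdd_above (range (\<lambda>n. min \<bar>w n t\<bar> (g t)))" for t
    by (rule bdd_aboveI[of _ "g t"]) auto
  have m_le: "m t \<le> g t" for t unfolding m_def by (rule cSUP_least) auto
  have m_ge: "min \<bar>w n t\<bar> (g t) \<le> m t" for n t unfolding m_def by (rule cSUP_upper[OF _ bdd]) simp
  have m0: "m t \<ge> 0" for t using m_ge[of 0 t] g(2)[of t] by linarith
  have [measurable]: "m \<in> borel_measurable borel"
    unfolding m_def[abs_def] by (rule borel_measurable_cSUP) (use bdd in auto)
  have mint: "integrable lborel m"
    by (rule Bochner_Integration.integrable_bound[OF g(1)]) (use m0 m_le g(2) in auto)
  \<comment> \<open>At a common Lebesgue point, divide the bound on increments over [t, t + h] by
    h.\<close>
  have wle: "AE t in lborel. \<forall>n. \<bar>w n t\<bar> \<le> g t"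
    unfolding AE_all_countable
  proof
    fix n
    show "AE t in lborel. \<bar>w n t\<bar> \<le> g t"
      using AE_lebesgue_point[OF w[of n]] AE_lebesgue_point[OF g(1)]
    proof eventually_elim
      fix t assume t: "lebesgue_point (w n) t" "lebesgue_point g t"
      show "\<bar>w n t\<bar> \<le> g t"
      proof (rule field_le_epsilon)
        fix e :: real assume e: "e > 0"
        obtain d where d: "d > 0" "\<And>s. s \<noteq> t \<Longrightarrow> \<bar>s - t\<bar> < d \<Longrightarrow>
           \<bar>(LINT r:{min s t..max s t}|lborel. w n r) - w n t * \<bar>s - t\<bar>\<bar> \<le> e/2 * \<bar>s - t\<bar>"
          using lebesgue_pointE[OF t(1), of "e/2"] e by auto
        obtain d' where d': "d' > 0" "\<And>s. s \<noteq> t \<Longrightarrow> \<bar>s - t\<bar> < d' \<Longrightarrow>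
           \<bar>(LINT r:{min s t..max s t}|lborel. g r) - g t * \<bar>s - t\<bar>\<bar> \<le> e/2 * \<bar>s - t\<bar>"
          using lebesgue_pointE[OF t(2), of "e/2"] e by auto
        define h where "h = min d d' / 2"
        have h: "h > 0" "h < d" "h < d'" using d d' by (auto simp: h_def)
        have "\<bar>LINT r:{t..t+h}|lborel. w n r\<bar> \<le> (LINT r:{t..t+h}|lborel. g r)"
          using order_trans[OF \<phi>le \<delta>le, of t "t+h" n] \<phi>w[of t "t+h" n] h by simp
        moreover have "\<bar>(LINT r:{t..t+h}|lborel. w n r) - w n t * h\<bar> \<le> e/2 * h"
          "\<bar>(LINT r:{t..t+h}|lborel. g r) - g t * h\<bar> \<le> e/2 * h"
          using d(2)[of "t+h"] d'(2)[of "t+h"] h by auto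
        moreover have "\<bar>w n t\<bar> * h = \<bar>w n t * h\<bar>" using h by (simp add: abs_mult)
        ultimately have "\<bar>w n t\<bar> * h \<le> (g t + e) * h"
          unfolding distrib_right by linarith
        then show "\<bar>w n t\<bar> \<le> g t + e" using h by simp
      qed
    qed
  qed
  then have wm: "AE t in lborel. \<bar>w n t\<bar> \<le> m t" for n
    by eventually_elim (use m_ge in \<open>metis min.absorb1\<close>)
  \<comment> \<open>For a rational time close to s the function \<open>\<phi> n\<close> is nearly 0
    at s and nearly the full distance at t, so its increment, bounded by the integral of m, recovers
    the distance.\<close>
  have dist_le: "dist (\<delta> s) (\<delta> t) \<le> (LINT r:{s..t}|lborel. m r)" if st: "s \<le> t" for s t
  proof (rule field_le_epsilon)
    fix e :: real assume e: "e > 0"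
    obtain d where d: "d > 0" "\<And>u v. s \<in> {u..v} \<Longrightarrow> v - u < d \<Longrightarrow> (LINT r:{u..v}|lborel. g r) < e/2"
      using small_set_integral[OF g(1,2), of "e/2" s] e by auto
    obtain q where q: "q \<in> \<rat>" "s < q" "q < s + d" using Rats_dense_in_real[of s "s+d"] d by auto
    then obtain n where n: "r n = q" using r by (metis imageE)
    have "\<phi> n s \<le> e/2" unfolding \<phi>_def n
      using \<delta>le[of s q] d(2)[of s q] q by auto
    moreover have "\<phi> n t \<ge> dist (\<delta> s) (\<delta> t) - \<phi> n s"
      unfolding \<phi>_def using dist_triangle[of "\<delta> s" "\<delta> t" "\<delta> (r n)"] by (simp add: dist_commute)
    moreover have "\<phi> n t - \<phi> n s \<le> (LINT r:{s..t}|lborel. m r)"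
      using abs_set_integral_le_lborel[OF w mint wm, of "{s..t}" n] \<phi>w[OF st, of n] by auto
    ultimately show "dist (\<delta> s) (\<delta> t) \<le> (LINT r:{s..t}|lborel. m r) + e" by simp
  qed
  have leb: "AE t in lborel. \<forall>n. lebesgue_point (w n) t"
    unfolding AE_all_countable using AE_lebesgue_point[OF w] by blast
  have "AE t\<in>{a..b} in lborel. has_metric_speed \<gamma> (m t) t"
    using AE_lebesgue_point[OF mint] leb wle AE_lborel_singleton[of a] AE_lborel_singleton[of b]
  proof (eventually_elim, intro impI)
    fix t assume t: "lebesgue_point m t" "\<forall>n. lebesgue_point (w n) t" "\<forall>n. \<bar>w n t\<bar> \<le> g t"
      "t \<noteq> a" "t \<noteq> b" "t \<in> {a..b}"
    show "has_metric_speed \<gamma> (m t) t"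
      unfolding has_metric_speed_def
    proof (rule LIM_I)
      fix e :: real assume e: "0 < e"
      \<comment> \<open>One index nearly attains the supremum; it gives the lower bound for the
        difference quotient, while \<open>dist_le\<close> gives the upper one.\<close>
      have "\<exists>n. m t - e/4 < min \<bar>w n t\<bar> (g t)"
        using less_cSUP_iff[OF _ bdd, of "m t - e/4" t] e unfolding m_def by auto
      then obtain n where n: "m t - e/4 < \<bar>w n t\<bar>" by auto
      obtain d where d: "d > 0" "\<And>s. s \<noteq> t \<Longrightarrow> \<bar>s - t\<bar> < d \<Longrightarrow>
         \<bar>(LINT r:{min s t..max s t}|lborel. w n r) - w n t * \<bar>s - t\<bar>\<bar> \<le> e/4 * \<bar>s - t\<bar>"
        using lebesgue_pointE[of "w n" t "e/4"] t(2) e by auto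
      obtain d' where d': "d' > 0" "\<And>s. s \<noteq> t \<Longrightarrow> \<bar>s - t\<bar> < d' \<Longrightarrow>
         \<bar>(LINT r:{min s t..max s t}|lborel. m r) - m t * \<bar>s - t\<bar>\<bar> \<le> e/4 * \<bar>s - t\<bar>"
        using lebesgue_pointE[OF t(1), of "e/4"] e by auto
      show "\<exists>\<delta>>0. \<forall>x. x \<noteq> t \<and> norm (x - t) < \<delta> \<longrightarrow> norm (dist (\<gamma> x) (\<gamma> t) / \<bar>x - t\<bar> - m t) < e"
      proof (intro exI[of _ "min (min d d') (min (t - a) (b - t))"] conjI allI impI)
        fix x assume x: "x \<noteq> t \<and> norm (x - t) < min (min d d') (min (t - a) (b - t))"
        then have "\<bar>x - t\<bar> < t - a" "\<bar>x - t\<bar> < b - t" by auto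
        then have xab: "a \<le> x" "x \<le> b" by linarith+
        define D where "D = dist (\<gamma> x) (\<gamma> t)"
        have D: "D = dist (\<delta> (min x t)) (\<delta> (max x t))"
          using xab t(6) unfolding \<delta>_def D_def by (cases "x < t") (auto simp: min_def max_def dist_commute)
        have "D \<le> (LINT r:{min x t..max x t}|lborel. m r)" unfolding D by (rule dist_le) auto
        moreover have "\<bar>(LINT r:{min x t..max x t}|lborel. m r) - m t * \<bar>x - t\<bar>\<bar> \<le> e/4 * \<bar>x - t\<bar>"
          using d'(2)[of x] x by auto
        ultimately have up: "D \<le> (m t + e/4) * \<bar>x - t\<bar>" unfolding distrib_right by linarith
        have "\<bar>LINT r:{min x t..max x t}|lborel. w n r\<bar> \<le> D" unfolding D
          using \<phi>le[of n "max x t" "min x t"] \<phi>w[of "min x t" "max x t" n] by simp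
        then have "(\<bar>w n t\<bar> - e/4) * \<bar>x - t\<bar> \<le> D"
        proof -
          assume *: "\<bar>LINT r:{min x t..max x t}|lborel. w n r\<bar> \<le> D"
          have "\<bar>w n t * \<bar>x - t\<bar>\<bar> - e/4 * \<bar>x - t\<bar> \<le> \<bar>LINT r:{min x t..max x t}|lborel. w n r\<bar>"
          proof -
            have "\<bar>(LINT r:{min x t..max x t}|lborel. w n r) - w n t * \<bar>x - t\<bar>\<bar> \<le> e/4 * \<bar>x - t\<bar>"
              using d(2)[of x] x by auto
            then show ?thesis by linarith
          qed
          then show ?thesis using * by (simp add: abs_mult algebra_simps)
        qed
        moreover have "(m t - e/2) * \<bar>x - t\<bar> \<le> (\<bar>w n t\<bar> - e/4) * \<bar>x - t\<bar>"
          using n by (intro mult_right_mono) auto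
        ultimately have lo: "(m t - e/2) * \<bar>x - t\<bar> \<le> D" by simp
        have p: "\<bar>x - t\<bar> > 0" using x by simp
        have "D / \<bar>x - t\<bar> \<le> m t + e/4" "m t - e/2 \<le> D / \<bar>x - t\<bar>"
          using up lo p by (auto simp: pos_divide_le_eq pos_le_divide_eq)
        then show "norm (dist (\<gamma> x) (\<gamma> t) / \<bar>x - t\<bar> - m t) < e" unfolding D_def[symmetric] using e by (auto simp: abs_less_iff)
      qed (use d d' t in auto)
    qed
  qed
  moreover have "dist (\<gamma> s) (\<gamma> t) \<le> (LINT r:{s..t}|lborel. m r)" if "a \<le> s" "s \<le> t" "t \<le> b" for s t
    using dist_le[OF that(2)] that by (simp add: \<delta>_def)
  ultimately show thesis using that mint m0 by blast
qed

section \<open>Proper time of causal curves\<close>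

lemma AE_lborel_reflect:
  fixes P :: "real \<Rightarrow> bool"
  assumes "AE t in lborel. P t"
  shows "AE t in lborel. P (e - t)"
proof -
  obtain N where N: "{t. \<not> P t} \<subseteq> N" "N \<in> null_sets lborel"
    using assms by (auto elim!: AE_E simp: null_sets_def)
  have [measurable]: "N \<in> sets borel" using N by (auto simp: null_sets_def)
  have "AE t in lborel. t \<notin> N" by (rule AE_not_in[OF N(2)])
  then have "AE t in lborel. (e + (-1) * t) \<notin> N" by (intro AE_borel_affine) auto
  then show ?thesis by eventually_elim (use N in auto)
qed

section \<open>Integrals of functions that are known only almost everywhere\<close>

text \<open>Completeness of \<open>lebesgue\<close> is what makes the length integrands measurable:
  they agree with Borel functions only off a null set.\<close>

lemma borel_measurable_lebesgue_AE_eq: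
  fixes F h :: "real \<Rightarrow> real"
  assumes h: "h \<in> borel_measurable borel" and ae: "AE t in lborel. F t = h t"
  shows "F \<in> borel_measurable lebesgue"
proof (rule measurableI)
  fix A :: "real set" assume A: "A \<in> sets borel"
  show "F -` A \<inter> space lebesgue \<in> sets lebesgue"
  proof (rule completion.in_sets_AE[where A="h -` A"])
    show "AE x in lebesgue. (x \<in> h -` A) = (x \<in> F -` A \<inter> space lebesgue)"
      using AE_completion[OF ae] by eventually_elim auto
    show "h -` A \<in> sets lebesgue" using measurable_sets[OF h A] by auto
  qed auto
qed auto

lemma set_lebesgue_integral_AE_eq:
  fixes F h :: "real \<Rightarrow> real"
  assumes h[measurable]: "h \<in> borel_measurable borel"
    and ae: "AE t\<in>{a..b} in lborel. F t = h t"
  shows "(LINT t:{a..b}|lebesgue. F t) = (LINT t:{a..b}|lborel. h t)"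
proof -
  have *: "AE t in lborel. indicator {a..b} t *\<^sub>R F t = indicator {a..b} t *\<^sub>R h t"
    using ae by eventually_elim (auto simp: indicator_def)
  have hm: "(\<lambda>t. indicator {a..b} t *\<^sub>R h t) \<in> borel_measurable borel" by measurable
  have hm': "(\<lambda>t. indicator {a..b} t *\<^sub>R h t) \<in> borel_measurable lebesgue"
    by (rule measurable_completion) (use hm in simp)
  have "(LINT t:{a..b}|lebesgue. F t) = (LINT t|lebesgue. indicator {a..b} t *\<^sub>R h t)"
    unfolding set_lebesgue_integral_def
    by (rule integral_cong_AE[OF borel_measurable_lebesgue_AE_eq[OF hm *] hm' AE_completion[OF *]])
  also have "\<dots> = (LINT t:{a..b}|lborel. h t)"
    unfolding set_lebesgue_integral_def by (rule integral_completion) (use hm in auto)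
  finally show ?thesis .
qed

text \<open>F may be non-integrable; its integral is then 0 by default and the nonnegativity of R on
  [a, b] settles the claim.\<close>

lemma set_lebesgue_integral_AE_le:
  fixes F R :: "real \<Rightarrow> real"
  assumes R: "integrable lborel R"
    and ae: "AE t\<in>{a..b} in lborel. F t \<le> R t \<and> 0 \<le> R t"
  shows "(LINT t:{a..b}|lebesgue. F t) \<le> (LINT t:{a..b}|lborel. R t)"
proof -
  have [measurable]: "R \<in> borel_measurable borel" using R by (simp add: borel_measurable_integrable)
  have Rm: "(\<lambda>t. indicator {a..b} t *\<^sub>R R t) \<in> borel_measurable borel" by measurable
  have Ri: "integrable lborel (\<lambda>t. indicator {a..b} t *\<^sub>R R t)"
    by (rule integrable_mult_indicator) (use R in auto)
  have *: "AE t in lborel. indicator {a..b} t *\<^sub>R F t \<le> indicator {a..b} t *\<^sub>R R t"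
    and **: "AE t in lborel. 0 \<le> indicator {a..b} t *\<^sub>R R t"
    using ae by (eventually_elim, auto simp: indicator_def)+
  show ?thesis
  proof (cases "integrable lebesgue (\<lambda>t. indicator {a..b} t *\<^sub>R F t)")
    case True
    have "(LINT t:{a..b}|lebesgue. F t) \<le> (LINT t|lebesgue. indicator {a..b} t *\<^sub>R R t)"
      unfolding set_lebesgue_integral_def
      by (rule integral_mono_AE[OF True _ AE_completion[OF *]]) (use Ri Rm integrable_completion in auto)
    also have "\<dots> = (LINT t:{a..b}|lborel. R t)"
      unfolding set_lebesgue_integral_def by (rule integral_completion) (use Rm in auto)
    finally show ?thesis .
  next
    case False
    then have "(LINT t:{a..b}|lebesgue. F t) = 0"
      by (simp add: set_lebesgue_integral_def not_integrable_integral_eq)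
    then show ?thesis using ** by (simp add: set_lebesgue_integral_def integral_nonneg_AE)
  qed
qed

lemma metric_speed_eqI:
  "has_metric_speed \<beta> m t \<Longrightarrow> metric_speed \<beta> t = m"
  unfolding metric_speed_def has_metric_speed_def by (rule tendsto_Lim) auto

lemma abs_cont_curve_continuous_on:
  assumes ac: "abs_cont_curve a b \<gamma>"
  shows "continuous_on {a..b} \<gamma>"
proof (cases "a \<le> b")
  case True
  obtain g where g: "integrable lborel g" "\<And>t. 0 \<le> g t"
    "\<And>s t. s \<le> t \<Longrightarrow> dist (\<gamma> (clamp_to a b s)) (\<gamma> (clamp_to a b t)) \<le> (LINT r:{s..t}|lborel. g r)"
    using abs_cont_curve_extend[OF ac True] by metis
  show ?thesis unfolding continuous_on_iff
  proof (intro ballI allI impI)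
    fix s e :: real assume s: "s \<in> {a..b}" and e: "0 < e"
    obtain d where d: "d > 0" "\<And>u v. s \<in> {u..v} \<Longrightarrow> v - u < d \<Longrightarrow> (LINT r:{u..v}|lborel. g r) < e"
      using small_set_integral[OF g(1,2) e, of s] by auto
    show "\<exists>d>0. \<forall>x'\<in>{a..b}. dist x' s < d \<longrightarrow> dist (\<gamma> x') (\<gamma> s) < e"
    proof (intro exI[of _ d] conjI ballI impI d(1))
      fix x assume x: "x \<in> {a..b}" "dist x s < d"
      have "dist (\<gamma> (min x s)) (\<gamma> (max x s)) \<le> (LINT r:{min x s..max x s}|lborel. g r)"
        using g(3)[of "min x s" "max x s"] x s by (simp add: min_def max_def)
      also have "\<dots> < e" using x d by (intro d(2)) (auto simp: dist_real_def)
      finally show "dist (\<gamma> x) (\<gamma> s) < e" by (cases "x \<le> s") (auto simp: dist_commute)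
    qed
  qed
qed simp

lemma strict_mono_on_derivative_nonneg:
  fixes \<alpha> :: "real \<Rightarrow> real"
  assumes "strict_mono_on {a..b} \<alpha>" "(\<alpha> has_real_derivative w) (at t)" "a \<le> t" "t < b"
  shows "0 \<le> w"
proof (rule ccontr)
  assume "\<not> 0 \<le> w"
  then obtain d where d: "d > 0" "\<And>h. 0 < h \<Longrightarrow> h < d \<Longrightarrow> \<alpha> (t + h) < \<alpha> t"
    using DERIV_neg_dec_right[OF assms(2)] by auto
  define h where "h = min d (b - t) / 2"
  have "0 < h" "h < d" "t + h \<le> b" using d assms by (auto simp: h_def min_def field_simps)
  then show False using d(2)[of h] strict_mono_onD[OF assms(1), of t "t + h"] assms(3,4) by auto
qed

text \<open>Monotonicity makes the derivative nonnegative only almost everywhere on [a, b]; taking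
  the absolute value makes the density nonnegative everywhere and keeps its integral over
  [a, b].\<close>

lemma increasing_curve_derivative:
  fixes \<alpha> :: "real \<Rightarrow> real"
  assumes ac: "abs_cont_curve a b \<alpha>" and ab: "a < b" and mono: "strict_mono_on {a..b} \<alpha>"
  obtains w where "integrable lborel w" "\<And>t. 0 \<le> w t"
    "AE t\<in>{a..b} in lborel. (\<alpha> has_real_derivative w t) (at t)"
    "\<alpha> b - \<alpha> a = (LINT r:{a..b}|lborel. w r)"
proof -
  obtain w where w: "integrable lborel w"
    and d: "AE t\<in>{a..b} in lborel. (\<alpha> has_real_derivative w t) (at t)"
    and eq: "\<And>s t. a \<le> s \<Longrightarrow> s \<le> t \<Longrightarrow> t \<le> b \<Longrightarrow> \<alpha> t - \<alpha> s = (LINT r:{s..t}|lborel. w r)"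
    using abs_cont_curve_derivative[OF ac] ab by (metis less_imp_le)
  have [measurable]: "w \<in> borel_measurable borel" using w by (simp add: borel_measurable_integrable)
  have *: "AE t\<in>{a..b} in lborel. (\<alpha> has_real_derivative w t) (at t) \<and> 0 \<le> w t"
    using d AE_lborel_singleton[of b]
    by eventually_elim (use strict_mono_on_derivative_nonneg[OF mono] in force)
  show thesis
  proof (rule that[of "\<lambda>t. \<bar>w t\<bar>"])
    show "AE t\<in>{a..b} in lborel. (\<alpha> has_real_derivative \<bar>w t\<bar>) (at t)"
      using * by eventually_elim auto
    have "\<alpha> b - \<alpha> a = (LINT r:{a..b}|lborel. w r)" using eq[of a b] ab by simp
    also have "\<dots> = (LINT r:{a..b}|lborel. \<bar>w r\<bar>)"
      unfolding set_lebesgue_integral_def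
      by (rule integral_cong_AE) (measurable, use * in \<open>eventually_elim, auto simp: indicator_def\<close>)
    finally show "\<alpha> b - \<alpha> a = (LINT r:{a..b}|lborel. \<bar>w r\<bar>)" .
  qed (use w in auto)
qed

lemma increasing_curve_speeds:
  assumes ac: "ac_curve I a b \<alpha> \<beta>" and mono: "strict_mono_on {a..b} \<alpha>"
  obtains w m where "integrable lborel w" "\<And>t. 0 \<le> w t" "integrable lborel m" "\<And>t. 0 \<le> m t"
    "AE t\<in>{a..b} in lborel. deriv \<alpha> t = w t \<and> metric_speed \<beta> t = m t"
    "\<alpha> b - \<alpha> a = (LINT r:{a..b}|lborel. w r)" "dist (\<beta> a) (\<beta> b) \<le> (LINT r:{a..b}|lborel. m r)"
proof -
  have A: "abs_cont_curve a b \<alpha>" "a < b" "abs_cont_curve a b \<beta>" using ac by (auto simp: ac_curve_def)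
  obtain w where w: "integrable lborel w" "\<And>t. 0 \<le> w t"
    "AE t\<in>{a..b} in lborel. (\<alpha> has_real_derivative w t) (at t)"
    "\<alpha> b - \<alpha> a = (LINT r:{a..b}|lborel. w r)"
    using increasing_curve_derivative[OF A(1,2) mono] by metis
  obtain m where m: "integrable lborel m" "\<And>t. 0 \<le> m t"
    "AE t\<in>{a..b} in lborel. has_metric_speed \<beta> (m t) t"
    "\<And>s t. a \<le> s \<Longrightarrow> s \<le> t \<Longrightarrow> t \<le> b \<Longrightarrow> dist (\<beta> s) (\<beta> t) \<le> (LINT r:{s..t}|lborel. m r)"
    by (rule abs_cont_curve_metric_speed[OF A(3) less_imp_le[OF A(2)]]) blast
  have "AE t\<in>{a..b} in lborel. deriv \<alpha> t = w t \<and> metric_speed \<beta> t = m t"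
    using w(3) m(3) by eventually_elim (auto intro: DERIV_imp_deriv metric_speed_eqI)
  then show thesis using that w m A(2) by simp
qed

lemma lorentz_length_le:
  assumes "fd_causal_curve I f a b \<alpha> \<beta>"
  shows "lorentz_length f a b \<alpha> \<beta> \<le> \<alpha> b - \<alpha> a"
proof -
  have ac: "ac_curve I a b \<alpha> \<beta>" "strict_mono_on {a..b} \<alpha>" using assms by (auto simp: fd_causal_curve_def)
  obtain w m where w: "integrable lborel w" "\<And>t. 0 \<le> w t"
    and d: "AE t\<in>{a..b} in lborel. deriv \<alpha> t = w t \<and> metric_speed \<beta> t = m t"
    and len: "\<alpha> b - \<alpha> a = (LINT r:{a..b}|lborel. w r)"
    by (rule increasing_curve_speeds[OF ac]) blast
  show ?thesis unfolding len lorentz_length_def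
  proof (rule set_lebesgue_integral_AE_le[OF w(1)])
    show "AE t\<in>{a..b} in lborel. sqrt ((deriv \<alpha> t)\<^sup>2 - (f (\<alpha> t))\<^sup>2 * (metric_speed \<beta> t)\<^sup>2) \<le> w t \<and> 0 \<le> w t"
      using d by eventually_elim (use w(2) in \<open>auto intro!: real_le_lsqrt\<close>)
  qed
qed

text \<open>One has sqrt(w^2 - x^2) <= w - x^2/(2w), and completing a square bounds this by the
  right-hand side. Linearity in w and x lets the bound pass through an integral over a
  curve.\<close>

lemma reverse_cauchy_schwarz_linear:
  fixes w x y Q :: real
  assumes "0 \<le> x" "x \<le> y" "y \<le> w" "0 \<le> Q"
  shows "sqrt (w\<^sup>2 - y\<^sup>2) \<le> (1 + Q\<^sup>2/2) * w - Q * x"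
proof (cases "w = 0")
  case False
  then have w: "w > 0" using assms by auto
  have 0: "(1 + Q\<^sup>2/2) * w - Q * x - (w - x\<^sup>2/(2*w)) = (w * Q - x)\<^sup>2 / (2*w)"
    using w by (simp add: field_simps power2_eq_square)
  have "0 \<le> (w * Q - x)\<^sup>2 / (2*w)" using w by simp
  then have 1: "w - x\<^sup>2/(2*w) \<le> (1 + Q\<^sup>2/2) * w - Q * x" using 0 by linarith
  have xw: "x\<^sup>2 \<le> w\<^sup>2" using assms by (intro power_mono) auto
  then have "x\<^sup>2/(2*w) \<le> w" using w by (simp add: field_simps power2_eq_square) (use w mult_pos_pos[OF w w] in linarith)
  moreover have "w\<^sup>2 - y\<^sup>2 \<le> (w - x\<^sup>2/(2*w))\<^sup>2"
  proof -
    have "(w - x\<^sup>2/(2*w))\<^sup>2 = w\<^sup>2 - x\<^sup>2 + (x\<^sup>2/(2*w))\<^sup>2"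
      using w by (simp add: power2_diff field_simps power2_eq_square)
    moreover have "x\<^sup>2 \<le> y\<^sup>2" using assms by (intro power_mono) auto
    ultimately show ?thesis using zero_le_power2[of "x\<^sup>2/(2*w)"] by linarith
  qed
  ultimately have "sqrt (w\<^sup>2 - y\<^sup>2) \<le> w - x\<^sup>2/(2*w)"
    by (intro real_le_lsqrt) auto
  then show ?thesis using 1 by simp
next
  case True
  then have "x = 0" "y = 0" using assms by auto
  then show ?thesis using True by simp
qed

text \<open>The linear bound is applied pointwise with x = c * m and y = f(\<alpha>) * m, where m is
  the speed of \<beta>. It integrates to the time increment and the length of \<beta>, which is at
  least the distance of the endpoints.\<close>

lemma lorentz_length_strict_le:
  assumes cu: "fd_causal_curve I f a b \<alpha> \<beta>" and c: "c \<ge> 0" "\<And>t. t \<in> {\<alpha> a..\<alpha> b} \<Longrightarrow> c \<le> f t" and Q: "Q \<ge> 0"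
  shows "lorentz_length f a b \<alpha> \<beta> \<le> (1 + Q\<^sup>2/2) * (\<alpha> b - \<alpha> a) - Q * (c * dist (\<beta> a) (\<beta> b))"
proof -
  have ac: "ac_curve I a b \<alpha> \<beta>" "strict_mono_on {a..b} \<alpha>" "a < b"
    and ca: "AE t\<in>{a..b} in lborel. - (deriv \<alpha> t)\<^sup>2 + (f (\<alpha> t))\<^sup>2 * (metric_speed \<beta> t)\<^sup>2 \<le> 0"
    using cu by (auto simp: fd_causal_curve_def ac_curve_def)
  obtain w m where w: "integrable lborel w" "\<And>t. 0 \<le> w t" and m: "integrable lborel m" "\<And>t. 0 \<le> m t"
    and d: "AE t\<in>{a..b} in lborel. deriv \<alpha> t = w t \<and> metric_speed \<beta> t = m t"
    and len: "\<alpha> b - \<alpha> a = (LINT r:{a..b}|lborel. w r)" "dist (\<beta> a) (\<beta> b) \<le> (LINT r:{a..b}|lborel. m r)"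
    by (rule increasing_curve_speeds[OF ac(1,2)]) blast
  define R where "R t = (1 + Q\<^sup>2/2) * w t - Q * (c * m t)" for t
  have R: "integrable lborel R" unfolding R_def using w m by auto
  have "lorentz_length f a b \<alpha> \<beta> \<le> (LINT t:{a..b}|lborel. R t)"
    unfolding lorentz_length_def
  proof (rule set_lebesgue_integral_AE_le[OF R])
    show "AE t\<in>{a..b} in lborel. sqrt ((deriv \<alpha> t)\<^sup>2 - (f (\<alpha> t))\<^sup>2 * (metric_speed \<beta> t)\<^sup>2) \<le> R t \<and> 0 \<le> R t"
      using d ca
    proof (eventually_elim, intro impI)
      fix t assume *: "t \<in> {a..b} \<longrightarrow> deriv \<alpha> t = w t \<and> metric_speed \<beta> t = m t"
        "t \<in> {a..b} \<longrightarrow> - (deriv \<alpha> t)\<^sup>2 + (f (\<alpha> t))\<^sup>2 * (metric_speed \<beta> t)\<^sup>2 \<le> 0" "t \<in> {a..b}"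
      then have d: "deriv \<alpha> t = w t" "metric_speed \<beta> t = m t" by auto
      have "\<alpha> t \<in> {\<alpha> a..\<alpha> b}" using strict_mono_on_leD[OF ac(2)] *(3) ac(3) by auto
      then have cf: "c \<le> f (\<alpha> t)" by (rule c(2))
      have "(f (\<alpha> t) * m t)\<^sup>2 \<le> (w t)\<^sup>2" using * d by (simp add: power_mult_distrib)
      then have "f (\<alpha> t) * m t \<le> w t" using w(2) by (rule power2_le_imp_le)
      moreover have "0 \<le> c * m t" "c * m t \<le> f (\<alpha> t) * m t" using c m(2) cf by (auto intro: mult_right_mono)
      ultimately have "sqrt ((w t)\<^sup>2 - (f (\<alpha> t) * m t)\<^sup>2) \<le> R t"
        unfolding R_def using Q by (intro reverse_cauchy_schwarz_linear)
      moreover from this have "0 \<le> R t" by (rule order_trans[rotated])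
        (use \<open>(f (\<alpha> t) * m t)\<^sup>2 \<le> (w t)\<^sup>2\<close> in simp)
      ultimately show "sqrt ((deriv \<alpha> t)\<^sup>2 - (f (\<alpha> t))\<^sup>2 * (metric_speed \<beta> t)\<^sup>2) \<le> R t \<and> 0 \<le> R t"
        unfolding d by (simp add: power_mult_distrib)
    qed
  qed
  also have "\<dots> = (1 + Q\<^sup>2/2) * (\<alpha> b - \<alpha> a) - Q * (c * (LINT t:{a..b}|lborel. m t))"
    unfolding R_def len(1) using w(1) m(1)
    by (subst set_integral_diff(2)) (auto intro: set_integrable_lborel)
  also have "\<dots> \<le> (1 + Q\<^sup>2/2) * (\<alpha> b - \<alpha> a) - Q * (c * dist (\<beta> a) (\<beta> b))"
    using len(2) c Q by (intro diff_left_mono mult_left_mono) auto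
  finally show ?thesis .
qed

lemma cone_indicator_measurable:
  assumes "abs_cont_curve a b \<alpha>" "\<alpha> ` {a..b} \<subseteq> I" "continuous_on I f"
  shows "(\<lambda>t. indicator {a..b} t * f (\<alpha> t)) \<in> borel_measurable (borel :: real measure)"
    and "\<exists>K. \<forall>t\<in>{a..b}. \<bar>f (\<alpha> t)\<bar> \<le> (K :: real)"
proof -
  have c: "continuous_on {a..b} (\<lambda>t. f (\<alpha> t))"
    using continuous_on_compose2[OF assms(3) abs_cont_curve_continuous_on[OF assms(1)] assms(2)] .
  then show "(\<lambda>t. indicator {a..b} t * f (\<alpha> t)) \<in> borel_measurable (borel :: real measure)"
    using borel_measurable_continuous_on_indicator[of "{a..b}" "\<lambda>t. f (\<alpha> t)"] by simp
  have "bounded ((\<lambda>t. f (\<alpha> t)) ` {a..b})"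
    by (rule compact_imp_bounded[OF compact_continuous_image[OF c compact_Icc]])
  then show "\<exists>K. \<forall>t\<in>{a..b}. \<bar>f (\<alpha> t)\<bar> \<le> (K :: real)" by (auto simp: bounded_iff)
qed

text \<open>A positive integrand is not enough, since a non-integrable one has integral 0 by
  default. Hence it is first replaced by a Borel function dominated by the time derivative.\<close>

lemma lorentz_length_pos:
  assumes cu: "fd_timelike_curve I f a b \<alpha> \<beta>" and f: "continuous_on I f"
  shows "0 < lorentz_length f a b \<alpha> \<beta>"
proof -
  have ac: "ac_curve I a b \<alpha> \<beta>" "strict_mono_on {a..b} \<alpha>"
    and A: "abs_cont_curve a b \<alpha>" "a < b" "\<alpha> ` {a..b} \<subseteq> I"
    and ca: "AE t\<in>{a..b} in lborel. - (deriv \<alpha> t)\<^sup>2 + (f (\<alpha> t))\<^sup>2 * (metric_speed \<beta> t)\<^sup>2 < 0"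
    using cu by (auto simp: fd_timelike_curve_def ac_curve_def)
  obtain w m where w: "integrable lborel w" "\<And>t. 0 \<le> w t" and m: "integrable lborel m"
    and d: "AE t\<in>{a..b} in lborel. deriv \<alpha> t = w t \<and> metric_speed \<beta> t = m t"
    by (rule increasing_curve_speeds[OF ac]) blast
  have [measurable]: "w \<in> borel_measurable borel" "m \<in> borel_measurable borel"
    using w m by (auto simp: borel_measurable_integrable)
  define \<phi> where "\<phi> t = indicator {a..b} t * f (\<alpha> t)" for t
  have [measurable]: "\<phi> \<in> borel_measurable borel" unfolding \<phi>_def
    using cone_indicator_measurable(1)[OF A(1,3) f] .
  define h where "h t = sqrt ((w t)\<^sup>2 - (\<phi> t * m t)\<^sup>2)" for t
  have [measurable]: "h \<in> borel_measurable borel" unfolding h_def by measurable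
  have *: "AE t\<in>{a..b} in lborel. sqrt ((deriv \<alpha> t)\<^sup>2 - (f (\<alpha> t))\<^sup>2 * (metric_speed \<beta> t)\<^sup>2) = h t \<and> 0 < h t"
    using d ca by eventually_elim (auto simp: h_def \<phi>_def power_mult_distrib)
  have eq: "lorentz_length f a b \<alpha> \<beta> = (LINT t:{a..b}|lborel. h t)"
    unfolding lorentz_length_def
    by (rule set_lebesgue_integral_AE_eq) (measurable, use * in \<open>eventually_elim, auto\<close>)
  have hint: "integrable lborel (\<lambda>t. indicator {a..b} t *\<^sub>R h t)"
  proof (rule Bochner_Integration.integrable_bound[OF w(1)])
    show "AE t in lborel. norm (indicator {a..b} t *\<^sub>R h t) \<le> norm (w t)"
      using *
    proof eventually_elim
      fix t assume t: "t \<in> {a..b} \<longrightarrow>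
        sqrt ((deriv \<alpha> t)\<^sup>2 - (f (\<alpha> t))\<^sup>2 * (metric_speed \<beta> t)\<^sup>2) = h t \<and> 0 < h t"
      have "h t \<le> w t" unfolding h_def using w(2) by (intro real_le_lsqrt) auto
      then show "norm (indicator {a..b} t *\<^sub>R h t) \<le> norm (w t)" using t w(2)[of t] by (auto simp: indicator_def)
    qed
  qed measurable
  have nn: "AE t in lborel. 0 \<le> indicator {a..b} t *\<^sub>R h t"
    using * by eventually_elim (auto simp: indicator_def)
  have "(LINT t:{a..b}|lborel. h t) \<noteq> 0"
  proof
    assume "(LINT t:{a..b}|lborel. h t) = 0"
    then have "AE t in lborel. indicator {a..b} t *\<^sub>R h t = 0"
      using integral_nonneg_eq_0_iff_AE[OF hint nn] by (simp add: set_lebesgue_integral_def)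
    then have "AE t in lborel. t \<notin> {a..b}" using * by eventually_elim auto
    then have "{a..b} \<in> null_sets lborel" by (simp add: AE_iff_null_sets)
    then show False using A(2) by (simp add: null_sets_def)
  qed
  moreover have "(LINT t:{a..b}|lborel. h t) \<ge> 0"
    unfolding set_lebesgue_integral_def by (rule integral_nonneg_AE[OF nn])
  ultimately show ?thesis unfolding eq by simp
qed

lemma fd_timelike_imp_causal: "fd_timelike_curve I f a b \<alpha> \<beta> \<Longrightarrow> fd_causal_curve I f a b \<alpha> \<beta>"
  unfolding fd_timelike_curve_def fd_causal_curve_def by (auto elim: eventually_mono)

lemma fd_timelike_line_unbounded:
  fixes \<gamma> :: "real \<Rightarrow> (real \<times> 'a::metric_space) set"
  assumes line: "fd_timelike_line I f \<gamma>" and f: "continuous_on I f"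
  shows "\<exists>t\<in>I. C < t" "\<exists>t\<in>I. t < C"
proof -
  obtain \<alpha> and \<beta> :: "real \<Rightarrow> 'a" where *: "\<forall>L>0. fd_timelike_curve I f (- L) L \<alpha> \<beta> \<and> maximal_geodesic I f (- L) L \<alpha> \<beta>"
    using line unfolding fd_timelike_line_def by auto
  then have c: "fd_timelike_curve I f (- L) L \<alpha> \<beta>" and g: "maximal_geodesic I f (- L) L \<alpha> \<beta>" if "L > 0" for L
    using that by auto
  have sub: "fd_timelike_curve I f s t \<alpha> \<beta>" if "s < t" for s t
  proof -
    define L where "L = max \<bar>s\<bar> \<bar>t\<bar>"
    have L: "L > 0" "{s..t} \<subseteq> {-L..L}" using that by (auto simp: L_def)
    have ac: "abs_cont_curve s t \<gamma>'" if *: "abs_cont_curve (-L) L \<gamma>'" for \<gamma>' :: "real \<Rightarrow> 'x::metric_space"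
    proof -
      obtain g where g: "set_integrable lborel {-L..L} g"
        "\<And>s t. -L \<le> s \<Longrightarrow> s \<le> t \<Longrightarrow> t \<le> L \<Longrightarrow> dist (\<gamma>' s) (\<gamma>' t) \<le> (LINT r:{s..t}|lborel. g r)"
        using * unfolding abs_cont_curve_def by blast
      then show ?thesis unfolding abs_cont_curve_def using L(2) that
        by (intro exI[of _ g]) (auto intro: set_integrable_subset)
    qed
    show ?thesis using c[OF L(1)] L(2) that unfolding fd_timelike_curve_def ac_curve_def
      by (auto intro: ac monotone_on_subset elim!: eventually_mono)
  qed
  obtain k where k: "\<And>s t. -1 \<le> s \<Longrightarrow> s < t \<Longrightarrow> t \<le> 1 \<Longrightarrow> lorentz_length f s t \<alpha> \<beta> = k * (t - s)"
    using g[OF zero_less_one] unfolding maximal_geodesic_def by blast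
  have k0: "k > 0" using lorentz_length_pos[OF sub f, of 0 1] k[of 0 1] by simp
  have len: "k * (t - s) \<le> \<alpha> t - \<alpha> s" if "s < t" for s t
  proof -
    define L where "L = max 1 (max \<bar>s\<bar> \<bar>t\<bar>)"
    have L: "L > 0" "- L \<le> s" "t \<le> L" "L \<ge> 1" by (auto simp: L_def)
    obtain k' where k': "\<And>s t. -L \<le> s \<Longrightarrow> s < t \<Longrightarrow> t \<le> L \<Longrightarrow> lorentz_length f s t \<alpha> \<beta> = k' * (t - s)"
      using g[OF L(1)] unfolding maximal_geodesic_def by blast
    \<comment> \<open>The proportionality constant may depend on the window; all windows with L >= 1
      contain [0, 1], where the constants are compared.\<close>
    have "k' = k" using k[of 0 1] k'[of 0 1] L by simp
    then show ?thesis using lorentz_length_le[OF fd_timelike_imp_causal[OF sub[OF that]]] k'[OF L(2) that L(3)] by simp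
  qed
  have I: "\<alpha> t \<in> I" for t
    using sub[of t "t+1"] by (auto simp: fd_timelike_curve_def ac_curve_def image_subset_iff)
  \<comment> \<open>Chosen so that k * T exceeds both C - \<alpha> 0 and \<alpha> 0 - C.\<close>
  define T where "T = (\<bar>C\<bar> + \<bar>\<alpha> 0\<bar> + 1) / k"
  have T: "T > 0" "k * T = \<bar>C\<bar> + \<bar>\<alpha> 0\<bar> + 1" using k0 by (auto simp: T_def)
  have "C < \<alpha> T" using len[of 0 T] T by simp
  then show "\<exists>t\<in>I. C < t" using I by blast
  have "\<alpha> (-T) < C" using len[of "-T" 0] T by simp
  then show "\<exists>t\<in>I. t < C" using I by blast
qed

section \<open>Length of curves in the cone\<close>

text \<open>A relation rather than a function, since \<^const>\<open>deriv\<close> and \<^const>\<open>metric_speed\<close> are junk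
  values where the limits do not exist.\<close>

definition cone_speed_at :: "(real \<Rightarrow> real) \<Rightarrow> (real \<Rightarrow> real) \<Rightarrow> (real \<Rightarrow> 'a::metric_space) \<Rightarrow> real \<Rightarrow> real \<Rightarrow> bool" where
  "cone_speed_at f \<alpha> \<beta> t v \<longleftrightarrow> (\<exists>w m. (\<alpha> has_real_derivative w) (at t) \<and>
     has_metric_speed \<beta> m t \<and> v = sqrt (w\<^sup>2 + (f (\<alpha> t))\<^sup>2 * m\<^sup>2))"

lemma cone_speed_at_integrand:
  "cone_speed_at f \<alpha> \<beta> t v \<Longrightarrow> sqrt ((deriv \<alpha> t)\<^sup>2 + (f (\<alpha> t))\<^sup>2 * (metric_speed \<beta> t)\<^sup>2) = v"
  unfolding cone_speed_at_def by (auto dest!: DERIV_imp_deriv metric_speed_eqI)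

lemma cone_speed_at_cong:
  assumes "cone_speed_at f \<alpha> \<beta> t v" "open U" "t \<in> U" "\<And>s. s \<in> U \<Longrightarrow> \<alpha>' s = \<alpha> s" "\<And>s. s \<in> U \<Longrightarrow> \<beta>' s = \<beta> s"
  shows "cone_speed_at f \<alpha>' \<beta>' t v"
proof -
  obtain w m where *: "(\<alpha> has_real_derivative w) (at t)"
     "has_metric_speed \<beta> m t" "v = sqrt (w\<^sup>2 + (f (\<alpha> t))\<^sup>2 * m\<^sup>2)"
    using assms(1) unfolding cone_speed_at_def by blast
  have "(\<alpha>' has_real_derivative w) (at t)"
    by (rule has_field_derivative_transform_within_open[OF *(1) assms(2,3)]) (use assms in auto)
  moreover have "has_metric_speed \<beta>' m t" unfolding has_metric_speed_def
    by (rule Lim_transform_within_open[OF *(2)[unfolded has_metric_speed_def] assms(2,3)]) (use assms in auto)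
  ultimately show ?thesis using *(3) assms(3,4) unfolding cone_speed_at_def by auto
qed

lemma cone_speed_at_reflect:
  assumes "cone_speed_at f \<alpha> \<beta> (e - t) v"
  shows "cone_speed_at f (\<lambda>t. \<alpha> (e - t)) (\<lambda>t. \<beta> (e - t)) t v"
proof -
  obtain w m where *: "(\<alpha> has_real_derivative w) (at (e - t))"
     "has_metric_speed \<beta> m (e - t)" "v = sqrt (w\<^sup>2 + (f (\<alpha> (e - t)))\<^sup>2 * m\<^sup>2)"
    using assms(1) unfolding cone_speed_at_def by blast
  have "((\<lambda>t. e - t) has_real_derivative (-1)) (at t)" by (auto intro!: derivative_eq_intros)
  from DERIV_chain2[of \<alpha> w "\<lambda>t. e - t" t, OF *(1) this]
  have "((\<lambda>t. \<alpha> (e - t)) has_real_derivative (- w)) (at t)" by simp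
  moreover have "has_metric_speed (\<lambda>t. \<beta> (e - t)) m t"
  proof -
    have "filterlim (\<lambda>s. e - s) (at (e - t)) (at t)"
      by (rule filterlim_atI) (auto intro!: tendsto_intros simp: eventually_at_filter)
    from filterlim_compose[OF *(2)[unfolded has_metric_speed_def] this]
    show ?thesis by (simp add: has_metric_speed_def abs_minus_commute)
  qed
  ultimately show ?thesis using *(3) unfolding cone_speed_at_def
    by (intro exI[of _ "-w"] exI[of _ m]) auto
qed

definition cone_length ::
    "(real \<Rightarrow> real) \<Rightarrow> real \<Rightarrow> real \<Rightarrow> (real \<Rightarrow> real) \<Rightarrow> (real \<Rightarrow> 'a::metric_space) \<Rightarrow> real" where
  "cone_length f a b \<alpha> \<beta> =
     (LINT t:{a..b}|lebesgue. sqrt ((deriv \<alpha> t)\<^sup>2 + (f (\<alpha> t))\<^sup>2 * (metric_speed \<beta> t)\<^sup>2))"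

text \<open>The integrand dominates both |\<alpha>'| and f(\<alpha>) times the speed of \<beta>. The
  two resulting lower bounds for the length are what later compares the cone metric with the product
  metric.\<close>

lemma cone_length_representation:
  assumes ac: "ac_curve I a b \<alpha> \<beta>" and f: "continuous_on I f"
  obtains h where "integrable lborel h" "\<And>t. 0 \<le> h t"
    "AE t\<in>{a..b} in lborel. cone_speed_at f \<alpha> \<beta> t (h t)"
    "cone_length f a b \<alpha> \<beta> = (LINT t:{a..b}|lborel. h t)"
    "\<And>s t. a \<le> s \<Longrightarrow> s \<le> t \<Longrightarrow> t \<le> b \<Longrightarrow> \<bar>\<alpha> t - \<alpha> s\<bar> \<le> (LINT r:{s..t}|lborel. h r)"
    "\<And>s t c. a \<le> s \<Longrightarrow> s \<le> t \<Longrightarrow> t \<le> b \<Longrightarrow> 0 \<le> c \<Longrightarrow> (\<And>r. r \<in> {s..t} \<Longrightarrow> c \<le> f (\<alpha> r)) \<Longrightarrow>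
       c * dist (\<beta> s) (\<beta> t) \<le> (LINT r:{s..t}|lborel. h r)"
proof -
  have A: "abs_cont_curve a b \<alpha>" "a \<le> b" "abs_cont_curve a b \<beta>" "\<alpha> ` {a..b} \<subseteq> I"
    using ac by (auto simp: ac_curve_def)
  obtain w where w: "integrable lborel w"
    "AE t\<in>{a..b} in lborel. (\<alpha> has_real_derivative w t) (at t)"
    "\<And>s t. a \<le> s \<Longrightarrow> s \<le> t \<Longrightarrow> t \<le> b \<Longrightarrow> \<alpha> t - \<alpha> s = (LINT r:{s..t}|lborel. w r)"
    by (rule abs_cont_curve_derivative[OF A(1,2)]) blast
  obtain m where m: "integrable lborel m" "\<And>t. 0 \<le> m t"
    "AE t\<in>{a..b} in lborel. has_metric_speed \<beta> (m t) t"
    "\<And>s t. a \<le> s \<Longrightarrow> s \<le> t \<Longrightarrow> t \<le> b \<Longrightarrow> dist (\<beta> s) (\<beta> t) \<le> (LINT r:{s..t}|lborel. m r)"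
    by (rule abs_cont_curve_metric_speed[OF A(3,2)]) blast
  have [measurable]: "w \<in> borel_measurable borel" "m \<in> borel_measurable borel"
    using w m by (auto simp: borel_measurable_integrable)
  define \<phi> where "\<phi> t = indicator {a..b} t * f (\<alpha> t)" for t
  have [measurable]: "\<phi> \<in> borel_measurable borel" unfolding \<phi>_def
    using cone_indicator_measurable(1)[OF A(1,4) f] .
  obtain K where K: "\<And>t. t \<in> {a..b} \<Longrightarrow> \<bar>f (\<alpha> t)\<bar> \<le> K"
    using cone_indicator_measurable(2)[OF A(1,4) f] by blast
  have K0: "0 \<le> K" using K[of a] A(2) by auto
  define h where "h t = sqrt ((w t)\<^sup>2 + (\<phi> t)\<^sup>2 * (m t)\<^sup>2)" for t
  have hm[measurable]: "h \<in> borel_measurable borel" unfolding h_def by measurable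
  have h0: "0 \<le> h t" for t unfolding h_def by simp
  have hint: "integrable lborel h"
  proof (rule Bochner_Integration.integrable_bound)
    show "integrable lborel (\<lambda>t. \<bar>w t\<bar> + K * m t)" using w m by auto
    show "AE t in lborel. norm (h t) \<le> norm (\<bar>w t\<bar> + K * m t)"
    proof (rule AE_I2)
      fix t
      have "h t \<le> \<bar>w t\<bar> + \<bar>\<phi> t * m t\<bar>"
        unfolding h_def using sqrt_sum_squares_le_sum_abs[of "w t" "\<phi> t * m t"] by (simp add: power_mult_distrib)
      moreover have "\<bar>\<phi> t * m t\<bar> \<le> K * m t"
        using K[of t] K0 m(2)[of t] by (auto simp: \<phi>_def abs_mult indicator_def intro!: mult_right_mono)
      ultimately show "norm (h t) \<le> norm (\<bar>w t\<bar> + K * m t)" using h0[of t] by simp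
    qed
  qed measurable
  have reg: "AE t\<in>{a..b} in lborel. cone_speed_at f \<alpha> \<beta> t (h t)"
    using w(2) m(3) by eventually_elim (auto simp: cone_speed_at_def h_def \<phi>_def)
  show thesis
  proof (rule that[OF hint h0 reg])
    show "cone_length f a b \<alpha> \<beta> = (LINT t:{a..b}|lborel. h t)"
      unfolding cone_length_def
      by (rule set_lebesgue_integral_AE_eq[OF hm]) (use reg in \<open>eventually_elim, auto dest: cone_speed_at_integrand\<close>)
    show "\<bar>\<alpha> t - \<alpha> s\<bar> \<le> (LINT r:{s..t}|lborel. h r)" if "a \<le> s" "s \<le> t" "t \<le> b" for s t
      unfolding w(3)[OF that]
      by (rule abs_set_integral_le_lborel[OF w(1) hint]) (auto simp: h_def real_le_rsqrt)
    show "c * dist (\<beta> s) (\<beta> t) \<le> (LINT r:{s..t}|lborel. h r)"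
      if st: "a \<le> s" "s \<le> t" "t \<le> b" and c: "0 \<le> c" "\<And>r. r \<in> {s..t} \<Longrightarrow> c \<le> f (\<alpha> r)" for s t c
    proof -
      have "c * dist (\<beta> s) (\<beta> t) \<le> (LINT r:{s..t}|lborel. c * m r)"
        using mult_left_mono[OF m(4)[OF st] c(1)] by simp
      also have "\<dots> \<le> (LINT r:{s..t}|lborel. h r)"
        unfolding set_lebesgue_integral_def
      proof (rule integral_mono)
        show "integrable lborel (\<lambda>x. indicat_real {s..t} x *\<^sub>R (c * m x))"
          "integrable lborel (\<lambda>x. indicat_real {s..t} x *\<^sub>R h x)"
          using m(1) hint by (intro integrable_mult_indicator; simp)+
        fix r
        show "indicat_real {s..t} r *\<^sub>R (c * m r) \<le> indicat_real {s..t} r *\<^sub>R h r"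
        proof (cases "r \<in> {s..t}")
          case True
          then have r: "r \<in> {a..b}" using st by auto
          have "c * m r \<le> \<phi> r * m r" using c(2)[OF True] r m(2) by (auto simp: \<phi>_def intro: mult_right_mono)
          also have "\<dots> \<le> h r" unfolding h_def by (rule real_le_rsqrt) (simp add: power_mult_distrib)
          finally show ?thesis using True by simp
        qed simp
      qed
      finally show ?thesis .
    qed
  qed
qed

lemma lborel_integral_reflect:
  fixes h :: "real \<Rightarrow> real"
  shows "(LINT t:{a..b}|lborel. h (e - t)) = (LINT t:{e - b..e - a}|lborel. h t)"
proof -
  have "(LINT t:{e - b..e - a}|lborel. h t) = (LINT x|lborel. indicator {e - b..e - a} (e + (-1) * x) *\<^sub>R h (e + (-1) * x))"
    unfolding set_lebesgue_integral_def
    using lborel_integral_real_affine[of "-1" "\<lambda>t. indicator {e - b..e - a} t *\<^sub>R h t" e] by simp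
  also have "\<dots> = (LINT t:{a..b}|lborel. h (e - t))"
    unfolding set_lebesgue_integral_def by (rule Bochner_Integration.integral_cong) (auto simp: indicator_def)
  finally show ?thesis ..
qed

text \<open>Concatenation with a reversed curve yields both symmetry and the triangle inequality.\<close>

lemma cone_curve_concat_reverse:
  fixes \<beta> \<beta>' :: "real \<Rightarrow> 'a::metric_space"
  assumes c1: "ac_curve I a b \<alpha> \<beta>" and c2: "ac_curve I c d \<alpha>' \<beta>'"
    and eq: "\<alpha> b = \<alpha>' d" "\<beta> b = \<beta>' d" and f: "continuous_on I f"
  obtains e A B where "ac_curve I a e A B" "A a = \<alpha> a" "B a = \<beta> a" "A e = \<alpha>' c" "B e = \<beta>' c"
    "cone_length f a e A B = cone_length f a b \<alpha> \<beta> + cone_length f c d \<alpha>' \<beta>'"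
proof -
  \<comment> \<open>The second curve is traversed backwards on [b, e]: the map t -> k - t sends b to
    d and e to c.\<close>
  define e where "e = b + d - c"
  define k where "k = b + d"
  have ab: "a < b" "c < d" "b < e" "k - e = c" "k - b = d" using c1 c2 by (auto simp: ac_curve_def e_def k_def)
  have acglue: "abs_cont_curve a e (\<lambda>t. if t \<le> b then p t else q (k - t))"
    if p: "abs_cont_curve a b p" and q: "abs_cont_curve c d q" and pq: "p b = q d" for p q :: "real \<Rightarrow> 'x::metric_space"
  proof -
    obtain g where g: "integrable lborel g" "\<And>t. 0 \<le> g t"
      "\<And>s t. s \<le> t \<Longrightarrow> dist (p (clamp_to a b s)) (p (clamp_to a b t)) \<le> (LINT r:{s..t}|lborel. g r)"
      by (rule abs_cont_curve_extend[OF p less_imp_le[OF ab(1)]]) blast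
    obtain g' where g': "integrable lborel g'" "\<And>t. 0 \<le> g' t"
      "\<And>s t. s \<le> t \<Longrightarrow> dist (q (clamp_to c d s)) (q (clamp_to c d t)) \<le> (LINT r:{s..t}|lborel. g' r)"
      by (rule abs_cont_curve_extend[OF q less_imp_le[OF ab(2)]]) blast
    \<comment> \<open>The sum bounds the increments on either piece, so no case distinction at b is
      needed in the bound.\<close>
    define G where "G t = g t + g' (k - t)" for t
    have g'r: "integrable lborel (\<lambda>t. g' (k - t))"
      using lborel_integrable_real_affine[OF g'(1), of "-1" k] by simp
    have G: "integrable lborel G" "\<And>t. 0 \<le> G t" unfolding G_def[abs_def] using g g' g'r by (auto intro: Bochner_Integration.integrable_add)
    have Gm: "G \<in> borel_measurable borel" using G(1) by (simp add: borel_measurable_integrable)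
    let ?\<gamma> = "\<lambda>t. if t \<le> b then p t else q (k - t)"
    have 1: "dist (?\<gamma> s) (?\<gamma> t) \<le> (LINT r:{s..t}|lborel. G r)" if "a \<le> s" "s \<le> t" "t \<le> b" for s t
    proof -
      have "dist (?\<gamma> s) (?\<gamma> t) \<le> (LINT r:{s..t}|lborel. g r)" using g(3)[of s t] that by simp
      also have "\<dots> \<le> (LINT r:{s..t}|lborel. G r)"
        by (rule set_integral_mono_lborel[OF g(1) G(1)]) (use g' in \<open>auto simp: G_def\<close>)
      finally show ?thesis .
    qed
    have gb: "?\<gamma> t = q (k - t)" if "b \<le> t" for t using that pq ab by auto
    have 2: "dist (?\<gamma> s) (?\<gamma> t) \<le> (LINT r:{s..t}|lborel. G r)" if "b \<le> s" "s \<le> t" "t \<le> e" for s t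
    proof -
      have "dist (?\<gamma> s) (?\<gamma> t) = dist (q (k - t)) (q (k - s))"
        using gb[of s] gb[of t] that by (simp add: dist_commute)
      also have "\<dots> \<le> (LINT r:{k - t..k - s}|lborel. g' r)"
        using g'(3)[of "k - t" "k - s"] that ab by simp
      also have "\<dots> = (LINT r:{s..t}|lborel. g' (k - r))" by (simp add: lborel_integral_reflect)
      also have "\<dots> \<le> (LINT r:{s..t}|lborel. G r)"
        by (rule set_integral_mono_lborel[OF g'r G(1)]) (use g in \<open>auto simp: G_def\<close>)
      finally show ?thesis .
    qed
    show ?thesis unfolding abs_cont_curve_def
    proof (intro exI[of _ G] conjI allI impI)
      show "set_integrable lborel {a..e} G" by (rule set_integrable_lborel) (use G in auto)
      fix s t assume st: "a \<le> s \<and> s \<le> t \<and> t \<le> e"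
      show "dist (?\<gamma> s) (?\<gamma> t) \<le> (LINT r:{s..t}|lborel. G r)"
      proof (cases "t \<le> b \<or> b \<le> s")
        case True then show ?thesis using 1[of s t] 2[of s t] st by blast
      next
        case False
        have "dist (?\<gamma> s) (?\<gamma> t) \<le> dist (?\<gamma> s) (?\<gamma> b) + dist (?\<gamma> b) (?\<gamma> t)" by (rule dist_triangle)
        also have "\<dots> \<le> (LINT r:{s..b}|lborel. G r) + (LINT r:{b..t}|lborel. G r)"
          using False st by (intro add_mono 1 2) auto
        also have "\<dots> = (LINT r:{s..t}|lborel. G r)"
          by (rule set_lborel_integral_Icc_split[symmetric]) (use False st G Gm set_integrable_lborel in auto)
        finally show ?thesis .
      qed
    qed
  qed
  define A where "A t = (if t \<le> b then \<alpha> t else \<alpha>' (k - t))" for t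
  define B where "B t = (if t \<le> b then \<beta> t else \<beta>' (k - t))" for t
  have ac: "ac_curve I a e A B"
    using c1 c2 ab eq acglue[of \<alpha> \<alpha>'] acglue[of \<beta> \<beta>'] unfolding ac_curve_def A_def B_def
    by (auto simp: image_subset_iff)
  obtain h where h: "integrable lborel h" "\<And>t. 0 \<le> h t"
    "AE t\<in>{a..b} in lborel. cone_speed_at f \<alpha> \<beta> t (h t)"
    "cone_length f a b \<alpha> \<beta> = (LINT t:{a..b}|lborel. h t)"
    by (rule cone_length_representation[OF c1 f]) blast
  obtain h' where h': "integrable lborel h'" "\<And>t. 0 \<le> h' t"
    "AE t\<in>{c..d} in lborel. cone_speed_at f \<alpha>' \<beta>' t (h' t)"
    "cone_length f c d \<alpha>' \<beta>' = (LINT t:{c..d}|lborel. h' t)"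
    by (rule cone_length_representation[OF c2 f]) blast
  define H where "H t = (if t \<le> b then h t else h' (k - t))" for t
  have [measurable]: "h \<in> borel_measurable borel" "h' \<in> borel_measurable borel"
    using h h' by (auto simp: borel_measurable_integrable)
  have Hm[measurable]: "H \<in> borel_measurable borel" unfolding H_def by measurable
  have h'r: "integrable lborel (\<lambda>t. h' (k - t))"
    using lborel_integrable_real_affine[OF h'(1), of "-1" k] by simp
  \<comment> \<open>The glued curve may have a corner at b; every other point has a neighbourhood
    where it is one of the two pieces.\<close>
  have HAE: "AE t\<in>{a..e} in lborel. cone_speed_at f A B t (H t)"
    using h(3) AE_lborel_reflect[OF h'(3), of k] AE_lborel_singleton[of b]
  proof (eventually_elim, intro impI)
    fix t assume t: "t \<in> {a..b} \<longrightarrow> cone_speed_at f \<alpha> \<beta> t (h t)"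
      "k - t \<in> {c..d} \<longrightarrow> cone_speed_at f \<alpha>' \<beta>' (k - t) (h' (k - t))" "t \<noteq> b" "t \<in> {a..e}"
    show "cone_speed_at f A B t (H t)"
    proof (cases "t < b")
      case True
      then have *: "cone_speed_at f \<alpha> \<beta> t (H t)" using t(1,4) by (simp add: H_def)
      show ?thesis
        by (rule cone_speed_at_cong[OF *, of "{..<b}"]) (use True in \<open>auto simp: A_def B_def\<close>)
    next
      case False
      then have "k - t \<in> {c..d}" "b < t" using t(3,4) ab by (auto simp: k_def e_def)
      then have "cone_speed_at f \<alpha>' \<beta>' (k - t) (H t)" using t(2) by (simp add: H_def)
      then have *: "cone_speed_at f (\<lambda>t. \<alpha>' (k - t)) (\<lambda>t. \<beta>' (k - t)) t (H t)"
        by (rule cone_speed_at_reflect)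
      show ?thesis
        by (rule cone_speed_at_cong[OF *, of "{b<..}"]) (use \<open>b < t\<close> in \<open>auto simp: A_def B_def\<close>)
    qed
  qed
  have "cone_length f a e A B = (LINT t:{a..e}|lborel. H t)"
    unfolding cone_length_def
    by (rule set_lebesgue_integral_AE_eq[OF Hm]) (use HAE in \<open>eventually_elim, auto dest: cone_speed_at_integrand\<close>)
  also have "\<dots> = (LINT t:{a..b}|lborel. H t) + (LINT t:{b..e}|lborel. H t)"
  proof (rule set_lborel_integral_Icc_split[OF _ _ _ Hm])
    have "integrable lborel (\<lambda>t. \<bar>h t\<bar> + \<bar>h' (k - t)\<bar>)" using h h'r by auto
    then have "integrable lborel H"
      by (rule Bochner_Integration.integrable_bound) (measurable, auto simp: H_def)
    then show "set_integrable lborel {a..e} H" by (rule set_integrable_lborel) auto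
  qed (use ab in auto)
  also have "(LINT t:{a..b}|lborel. H t) = (LINT t:{a..b}|lborel. h t)"
    unfolding set_lebesgue_integral_def by (rule Bochner_Integration.integral_cong) (auto simp: H_def indicator_def)
  also have "(LINT t:{b..e}|lborel. H t) = (LINT t:{b..e}|lborel. h' (k - t))"
    unfolding set_lebesgue_integral_def
    by (rule integral_cong_AE) (measurable, use AE_lborel_singleton[of b] in \<open>eventually_elim, auto simp: H_def indicator_def\<close>)
  also have "\<dots> = (LINT t:{c..d}|lborel. h' t)" using ab by (simp add: lborel_integral_reflect)
  finally have "cone_length f a e A B = cone_length f a b \<alpha> \<beta> + cone_length f c d \<alpha>' \<beta>'"
    using h(4) h'(4) by simp
  moreover have "A a = \<alpha> a" "B a = \<beta> a" "A e = \<alpha>' c" "B e = \<beta>' c" using ab by (auto simp: A_def B_def)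
  ultimately show thesis using that ac by blast
qed

section \<open>The cone over the line\<close>

lemma cone_rel_pos: "(\<And>t. f t \<noteq> 0) \<Longrightarrow> cone_rel UNIV f = Id"
  by (auto simp: cone_rel_def)

lemma abs_cont_curve_Lipschitz:
  assumes "\<And>s t. a \<le> s \<Longrightarrow> s \<le> t \<Longrightarrow> t \<le> b \<Longrightarrow> dist (\<gamma> s) (\<gamma> t) \<le> C * (t - s)"
  shows "abs_cont_curve a b \<gamma>"
  unfolding abs_cont_curve_def
proof (intro exI[of _ "\<lambda>_. C"] conjI allI impI)
  show "set_integrable lborel {a..b} (\<lambda>_. C)"
    by (auto simp: set_integrable_def integrable_indicator_iff emeasure_lborel_Icc_eq)
  show "dist (\<gamma> s) (\<gamma> t) \<le> (LINT r:{s..t}|lborel. C)" if "a \<le> s \<and> s \<le> t \<and> t \<le> b" for s t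
    using assms[of s t] that by (simp add: set_lebesgue_integral_def ac_simps)
qed

lemma metric_speed_const [simp]: "metric_speed (\<lambda>_. x) t = 0"
  by (rule metric_speed_eqI) (simp add: has_metric_speed_def)

lemma cone_length_nonneg: "0 \<le> cone_length f a b \<alpha> \<beta>"
  unfolding cone_length_def set_lebesgue_integral_def by (rule integral_nonneg_AE) simp

lemma space_borel_of [simp]: "space (borel_of Y) = topspace Y"
  by (simp add: borel_of_def space_measure_of_conv)

lemma borel_of_sets: "sets (borel_of Y) = sigma_sets (topspace Y) {U. openin Y U}"
  unfolding borel_of_def by (rule sets_measure_of) (auto dest: openin_subset)

lemma open_in_borel_of: "openin Y U \<Longrightarrow> U \<in> sets (borel_of Y)"
  by (simp add: borel_of_sets)

lemma continuous_map_measurable: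
  assumes "continuous_map Y Z g"
  shows "g \<in> measurable (borel_of Y) (borel_of Z)"
  unfolding borel_of_def[of Z]
proof (rule measurable_measure_of)
  show "g \<in> space (borel_of Y) \<rightarrow> topspace Z"
    using assms by (auto simp: continuous_map_def)
  fix U assume "U \<in> {U. openin Z U}"
  then have "openin Y {x \<in> topspace Y. g x \<in> U}" using assms by (simp add: continuous_map_def)
  moreover have "g -` U \<inter> space (borel_of Y) = {x \<in> topspace Y. g x \<in> U}" by auto
  ultimately show "g -` U \<inter> space (borel_of Y) \<in> sets (borel_of Y)" by (simp add: open_in_borel_of)
qed (auto dest: openin_subset)

section \<open>The cone over the whole line: its metric induces the product topology\<close>

locale warped_line =
  fixes f :: "real \<Rightarrow> real" and X :: "'a::metric_space itself"
  assumes cont: "continuous_on UNIV f" and pos: "\<And>t. 0 < f t" and geodesic: "geodesic_space TYPE('a)"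
begin

abbreviation pt :: "real \<times> 'a \<Rightarrow> (real \<times> 'a) set" where "pt q \<equiv> {q}"

definition D :: "real \<times> 'a \<Rightarrow> real \<times> 'a \<Rightarrow> real" where
  "D q q' = cone_dist UNIV f (pt q) (pt q')"

lemma cone_pt_eq: "cone_pt UNIV f q = pt q"
  using cone_rel_pos[of f] pos by (auto simp: cone_pt_def less_imp_neq[symmetric])

lemma cone_points_eq: "(cone_points UNIV f :: (real \<times> 'a) set set) = range pt"
  using cone_rel_pos[of f] pos by (auto simp: cone_points_def quotient_def less_imp_neq[symmetric])

definition lengths :: "real \<times> 'a \<Rightarrow> real \<times> 'a \<Rightarrow> real set" where
  "lengths q q' = {l. \<exists>a b \<alpha> \<beta>. ac_curve UNIV a b \<alpha> \<beta> \<and> (\<alpha> a, \<beta> a) = q \<and> (\<alpha> b, \<beta> b) = q' \<and>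
     l = cone_length f a b \<alpha> \<beta>}"

lemma D_eq: "D q q' = Inf (lengths q q')"
  unfolding D_def cone_dist_def lengths_def cone_points_eq cone_length_def by simp

lemma lengths_nonneg: "l \<in> lengths q q' \<Longrightarrow> 0 \<le> l"
  by (auto simp: lengths_def cone_length_nonneg)

lemma bdd_below_lengths: "bdd_below (lengths q q')"
  by (rule bdd_belowI[of _ 0]) (rule lengths_nonneg)

lemma bounded_on_Icc:
  obtains K where "0 < K" "\<And>r. r \<in> {u..v} \<Longrightarrow> f r \<le> K"
proof -
  have "bounded (f ` {u..v})"
    by (intro compact_imp_bounded compact_continuous_image continuous_on_subset[OF cont]) auto
  then obtain K where "\<forall>r\<in>{u..v}. \<bar>f r\<bar> \<le> K" by (auto simp: bounded_iff)
  then show thesis by (intro that[of "max 1 K"]) fastforce+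
qed

lemma bounded_below_on_Icc:
  obtains c where "0 < c" "\<And>r. r \<in> {u..v} \<Longrightarrow> c \<le> f r"
proof (cases "u \<le> v")
  case True
  obtain z where "z \<in> {u..v}" "\<And>r. r \<in> {u..v} \<Longrightarrow> f z \<le> f r"
    using continuous_attains_inf[of "{u..v}" f] continuous_on_subset[OF cont] True by auto
  then show thesis using that pos by blast
qed (use that[of 1] in auto)

text \<open>The competitor is affine in time and a constant speed geodesic in X. Its length is
  estimated with sqrt(a^2 + b^2) <= |a| + |b|.\<close>

lemma straight_curve:
  assumes K: "\<And>r. r \<in> closed_segment s t \<Longrightarrow> f r \<le> K"
  shows "\<exists>l\<in>lengths (s,x) (t,y). l \<le> \<bar>t - s\<bar> + K * dist x y"
proof -
  obtain \<beta> :: "real \<Rightarrow> 'a" where \<beta>: "\<beta> 0 = x" "\<beta> 1 = y"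
    "\<And>u v. u \<in> {0..1} \<Longrightarrow> v \<in> {0..1} \<Longrightarrow> dist (\<beta> u) (\<beta> v) = \<bar>v - u\<bar> * dist x y"
    using geodesic unfolding geodesic_space_def by metis
  define \<alpha> where "\<alpha> r = s + r * (t - s)" for r
  have ac: "ac_curve UNIV 0 1 \<alpha> \<beta>"
    unfolding ac_curve_def
  proof (intro conjI)
    show "abs_cont_curve 0 1 \<alpha>"
      by (rule abs_cont_curve_Lipschitz[where C="\<bar>t - s\<bar>"])
        (simp add: \<alpha>_def dist_real_def left_diff_distrib[symmetric] abs_mult)
    show "abs_cont_curve 0 1 \<beta>"
      by (rule abs_cont_curve_Lipschitz[where C="dist x y"]) (simp add: \<beta>(3))
  qed auto
  define R where "R r = indicator {0..1} r * (\<bar>t - s\<bar> + K * dist x y)" for r :: real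
  have R: "integrable lborel R" unfolding R_def
    by (auto simp: integrable_indicator_iff)
  have "cone_length f 0 1 \<alpha> \<beta> \<le> (LINT r:{0..1}|lborel. R r)"
    unfolding cone_length_def
  proof (rule set_lebesgue_integral_AE_le[OF R])
    show "AE r\<in>{0..1} in lborel. sqrt ((deriv \<alpha> r)\<^sup>2 + (f (\<alpha> r))\<^sup>2 * (metric_speed \<beta> r)\<^sup>2) \<le> R r \<and> 0 \<le> R r"
      using AE_lborel_singleton[of 0] AE_lborel_singleton[of 1]
    proof (eventually_elim, intro impI)
      fix r :: real assume r: "r \<noteq> 0" "r \<noteq> 1" "r \<in> {0..1}"
      have "(\<alpha> has_real_derivative (t - s)) (at r)"
        unfolding \<alpha>_def by (auto intro!: derivative_eq_intros)
      then have d: "deriv \<alpha> r = t - s" by (rule DERIV_imp_deriv)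
      have m: "metric_speed \<beta> r = dist x y"
      proof (rule metric_speed_eqI, unfold has_metric_speed_def, rule Lim_transform_within_open[where s="{0<..<1}"])
        show "((\<lambda>_. dist x y) \<longlongrightarrow> dist x y) (at r)" by simp
        show "dist x y = dist (\<beta> u) (\<beta> r) / \<bar>u - r\<bar>" if "u \<in> {0<..<1}" "u \<noteq> r" for u
          using that r \<beta>(3)[of u r] by (simp add: abs_minus_commute)
      qed (use r in auto)
      have "\<alpha> r \<in> closed_segment s t" unfolding closed_segment_def \<alpha>_def
        using r by (intro CollectI exI[of _ r]) (auto simp: algebra_simps)
      then have fK: "f (\<alpha> r) \<le> K" by (rule K)
      then have K0: "0 \<le> K" using pos[of "\<alpha> r"] by linarith
      have "sqrt ((t - s)\<^sup>2 + (f (\<alpha> r) * dist x y)\<^sup>2) \<le> \<bar>t - s\<bar> + \<bar>f (\<alpha> r) * dist x y\<bar>"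
        by (rule sqrt_sum_squares_le_sum_abs)
      also have "\<dots> \<le> \<bar>t - s\<bar> + K * dist x y"
        using fK pos[of "\<alpha> r"] by (auto simp: abs_mult intro!: mult_right_mono)
      finally show "sqrt ((deriv \<alpha> r)\<^sup>2 + (f (\<alpha> r))\<^sup>2 * (metric_speed \<beta> r)\<^sup>2) \<le> R r \<and> 0 \<le> R r"
        unfolding d m R_def using r K0 by (simp add: power_mult_distrib)
    qed
  qed
  also have "\<dots> = (LINT r|lborel. R r)"
    unfolding set_lebesgue_integral_def by (rule Bochner_Integration.integral_cong) (auto simp: R_def indicator_def)
  also have "\<dots> = \<bar>t - s\<bar> + K * dist x y" unfolding R_def by simp
  finally have "cone_length f 0 1 \<alpha> \<beta> \<le> \<bar>t - s\<bar> + K * dist x y" .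
  moreover have "cone_length f 0 1 \<alpha> \<beta> \<in> lengths (s,x) (t,y)"
    unfolding lengths_def using ac \<beta>(1,2) \<alpha>_def
    by (intro CollectI exI[of _ 0] exI[of _ 1] exI[of _ \<alpha>] exI[of _ \<beta>]) (auto simp: \<alpha>_def)
  ultimately show ?thesis by blast
qed

lemma lengths_nonempty: "lengths q q' \<noteq> {}"
proof -
  obtain s x t y where q: "q = (s,x)" "q' = (t,y)" by fastforce
  obtain K where "\<And>r. r \<in> {min s t..max s t} \<Longrightarrow> f r \<le> K" using bounded_on_Icc by blast
  then show ?thesis using straight_curve[of s t K x y] unfolding q
    by (fastforce simp: closed_segment_eq_real_ivl split: if_splits)
qed

lemma D_le:
  assumes "\<And>r. r \<in> closed_segment s t \<Longrightarrow> f r \<le> K"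
  shows "D (s,x) (t,y) \<le> \<bar>t - s\<bar> + K * dist x y"
  using straight_curve[OF assms, where x=x and y=y] cInf_lower[OF _ bdd_below_lengths]
  unfolding D_eq by (meson order_trans)

lemma D_nonneg: "0 \<le> D q q'"
  unfolding D_eq by (rule cInf_greatest[OF lengths_nonempty lengths_nonneg])

lemma D_time_le: "\<bar>t - s\<bar> \<le> D (s,x) (t,y)"
  unfolding D_eq
proof (rule cInf_greatest[OF lengths_nonempty])
  fix l assume "l \<in> lengths (s,x) (t,y)"
  then obtain a b \<alpha> and \<beta> :: "real \<Rightarrow> 'a" where c: "ac_curve UNIV a b \<alpha> \<beta>" "(\<alpha> a, \<beta> a) = (s,x)" "(\<alpha> b, \<beta> b) = (t,y)"
    "l = cone_length f a b \<alpha> \<beta>" unfolding lengths_def by blast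
  obtain h where h: "integrable lborel h"
    "cone_length f a b \<alpha> \<beta> = (LINT t:{a..b}|lborel. h t)"
    "\<And>s t. a \<le> s \<Longrightarrow> s \<le> t \<Longrightarrow> t \<le> b \<Longrightarrow> \<bar>\<alpha> t - \<alpha> s\<bar> \<le> (LINT r:{s..t}|lborel. h r)"
    by (rule cone_length_representation[OF c(1) cont]) blast
  show "\<bar>t - s\<bar> \<le> l" using h(3)[of a b] h(2) c by (auto simp: ac_curve_def)
qed

text \<open>A curve of length below l cannot leave the time window of radius l around s, so a lower
  bound for f on that window is enough.\<close>

lemma D_space_le:
  assumes l: "D (s,x) (t,y) < l" and c: "0 \<le> c" "\<And>r. r \<in> {s - l..s + l} \<Longrightarrow> c \<le> f r"
  shows "c * dist x y \<le> l"
proof -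
  obtain l' where l': "l' \<in> lengths (s,x) (t,y)" "l' < l"
    using cInf_lessD[OF lengths_nonempty] l unfolding D_eq by blast
  then obtain a b \<alpha> and \<beta> :: "real \<Rightarrow> 'a" where cu: "ac_curve UNIV a b \<alpha> \<beta>" "(\<alpha> a, \<beta> a) = (s,x)" "(\<alpha> b, \<beta> b) = (t,y)"
    "l' = cone_length f a b \<alpha> \<beta>" unfolding lengths_def by blast
  obtain h where h: "integrable lborel h" "\<And>t. 0 \<le> h t"
    "cone_length f a b \<alpha> \<beta> = (LINT t:{a..b}|lborel. h t)"
    "\<And>s t. a \<le> s \<Longrightarrow> s \<le> t \<Longrightarrow> t \<le> b \<Longrightarrow> \<bar>\<alpha> t - \<alpha> s\<bar> \<le> (LINT r:{s..t}|lborel. h r)"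
    "\<And>s t c. a \<le> s \<Longrightarrow> s \<le> t \<Longrightarrow> t \<le> b \<Longrightarrow> 0 \<le> c \<Longrightarrow> (\<And>r. r \<in> {s..t} \<Longrightarrow> c \<le> f (\<alpha> r)) \<Longrightarrow>
       c * dist (\<beta> s) (\<beta> t) \<le> (LINT r:{s..t}|lborel. h r)"
    by (rule cone_length_representation[OF cu(1) cont]) blast
  have ab: "a < b" using cu(1) by (auto simp: ac_curve_def)
  have "\<alpha> r \<in> {s - l..s + l}" if r: "r \<in> {a..b}" for r
  proof -
    have "\<bar>\<alpha> r - \<alpha> a\<bar> \<le> (LINT r:{a..r}|lborel. h r)" using r by (intro h(4)) auto
    also have "\<dots> \<le> (LINT r:{a..b}|lborel. h r)"
      by (rule set_integral_mono_set_lborel) (use r h in auto)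
    also have "\<dots> < l" using h(3) cu l' by simp
    finally show ?thesis using cu(2) by (auto simp: abs_less_iff)
  qed
  then have "c * dist (\<beta> a) (\<beta> b) \<le> (LINT r:{a..b}|lborel. h r)"
    using ab c by (intro h(5)) auto
  then show ?thesis using cu h(3) l' by simp
qed

text \<open>The last distance has its arguments reversed because the second curve is run backwards.
  Taking the middle point equal to q turns this into symmetry, after which it is the usual triangle
  inequality.\<close>

lemma D_triangle': "D q q'' \<le> D q q' + D q'' q'"
proof (rule field_le_epsilon)
  fix e :: real assume e: "0 < e"
  obtain l1 where l1: "l1 \<in> lengths q q'" "l1 < D q q' + e/2"
    using cInf_lessD[OF lengths_nonempty, of q q' "D q q' + e/2"] e unfolding D_eq by auto
  obtain l2 where l2: "l2 \<in> lengths q'' q'" "l2 < D q'' q' + e/2"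
    using cInf_lessD[OF lengths_nonempty, of q'' q' "D q'' q' + e/2"] e unfolding D_eq by auto
  obtain a b \<alpha> and \<beta> :: "real \<Rightarrow> 'a" where c1: "ac_curve UNIV a b \<alpha> \<beta>" "(\<alpha> a, \<beta> a) = q" "(\<alpha> b, \<beta> b) = q'"
    "l1 = cone_length f a b \<alpha> \<beta>" using l1(1) unfolding lengths_def by blast
  obtain c d \<alpha>' and \<beta>' :: "real \<Rightarrow> 'a" where c2: "ac_curve UNIV c d \<alpha>' \<beta>'" "(\<alpha>' c, \<beta>' c) = q''" "(\<alpha>' d, \<beta>' d) = q'"
    "l2 = cone_length f c d \<alpha>' \<beta>'" using l2(1) unfolding lengths_def by blast
  have eq: "\<alpha> b = \<alpha>' d" "\<beta> b = \<beta>' d" using c1 c2 by auto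
  obtain e' A B where g: "ac_curve UNIV a e' A B" "A a = \<alpha> a" "B a = \<beta> a" "A e' = \<alpha>' c" "B e' = \<beta>' c"
    "cone_length f a e' A B = cone_length f a b \<alpha> \<beta> + cone_length f c d \<alpha>' \<beta>'"
    by (rule cone_curve_concat_reverse[OF c1(1) c2(1) eq cont]) blast
  have "l1 + l2 \<in> lengths q q''" unfolding lengths_def
    using g c1 c2 by (intro CollectI exI[of _ a] exI[of _ e'] exI[of _ A] exI[of _ B]) auto
  then have "D q q'' \<le> l1 + l2" unfolding D_eq by (rule cInf_lower[OF _ bdd_below_lengths])
  then show "D q q'' \<le> D q q' + D q'' q' + e" using l1 l2 by simp
qed

lemma D_self: "D q q = 0"
proof -
  obtain s x where q: "q = (s,x)" by fastforce
  have "D (s,x) (s,x) \<le> \<bar>s - s\<bar> + f s * dist x x" by (rule D_le) simp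
  then show ?thesis using D_nonneg[of q q] unfolding q by simp
qed

lemma D_commute: "D q q' = D q' q"
  using D_triangle'[of q q' q] D_triangle'[of q' q q'] D_self by (simp add: order_antisym)

lemma D_triangle: "D q q'' \<le> D q q' + D q' q''"
  using D_triangle'[of q q'' q'] D_commute by simp

lemma D_small:
  assumes "0 < r"
  obtains \<epsilon> where "0 < \<epsilon>" "\<And>q'. dist q q' < \<epsilon> \<Longrightarrow> D q q' < r"
proof -
  obtain s x where q: "q = (s,x)" by fastforce
  obtain K where K: "0 < K" "\<And>u. u \<in> {s-1..s+1} \<Longrightarrow> f u \<le> K" using bounded_on_Icc by blast
  define \<epsilon> where "\<epsilon> = min 1 (r / (1 + K))"
  \<comment> \<open>Within time distance 1 of s the cone distance is at most |t - s| + K * dist x y,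
    hence below (1 + K) * \<epsilon>.\<close>
  have \<epsilon>: "0 < \<epsilon>" "\<epsilon> \<le> 1" "(1 + K) * \<epsilon> \<le> r"
    using K(1) assms pos_le_divide_eq[of "1 + K" \<epsilon> r] by (auto simp: \<epsilon>_def mult.commute)
  show thesis
  proof (rule that[OF \<epsilon>(1)])
    fix q' assume d: "dist q q' < \<epsilon>"
    obtain t y where q': "q' = (t,y)" by fastforce
    have st: "\<bar>t - s\<bar> < \<epsilon>" "dist x y < \<epsilon>"
      using d dist_fst_le[of q q'] dist_snd_le[of q q'] unfolding q q' by (auto simp: dist_real_def)
    have "D (s,x) (t,y) \<le> \<bar>t - s\<bar> + K * dist x y"
      by (rule D_le) (use K(2) st \<epsilon>(2) in \<open>auto simp: closed_segment_eq_real_ivl abs_less_iff split: if_splits\<close>)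
    also have "\<dots> < \<epsilon> + K * \<epsilon>" using st K(1) by (intro add_strict_mono mult_strict_left_mono)
    also have "\<dots> \<le> r" using \<epsilon>(3) by (simp add: algebra_simps)
    finally show "D q q' < r" unfolding q q' .
  qed
qed

lemma dist_small:
  assumes "0 < \<epsilon>"
  obtains r where "0 < r" "\<And>q'. D q q' < r \<Longrightarrow> dist q q' < \<epsilon>"
proof -
  obtain s x where q: "q = (s,x)" by fastforce
  obtain c where c: "0 < c" "\<And>u. u \<in> {s-1..s+1} \<Longrightarrow> c \<le> f u" using bounded_below_on_Icc by blast
  \<comment> \<open>A cone distance below r bounds the time difference by r and the spatial distance
    by r/c, so the product distance is below r * P.\<close>
  define P where "P = 1 + 1/c"
  have p: "P > 0" using c by (simp add: P_def add_pos_pos)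
  define r where "r = min 1 (\<epsilon> / 2 / P)"
  have "r \<le> \<epsilon> / 2 / P" by (simp add: r_def)
  then have "r * P \<le> \<epsilon> / 2" using p by (simp only: pos_le_divide_eq)
  then have "r * P < \<epsilon>" using assms by simp
  then have r: "0 < r" "r \<le> 1" "r * (1 + 1/c) < \<epsilon>" using p assms by (auto simp: r_def P_def)
  show thesis
  proof (rule that[OF r(1)])
    fix q' assume d: "D q q' < r"
    obtain t y where q': "q' = (t,y)" by fastforce
    have t: "\<bar>t - s\<bar> < r" using D_time_le[of t s x y] d unfolding q q' by simp
    have "c * dist x y \<le> r"
      by (rule D_space_le[of s x t y r]) (use d c r in \<open>auto simp: q q'\<close>)
    then have "dist x y \<le> r / c" using c(1) by (simp add: pos_le_divide_eq mult.commute)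
    moreover have "dist q q' \<le> \<bar>s - t\<bar> + \<bar>dist x y\<bar>"
      unfolding q q' dist_Pair_Pair dist_real_def using sqrt_sum_squares_le_sum_abs[of "\<bar>s - t\<bar>" "dist x y"] by simp
    ultimately have "dist q q' < r * (1 + 1/c)" using t by (simp add: algebra_simps)
    then show "dist q q' < \<epsilon>" using r(3) by simp
  qed
qed

lemma cone_dist_metric: "Metric_space (cone_points UNIV f :: (real \<times> 'a) set set) (cone_dist UNIV f)"
proof
  fix y y' :: "(real \<times> 'a) set"
  show "0 \<le> cone_dist UNIV f y y'"
    using D_nonneg by (cases "y \<in> range pt \<and> y' \<in> range pt") (auto simp: D_def cone_dist_def cone_points_eq)
  show "cone_dist UNIV f y y' = cone_dist UNIV f y' y"
    using D_commute by (cases "y \<in> range pt \<and> y' \<in> range pt") (force simp: D_def, auto simp: cone_dist_def cone_points_eq)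
next
  fix y y' :: "(real \<times> 'a) set" assume "y \<in> cone_points UNIV f" "y' \<in> cone_points UNIV f"
  then obtain q q' where q: "y = pt q" "y' = pt q'" by (auto simp: cone_points_eq)
  have "D q q' = 0 \<longleftrightarrow> q = q'"
  proof
    assume 0: "D q q' = 0"
    have "dist q q' \<le> \<epsilon>" if "\<epsilon> > 0" for \<epsilon> using dist_small[OF that, of q] 0 by (metis less_imp_le)
    then show "q = q'" using field_le_epsilon[of "dist q q'" 0] by auto
  qed (simp add: D_self)
  then show "cone_dist UNIV f y y' = 0 \<longleftrightarrow> y = y'" unfolding q D_def by auto
next
  fix y y' y'' :: "(real \<times> 'a) set"
  assume "y \<in> cone_points UNIV f" "y' \<in> cone_points UNIV f" "y'' \<in> cone_points UNIV f"
  then show "cone_dist UNIV f y y'' \<le> cone_dist UNIV f y y' + cone_dist UNIV f y' y''"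
    using D_triangle by (auto simp: cone_points_eq D_def)
qed

lemma mspace_cone: "mspace (cone_metric UNIV f :: (real \<times> 'a) set metric) = range pt"
  unfolding cone_metric_def Metric_space.mspace_metric[OF cone_dist_metric] by (rule cone_points_eq)

lemma mdist_cone: "mdist (cone_metric UNIV f :: (real \<times> 'a) set metric) = cone_dist UNIV f"
  unfolding cone_metric_def by (rule Metric_space.mdist_metric[OF cone_dist_metric])

definition T :: "(real \<times> 'a) set topology" where
  "T = mtopology_of (cone_metric UNIV f)"

text \<open>The constants of \<open>D_small\<close> and \<open>dist_small\<close> depend on the
  centre, so the metrics are compared point by point; that suffices to identify the open
  sets.\<close>

lemma openin_T: "openin T U \<longleftrightarrow> U \<subseteq> range pt \<and> open {q. pt q \<in> U}"
proof -
  interpret Metric_space "range pt :: (real \<times> 'a) set set" "cone_dist UNIV f"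
    using cone_dist_metric unfolding cone_points_eq .
  have "openin T U \<longleftrightarrow> U \<subseteq> range pt \<and> (\<forall>x. x \<in> U \<longrightarrow> (\<exists>r>0. mball x r \<subseteq> U))"
    unfolding T_def mtopology_of_def mspace_cone mdist_cone openin_mtopology by blast
  also have "\<dots> \<longleftrightarrow> U \<subseteq> range pt \<and> (\<forall>q. pt q \<in> U \<longrightarrow> (\<exists>r>0. \<forall>q'. D q q' < r \<longrightarrow> pt q' \<in> U))"
  proof (intro conj_cong refl)
    have ball: "mball (pt q) r = pt ` {q'. D q q' < r}" for q r by (auto simp: mball_def D_def)
    assume "U \<subseteq> range pt"
    then have "(\<forall>x. x \<in> U \<longrightarrow> P x) \<longleftrightarrow> (\<forall>q. pt q \<in> U \<longrightarrow> P (pt q))" for P by blast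
    then show "(\<forall>x. x \<in> U \<longrightarrow> (\<exists>r>0. mball x r \<subseteq> U)) \<longleftrightarrow>
        (\<forall>q. pt q \<in> U \<longrightarrow> (\<exists>r>0. \<forall>q'. D q q' < r \<longrightarrow> pt q' \<in> U))"
      by (simp add: ball image_subset_iff)
  qed
  also have "\<dots> \<longleftrightarrow> U \<subseteq> range pt \<and> (\<forall>q. pt q \<in> U \<longrightarrow> (\<exists>r>0. \<forall>q'. dist q' q < r \<longrightarrow> pt q' \<in> U))"
  proof (intro conj_cong refl iff_allI imp_cong)
    fix q
    show "(\<exists>r>0. \<forall>q'. D q q' < r \<longrightarrow> pt q' \<in> U) \<longleftrightarrow> (\<exists>r>0. \<forall>q'. dist q' q < r \<longrightarrow> pt q' \<in> U)"
    proof
      assume "\<exists>r>0. \<forall>q'. D q q' < r \<longrightarrow> pt q' \<in> U"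
      then obtain r where r: "0 < r" "\<And>q'. D q q' < r \<Longrightarrow> pt q' \<in> U" by blast
      obtain e where "0 < e" "\<And>q'. dist q q' < e \<Longrightarrow> D q q' < r" using D_small[OF r(1)] by metis
      then show "\<exists>r>0. \<forall>q'. dist q' q < r \<longrightarrow> pt q' \<in> U" using r(2) by (metis dist_commute)
    next
      assume "\<exists>r>0. \<forall>q'. dist q' q < r \<longrightarrow> pt q' \<in> U"
      then obtain r where r: "0 < r" "\<And>q'. dist q' q < r \<Longrightarrow> pt q' \<in> U" by blast
      obtain e where "0 < e" "\<And>q'. D q q' < e \<Longrightarrow> dist q q' < r" using dist_small[OF r(1)] by metis
      then show "\<exists>r>0. \<forall>q'. D q q' < r \<longrightarrow> pt q' \<in> U" using r(2) by (metis dist_commute)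
    qed
  qed
  also have "\<dots> \<longleftrightarrow> U \<subseteq> range pt \<and> open {q. pt q \<in> U}"
    unfolding open_dist by simp
  finally show ?thesis .
qed

lemma topspace_T: "topspace T = range pt"
  unfolding T_def topspace_mtopology_of mspace_cone ..

lemma measurable_pt: "pt \<in> measurable borel (borel_of T)"
  unfolding borel_of_def
proof (rule measurable_measure_of)
  show "{U. openin T U} \<subseteq> Pow (topspace T)" by (auto dest: openin_subset)
  fix U assume "U \<in> {U. openin T U}"
  then have "open {q. pt q \<in> U}" by (simp add: openin_T)
  then show "pt -` U \<inter> space borel \<in> sets borel" by (simp add: vimage_def)
qed (simp add: topspace_T)

lemma measurable_the_elem: "the_elem \<in> measurable (borel_of T) (borel :: (real \<times> 'a) measure)"
proof (rule borel_measurableI)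
  fix S :: "(real \<times> 'a) set" assume S: "open S"
  have "the_elem -` S \<inter> space (borel_of T) = pt ` S" by (auto simp: topspace_T)
  moreover have "openin T (pt ` S)" unfolding openin_T
  proof
    have "{q. pt q \<in> pt ` S} = S" by auto
    then show "open {q. pt q \<in> pt ` S}" using S by simp
  qed auto
  ultimately show "the_elem -` S \<inter> space (borel_of T) \<in> sets (borel_of T)" by (simp add: open_in_borel_of)
qed

end

section \<open>Time separation: upper bound and equality case\<close>

lemma abs_cont_curve_const: "abs_cont_curve a b (\<lambda>_. x)"
  by (rule abs_cont_curve_Lipschitz[where C=0]) simp

lemma vertical_curve:
  assumes "s < t"
  shows "fd_timelike_curve UNIV f s t (\<lambda>r. r) (\<lambda>_. x)"
    and "lorentz_length f s t (\<lambda>r. r) (\<lambda>_. x) = t - s"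
proof -
  have [simp]: "deriv (\<lambda>r::real. r) = (\<lambda>_. 1)" by (auto intro!: DERIV_imp_deriv)
  have "abs_cont_curve s t (\<lambda>r::real. r)"
    by (rule abs_cont_curve_Lipschitz[where C=1]) (auto simp: dist_real_def)
  then show "fd_timelike_curve UNIV f s t (\<lambda>r. r) (\<lambda>_. x)"
    using assms unfolding fd_timelike_curve_def ac_curve_def
    by (auto simp: abs_cont_curve_const strict_mono_on_def)
  show "lorentz_length f s t (\<lambda>r. r) (\<lambda>_. x) = t - s"
    using assms by (simp add: lorentz_length_def set_lebesgue_integral_def)
qed

definition proper_times ::
    "(real \<Rightarrow> real) \<Rightarrow> real \<times> 'a::metric_space \<Rightarrow> real \<times> 'a \<Rightarrow> real set" where
  "proper_times f q q' = {lorentz_length f a b \<alpha> \<beta> | a b \<alpha> \<beta>.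
     fd_causal_curve UNIV f a b \<alpha> \<beta> \<and> (\<alpha> a, \<beta> a) \<in> {q} \<and> (\<alpha> b, \<beta> b) \<in> {q'}}"

lemma cone_tsep_eq:
  "cone_tsep UNIV f {q} {q'} = (if proper_times f q q' = {} then 0 else Sup (proper_times f q q'))"
  unfolding cone_tsep_def proper_times_def Let_def ..

lemma proper_times_bounds:
  assumes "l \<in> proper_times f (s,x) (t,y)"
  shows "s < t" "l \<le> t - s"
    "\<lbrakk>0 \<le> c; \<And>r. r \<in> {s..t} \<Longrightarrow> c \<le> f r; 0 \<le> Q\<rbrakk> \<Longrightarrow> l \<le> (1 + Q\<^sup>2/2) * (t - s) - Q * (c * dist x y)"
proof -
  obtain a b \<alpha> \<beta> where c: "fd_causal_curve UNIV f a b \<alpha> \<beta>" "\<alpha> a = s" "\<beta> a = x" "\<alpha> b = t" "\<beta> b = y"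
    "l = lorentz_length f a b \<alpha> \<beta>"
    using assms unfolding proper_times_def by auto
  show "s < t" using c by (auto simp: fd_causal_curve_def ac_curve_def strict_mono_on_def)
  show "l \<le> t - s" using lorentz_length_le[OF c(1)] c by simp
  show "l \<le> (1 + Q\<^sup>2/2) * (t - s) - Q * (c * dist x y)"
    if "0 \<le> c" "\<And>r. r \<in> {s..t} \<Longrightarrow> c \<le> f r" "0 \<le> Q"
    using lorentz_length_strict_le[OF c(1) that(1) _ that(3)] that(2) c by auto
qed

lemma cone_tsep_le:
  assumes "s \<le> t"
  shows "cone_tsep UNIV f {(s,x)} {(t,y)} \<le> t - s"
proof (cases "proper_times f (s,x) (t,y) = {}")
  case False
  then have "Sup (proper_times f (s,x) (t,y)) \<le> t - s" by (rule cSup_least) (rule proper_times_bounds(2))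
  then show ?thesis using False by (simp add: cone_tsep_eq)
qed (use assms in \<open>simp add: cone_tsep_eq\<close>)

lemma cone_tsep_pos_imp_less:
  assumes "0 < cone_tsep UNIV f {(s,x)} {(t,y)}"
  shows "s < t"
proof -
  obtain l where "l \<in> proper_times f (s,x) (t,y)"
    using assms unfolding cone_tsep_eq by (auto split: if_splits)
  then show ?thesis by (rule proper_times_bounds(1))
qed

lemma cone_tsep_vertical:
  assumes "s < t"
  shows "cone_tsep UNIV f {(s,x)} {(t,x)} = t - s"
proof -
  have *: "t - s \<in> proper_times f (s,x) (t,x)"
    unfolding proper_times_def
    using fd_timelike_imp_causal[OF vertical_curve(1)[OF assms, where x=x]] vertical_curve(2)[OF assms, where x=x]
    by (intro CollectI exI[of _ s] exI[of _ t] exI[of _ "\<lambda>r. r"] exI[of _ "\<lambda>_. x"]) auto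
  have "t - s \<le> Sup (proper_times f (s,x) (t,x))"
    by (rule cSup_upper[OF *]) (auto intro!: bdd_aboveI[of _ "t - s"] proper_times_bounds(2))
  moreover have "proper_times f (s,x) (t,x) \<noteq> {}" using * by blast
  ultimately show ?thesis using cone_tsep_le[of s t f x x] assms by (simp add: cone_tsep_eq)
qed

text \<open>With c the minimum of f on [s, t], the linear bounds pass to the supremum and give t - s
  <= (1 + Q^2/2)(t - s) - Q c dist x y. The terms of order zero cancel, so c dist x y <= Q (t - s)/2
  for every Q > 0, which forces the distance to vanish.\<close>

lemma cone_tsep_eq_imp_vertical:
  assumes pos: "\<And>r. 0 < f r" and f: "continuous_on UNIV f"
    and eq: "cone_tsep UNIV f {(s,x)} {(t,y)} = t - s" and st: "s < t"
  shows "x = y"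
proof -
  obtain z where z: "z \<in> {s..t}" "\<And>r. r \<in> {s..t} \<Longrightarrow> f z \<le> f r"
    using continuous_attains_inf[of "{s..t}" f] continuous_on_subset[OF f] st by auto
  have ne: "proper_times f (s,x) (t,y) \<noteq> {}" using eq st by (auto simp: cone_tsep_eq split: if_splits)
  have le: "f z * dist x y \<le> Q * (t - s) / 2" if "0 < Q" for Q
  proof -
    have "Sup (proper_times f (s,x) (t,y)) \<le> (1 + Q\<^sup>2/2) * (t - s) - Q * (f z * dist x y)"
      by (rule cSup_least[OF ne], rule proper_times_bounds(3)) (use z pos[of z] that in auto)
    then have "Q * (f z * dist x y) \<le> Q * (Q * (t - s) / 2)"
    proof -
      have "(1 + Q\<^sup>2/2) * (t - s) = (t - s) + Q * (Q * (t - s) / 2)"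
        by (simp add: distrib_right power2_eq_square)
      moreover have "Sup (proper_times f (s,x) (t,y)) = t - s" using eq ne by (simp add: cone_tsep_eq)
      moreover assume "Sup (proper_times f (s,x) (t,y)) \<le> (1 + Q\<^sup>2/2) * (t - s) - Q * (f z * dist x y)"
      ultimately show ?thesis by linarith
    qed
    then show ?thesis using that by (simp only: mult_le_cancel_left_pos)
  qed
  have "f z * dist x y \<le> 0"
  proof (rule field_le_epsilon)
    fix e :: real assume "0 < e"
    \<comment> \<open>This choice of Q makes Q (t - s)/2 equal to e.\<close>
    then show "f z * dist x y \<le> 0 + e" using le[of "2 * e / (t - s)"] st by simp
  qed
  then show ?thesis using pos[of z] by (simp add: mult_le_0_iff)
qed

lemma cone_chron_vertical: "s < t \<Longrightarrow> cone_chron UNIV f {(s,x)} {(t,x)}"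
  unfolding cone_chron_def using vertical_curve(1)[of s t f x]
  by (intro exI[of _ s] exI[of _ t] exI[of _ "\<lambda>r. r"] exI[of _ "\<lambda>_. x"]) auto

lemma cone_caus_imp_le:
  fixes x y :: "'a::metric_space"
  assumes "cone_caus UNIV f {(s,x)} {(t,y)}"
  shows "s \<le> t"
proof (cases "s = t \<and> x = y")
  case False
  then obtain a b \<alpha> and \<beta> :: "real \<Rightarrow> 'a" where "fd_causal_curve UNIV f a b \<alpha> \<beta>" "\<alpha> a = s" "\<alpha> b = t"
    using assms unfolding cone_caus_def by auto
  then show ?thesis by (auto simp: fd_causal_curve_def ac_curve_def strict_mono_on_def less_imp_le)
qed simp

section \<open>Measurability and integral inequalities\<close>

text \<open>Evaluation at a point is 1-Lipschitz for the uniform distance.\<close>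

lemma cfunspace_evaluation_continuous:
  assumes t: "t \<in> topspace Z"
  shows "continuous_map (mtopology_of (cfunspace Z m)) (mtopology_of m) (\<lambda>g. g t)"
proof (rule Lipschitz_continuous_imp_continuous_map)
  have ne: "topspace Z \<noteq> {}" using t by blast
  have "mdist m (g t) (h t) \<le> 1 * mdist (cfunspace Z m) g h"
    if "g \<in> mspace (cfunspace Z m)" "h \<in> mspace (cfunspace Z m)" for g h
    using cfunspace_mdist_le[OF that ne, of "mdist (cfunspace Z m) g h"] t by simp
  moreover have "(\<lambda>g. g t) \<in> mspace (cfunspace Z m) \<rightarrow> mspace m" using t by auto
  ultimately show "Lipschitz_continuous_map (cfunspace Z m) m (\<lambda>g. g t)"
    unfolding Lipschitz_continuous_map_def by blast
qed

lemma path_space_evaluation_measurable: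
  assumes P: "P \<in> prob_measures_on (path_space m) G" and t: "t \<in> {0..1}"
  shows "(\<lambda>\<gamma>. \<gamma> t) \<in> measurable P (borel_of (mtopology_of m))"
proof -
  have "continuous_map (path_space m) (mtopology_of m) (\<lambda>\<gamma>. \<gamma> t)"
    unfolding path_space_def by (rule cfunspace_evaluation_continuous) (use t in simp)
  then have "continuous_map (subtopology (path_space m) G) (mtopology_of m) (\<lambda>\<gamma>. \<gamma> t)"
    by (rule continuous_map_from_subtopology)
  from continuous_map_measurable[OF this]
  have "(\<lambda>\<gamma>. \<gamma> t) \<in> measurable (borel_of (subtopology (path_space m) G)) (borel_of (mtopology_of m))" .
  moreover have "sets P = sets (borel_of (subtopology (path_space m) G))"
    using P by (simp add: prob_measures_on_def)
  ultimately show ?thesis by (simp cong: measurable_cong_sets)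
qed

definition countably_dense :: "'a::metric_space set \<Rightarrow> bool" where
  "countably_dense C \<longleftrightarrow> countable C \<and> (\<forall>x e. 0 < e \<longrightarrow> (\<exists>c\<in>C. dist x c < e))"

lemma countably_dense_real: "countably_dense (\<rat> :: real set)"
  unfolding countably_dense_def
proof (intro conjI allI impI)
  fix x e :: real assume "0 < e"
  then obtain r where "r \<in> \<rat>" "x < r" "r < x + e" using Rats_dense_in_real[of x "x + e"] by auto
  then show "\<exists>c\<in>\<rat>. dist x c < e" by (intro bexI[of _ r]) (auto simp: dist_real_def)
qed (rule countable_rat)

text \<open>Closed balls of radius n are compact and have finite nets of every mesh 1/(1 + j).
  \<open>undefined\<close> serves as an arbitrary base point.\<close>

lemma proper_space_countably_dense:
  assumes "proper_space TYPE('a::metric_space)"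
  obtains C :: "'a::metric_space set" where "countably_dense C"
proof -
  have cpt: "compact (cball x r)" for x :: 'a and r using assms by (auto simp: proper_space_def)
  have ex: "\<exists>k. finite k \<and> cball undefined r \<subseteq> (\<Union>c\<in>k. ball (c::'a) e)" if e: "e > 0" for r e
  proof -
    obtain k where "k \<subseteq> cball (undefined::'a) r" "finite k" "cball undefined r \<subseteq> (\<Union>c\<in>k. ball c e)"
    proof (rule compactE_image[OF cpt])
      show "cball (undefined::'a) r \<subseteq> (\<Union>c\<in>cball undefined r. ball c e)" using e by auto
    qed auto
    then show ?thesis by blast
  qed
  define k where "k r e = (SOME k. finite k \<and> cball undefined r \<subseteq> (\<Union>c\<in>k. ball (c::'a) e))" for r e
  have k: "finite (k r e)" "cball undefined r \<subseteq> (\<Union>c\<in>k r e. ball c e)" if "e > 0" for r e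
    using someI_ex[OF ex[OF that, of r]] unfolding k_def by auto
  define C where "C = (\<Union>n::nat. \<Union>j::nat. k (real n) (1 / (1 + real j)))"
  have "countably_dense C" unfolding countably_dense_def
  proof (intro conjI allI impI)
    have "countable (k (real n) (1 / (1 + real j)))" for n j :: nat
      by (rule countable_finite[OF k(1)]) simp
    then show "countable C" unfolding C_def by (intro countable_UN) auto
    fix x :: 'a and e :: real assume e: "0 < e"
    obtain j where j: "1 / (1 + real j) < e" using e nat_approx_posE[of e] by (auto simp: add.commute)
    obtain n where n: "dist undefined x \<le> real n" using real_arch_simple by blast
    have "x \<in> (\<Union>c\<in>k (real n) (1 / (1 + real j)). ball c (1 / (1 + real j)))"
      using k(2)[of "1 / (1 + real j)" "real n"] n by (auto simp: subset_iff)
    then obtain c where "c \<in> k (real n) (1 / (1 + real j))" "dist c x < 1 / (1 + real j)" by auto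
    then show "\<exists>c\<in>C. dist x c < e" using j by (intro bexI[of _ c]) (auto simp: C_def dist_commute)
  qed
  then show thesis by (rule that)
qed

text \<open>Separability makes every open set of the product a countable union of rectangles of
  balls; without it the product \<sigma>-algebra can be too small to contain all open sets.\<close>

lemma sets_borel_pair_countably_dense:
  fixes A :: "'a::metric_space set" and C :: "'b::metric_space set"
  assumes "countably_dense A" "countably_dense C"
  shows "sets (borel \<Otimes>\<^sub>M borel :: ('a \<times> 'b) measure) = sets borel"
proof
  have "(\<lambda>p. (fst p, snd p)) \<in> measurable borel (borel \<Otimes>\<^sub>M borel :: ('a \<times> 'b) measure)"
    by (intro measurable_Pair borel_measurable_continuous_onI continuous_intros)
  then have id: "(\<lambda>p. p) \<in> measurable borel (borel \<Otimes>\<^sub>M borel :: ('a \<times> 'b) measure)" by simp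
  show "sets (borel \<Otimes>\<^sub>M borel :: ('a \<times> 'b) measure) \<subseteq> sets borel"
  proof
    fix E assume "E \<in> sets (borel \<Otimes>\<^sub>M borel :: ('a \<times> 'b) measure)"
    from measurable_sets[OF id this] show "E \<in> sets borel" by simp
  qed
  have op: "U \<in> sets (borel \<Otimes>\<^sub>M borel :: ('a \<times> 'b) measure)" if U: "open U" for U :: "('a \<times> 'b) set"
  proof -
    define J where "J = {(a, c, j :: nat). a \<in> A \<and> c \<in> C \<and> ball a (1 / (1 + real j)) \<times> ball c (1 / (1 + real j)) \<subseteq> U}"
    have "countable (A \<times> C \<times> (UNIV :: nat set))"
      using assms by (intro countable_SIGMA) (auto simp: countably_dense_def)
    then have J: "countable J" by (rule countable_subset[rotated]) (auto simp: J_def)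
    have "U = (\<Union>(a, c, j)\<in>J. ball a (1 / (1 + real j)) \<times> ball c (1 / (1 + real j)))"
    proof (intro equalityI subsetI)
      fix p assume p: "p \<in> U"
      obtain x y where xy: "p = (x, y)" by fastforce
      obtain e where e: "e > 0" "ball p e \<subseteq> U" using U p open_contains_ball by blast
      \<comment> \<open>Each coordinate moves by at most two radii, so below e/2, and the two
        coordinates together by less than e.\<close>
      obtain j where j: "1 / (1 + real j) < e / 4" using nat_approx_posE[of "e/4"] e by (auto simp: add.commute)
      have jp: "1 / (1 + real j) > 0" by simp
      obtain a where a: "a \<in> A" "dist x a < 1 / (1 + real j)" using assms(1) jp unfolding countably_dense_def by metis
      obtain c where c: "c \<in> C" "dist y c < 1 / (1 + real j)" using assms(2) jp unfolding countably_dense_def by metis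
      have "ball a (1 / (1 + real j)) \<times> ball c (1 / (1 + real j)) \<subseteq> ball p e"
      proof
        fix q assume "q \<in> ball a (1 / (1 + real j)) \<times> ball c (1 / (1 + real j))"
        then obtain u v where q: "q = (u, v)" "dist a u < 1 / (1 + real j)" "dist c v < 1 / (1 + real j)" by auto
        have "dist x u < e / 2" "dist y v < e / 2"
          using dist_triangle[of x u a] dist_triangle[of y v c] a c q j by linarith+
        moreover have "dist p q \<le> \<bar>dist x u\<bar> + \<bar>dist y v\<bar>"
          unfolding xy q dist_Pair_Pair by (rule sqrt_sum_squares_le_sum_abs)
        ultimately show "q \<in> ball p e" by simp
      qed
      then have "(a, c, j) \<in> J" using a c e by (auto simp: J_def)
      moreover have "p \<in> ball a (1 / (1 + real j)) \<times> ball c (1 / (1 + real j))"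
        using a c by (auto simp: xy dist_commute)
      ultimately show "p \<in> (\<Union>(a, c, j)\<in>J. ball a (1 / (1 + real j)) \<times> ball c (1 / (1 + real j)))" by blast
    qed (auto simp: J_def)
    also have "\<dots> \<in> sets (borel \<Otimes>\<^sub>M borel)"
      by (rule sets.countable_UN'[OF J]) auto
    finally show ?thesis .
  qed
  show "sets borel \<subseteq> sets (borel \<Otimes>\<^sub>M borel :: ('a \<times> 'b) measure)"
  proof -
    have "sets (borel :: ('a \<times> 'b) measure) = sigma_sets UNIV {S. open S}"
      unfolding borel_def by (rule sets_measure_of) simp
    then show ?thesis
      using sets.sigma_sets_subset[of "{S. open S}" "borel \<Otimes>\<^sub>M borel :: ('a \<times> 'b) measure"] op
      by (auto simp: space_pair_measure)
  qed
qed

text \<open>Concavity of the power, from the weighted arithmetic-geometric mean inequality for u =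
  r/c and 1. It serves twice: for the transport cost and for the entropy in Jensen's
  inequality.\<close>

lemma powr_tangent_bound:
  fixes p r c :: real
  assumes "0 < p" "p < 1" "0 < c" "0 \<le> r"
  shows "r powr p \<le> c powr p + p * c powr (p - 1) * (r - c)"
proof (cases "r = 0")
  case True
  have "c powr p = c powr (p - 1) * c" using assms by (simp add: powr_diff)
  then have "c powr p + p * c powr (p - 1) * (0 - c) = (1 - p) * c powr p" by (simp add: algebra_simps)
  then show ?thesis using True assms by simp
next
  case False
  then have r: "r > 0" using assms by simp
  define u where "u = r / c"
  have u: "u > 0" "r = u * c" using r assms by (auto simp: u_def)
  have "u powr p * 1 powr (1 - p) \<le> p * u + (1 - p) * 1"
    by (rule Youngs_inequality_0) (use assms u in auto)
  then have "u powr p * c powr p \<le> (p * u + (1 - p)) * c powr p" by (intro mult_right_mono) auto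
  moreover have "r powr p = u powr p * c powr p" using u assms by (simp add: powr_mult)
  moreover have "c powr p = c powr (p - 1) * c" using assms by (simp add: powr_diff)
  ultimately show ?thesis unfolding u(2) by (simp add: algebra_simps)
qed

text \<open>F need not be measurable, which allows F to be a power of the time separation. Some
  measurable u <= F has the same integral as F, and then h - u is nonnegative with integral
  0.\<close>

lemma nn_integral_eq_imp_AE_le:
  fixes F h :: "'b \<Rightarrow> ennreal"
  assumes h[measurable]: "h \<in> borel_measurable M" and le: "AE x in M. F x \<le> h x"
    and int: "(\<integral>\<^sup>+x. h x \<partial>M) \<le> (\<integral>\<^sup>+x. F x \<partial>M)" and fin: "(\<integral>\<^sup>+x. h x \<partial>M) < \<infinity>"
  shows "AE x in M. h x \<le> F x"
proof -
  \<comment> \<open>The integral is by definition a supremum over simple functions below F;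
    countably many of them attain it, and u is their pointwise supremum.\<close>
  have "\<exists>u. u \<in> borel_measurable M \<and> (\<forall>x. u x \<le> F x) \<and> (\<integral>\<^sup>+x. F x \<partial>M) \<le> (\<integral>\<^sup>+x. u x \<partial>M)"
  proof -
    let ?G = "{g. simple_function M g \<and> g \<le> F}"
    have ne: "integral\<^sup>S M ` ?G \<noteq> {}" by (auto intro!: exI[of _ "\<lambda>_. 0"] simp: le_fun_def)
    obtain s :: "nat \<Rightarrow> ennreal" where s: "range s \<subseteq> integral\<^sup>S M ` ?G" "(SUP i. s i) = (SUP g\<in>?G. integral\<^sup>S M g)"
      using ennreal_Sup_countable_SUP[OF ne] by auto
    then have "\<forall>i. \<exists>g. g \<in> ?G \<and> s i = integral\<^sup>S M g" by (auto simp: image_subset_iff)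
    then obtain g where g: "\<And>i. g i \<in> ?G" "\<And>i. s i = integral\<^sup>S M (g i)" by metis
    have [measurable]: "g i \<in> borel_measurable M" for i using g(1)[of i] by (auto intro: borel_measurable_simple_function)
    show ?thesis
    proof (intro exI[of _ "\<lambda>x. SUP i. g i x"] conjI allI)
      show "(\<lambda>x. SUP i. g i x) \<in> borel_measurable M" by measurable
      show "(SUP i. g i x) \<le> F x" for x using g(1) by (auto intro!: SUP_least simp: le_fun_def)
      have "(\<integral>\<^sup>+x. F x \<partial>M) = (SUP i. s i)" unfolding s(2) nn_integral_def ..
      also have "\<dots> \<le> (\<integral>\<^sup>+x. (SUP i. g i x) \<partial>M)"
      proof (rule SUP_least)
        fix i
        have "s i = (\<integral>\<^sup>+x. g i x \<partial>M)" using g[of i] by (simp add: nn_integral_eq_simple_integral)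
        also have "\<dots> \<le> (\<integral>\<^sup>+x. (SUP i. g i x) \<partial>M)" by (intro nn_integral_mono SUP_upper) simp
        finally show "s i \<le> (\<integral>\<^sup>+x. (SUP i. g i x) \<partial>M)" .
      qed
      finally show "(\<integral>\<^sup>+x. F x \<partial>M) \<le> (\<integral>\<^sup>+x. (SUP i. g i x) \<partial>M)" .
    qed
  qed
  then obtain u where u[measurable]: "u \<in> borel_measurable M" and uF: "\<And>x. u x \<le> F x"
    and ui: "(\<integral>\<^sup>+x. F x \<partial>M) \<le> (\<integral>\<^sup>+x. u x \<partial>M)" by blast
  have uh: "AE x in M. u x \<le> h x" using le by eventually_elim (use uF order_trans in blast)
  have ufin: "(\<integral>\<^sup>+x. u x \<partial>M) \<noteq> \<infinity>" using nn_integral_mono_AE[OF uh] fin by (auto simp: top_unique)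
  have "(\<integral>\<^sup>+x. h x - u x \<partial>M) = (\<integral>\<^sup>+x. h x \<partial>M) - (\<integral>\<^sup>+x. u x \<partial>M)"
    by (rule nn_integral_diff) (use uh ufin in auto)
  also have "\<dots> = 0" using order_trans[OF int ui] fin by (simp add: diff_eq_0_iff_ennreal less_top)
  finally have "AE x in M. h x - u x = 0" by (subst (asm) nn_integral_0_iff_AE) auto
  moreover have "AE x in M. h x \<noteq> \<infinity>" by (rule nn_integral_noteq_infinite) (use fin in auto)
  ultimately show ?thesis
  proof eventually_elim
    case (elim x)
    then have "h x \<le> u x" by (simp add: diff_eq_0_iff_ennreal)
    then show ?case using uF order_trans by blast
  qed
qed

section \<open>Optimal transport between slabs\<close>

text \<open>\<open>sqrt\<close> is an odd function on the reals, so the sign comes from the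
  causality condition.\<close>

lemma lorentz_length_nonneg:
  assumes "fd_causal_curve I f a b \<alpha> \<beta>"
  shows "0 \<le> lorentz_length f a b \<alpha> \<beta>"
proof -
  have "AE t\<in>{a..b} in lborel. - (deriv \<alpha> t)\<^sup>2 + (f (\<alpha> t))\<^sup>2 * (metric_speed \<beta> t)\<^sup>2 \<le> 0"
    using assms by (simp add: fd_causal_curve_def)
  then have "AE t in lborel. 0 \<le> indicator {a..b} t *\<^sub>R sqrt ((deriv \<alpha> t)\<^sup>2 - (f (\<alpha> t))\<^sup>2 * (metric_speed \<beta> t)\<^sup>2)"
    by eventually_elim (auto simp: indicator_def)
  then show ?thesis unfolding lorentz_length_def set_lebesgue_integral_def
    by (intro integral_nonneg_AE AE_completion)
qed

lemma cone_tsep_nonneg: "0 \<le> cone_tsep UNIV f {q} {q'}"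
proof (cases "proper_times f q q' = {}")
  case False
  obtain s x t y where q: "q = (s, x)" "q' = (t, y)" by fastforce
  obtain l where l: "l \<in> proper_times f q q'" using False by blast
  have "0 \<le> l" using l lorentz_length_nonneg unfolding proper_times_def by blast
  also have "l \<le> Sup (proper_times f q q')"
    by (rule cSup_upper[OF l]) (auto simp: q intro!: bdd_aboveI[of _ "t - s"] proper_times_bounds(2))
  finally show ?thesis using False by (simp add: cone_tsep_eq)
qed (simp add: cone_tsep_eq)

locale warped_measure = warped_line f X
  for f and X :: "'a::metric_space itself" +
  fixes N :: real and M :: "'a measure"
  assumes N: "1 < N" and proper: "proper_space TYPE('a)" and radon: "radon_measure M"
begin

definition S :: "(real \<times> 'a) set lorentz_space" where "S = lorentz_cone UNIV f N M"

abbreviation B :: "(real \<times> 'a) set measure" where "B \<equiv> borel_of T"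

abbreviation L :: "(real \<times> 'a) measure" where "L \<equiv> lborel \<Otimes>\<^sub>M M"

definition tm :: "(real \<times> 'a) set \<Rightarrow> real" where "tm y = fst (the_elem y)"

lemma S_simps [simp]:
  "metr S = cone_metric UNIV f" "chron S = cone_chron UNIV f" "caus S = cone_caus UNIV f"
  "tsep S = cone_tsep UNIV f" "vol S = cone_vol UNIV f N M" "top_of S = T"
  by (simp_all add: S_def lorentz_cone_def top_of_def T_def)

lemma sets_M [measurable_cong]: "sets M = sets borel"
  using radon by (simp add: radon_measure_def)

lemma space_M [simp]: "space M = UNIV"
  using sets_eq_imp_space_eq[OF sets_M] by simp

lemma emeasure_compact: "compact K \<Longrightarrow> emeasure M K < \<infinity>"
  using radon by (simp add: radon_measure_def)

lemma UN_cball: "(\<Union>n. cball x (real n)) = UNIV"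
  using real_arch_simple by auto

lemma compact_cball: "compact (cball (x::'a) r)"
  using proper by (simp add: proper_space_def)

lemma sigma_finite_M: "sigma_finite_measure M"
proof
  show "\<exists>A. countable A \<and> A \<subseteq> sets M \<and> \<Union>A = space M \<and> (\<forall>a\<in>A. emeasure M a \<noteq> \<infinity>)"
  proof (intro exI[of _ "range (\<lambda>n. cball undefined (real n))"] conjI ballI)
    show "range (\<lambda>n. cball undefined (real n)) \<subseteq> sets M" by (auto simp: sets_M)
    fix a assume "a \<in> range (\<lambda>n. cball (undefined::'a) (real n))"
    then show "emeasure M a \<noteq> \<infinity>" using emeasure_compact[OF compact_cball] by (auto simp: less_top)
  qed (use UN_cball in auto)
qed

sublocale M: sigma_finite_measure M by (rule sigma_finite_M)

lemma ex_compact_nonnull: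
  assumes "emeasure M UNIV \<noteq> 0"
  shows "\<exists>K. compact K \<and> emeasure M K \<noteq> 0"
proof (rule ccontr)
  assume "\<not> ?thesis"
  then have "cball undefined (real n) \<in> null_sets M" for n
    using compact_cball by (auto simp: null_sets_def sets_M)
  then have "(\<Union>n. cball undefined (real n)) \<in> null_sets M" by (intro null_sets_UN)
  then show False using assms unfolding UN_cball by (simp add: null_sets_def)
qed

text \<open>\<open>pt\<close> and its inverse are known to be Borel, while the volume is built on a
  product measure; this equality lets the two be combined.\<close>

lemma sets_L: "sets L = sets (borel :: (real \<times> 'a) measure)"
proof -
  obtain C :: "'a set" where C: "countably_dense C" by (rule proper_space_countably_dense[OF proper])
  have "sets L = sets (borel \<Otimes>\<^sub>M borel :: (real \<times> 'a) measure)"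
    by (rule sets_pair_measure_cong) (simp_all add: sets_M)
  then show ?thesis using sets_borel_pair_countably_dense[OF countably_dense_real C] by simp
qed

lemma measurable_pt_L [measurable]: "pt \<in> measurable L B"
  using measurable_pt measurable_cong_sets[OF sets_L refl] by blast

lemma measurable_the_elem_L [measurable]: "the_elem \<in> measurable B L"
  using measurable_the_elem measurable_cong_sets[OF refl sets_L] by blast

lemma measurable_fst_L [measurable]: "fst \<in> borel_measurable L"
  by measurable

lemma measurable_tm [measurable]: "tm \<in> borel_measurable B"
  unfolding tm_def by (rule measurable_compose[OF measurable_the_elem_L measurable_fst_L])

lemma measurable_f [measurable]: "f \<in> borel_measurable borel"
  by (rule borel_measurable_continuous_onI[OF cont])

lemma cone_vol_eq: "cone_vol UNIV f N M = distr (density L (\<lambda>q. ennreal (f (fst q) powr N))) B pt"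
proof -
  have r: "restrict_space lborel UNIV = (lborel :: real measure)"
    by (rule measure_eqI) (auto simp: sets_restrict_space emeasure_restrict_space)
  \<comment> \<open>Writing M as a density with weight 1 makes the product rule for densities
    applicable.\<close>
  have "density lborel (\<lambda>t. ennreal (f t powr N)) \<Otimes>\<^sub>M density M (\<lambda>_. 1) =
    density L (\<lambda>(t, x). ennreal (f t powr N) * 1)"
  proof (rule pair_measure_density)
    show "sigma_finite_measure (density M (\<lambda>_. 1))" by (simp add: density_1 sigma_finite_M)
  qed (use sigma_finite_M in measurable)
  then have "density lborel (\<lambda>t. ennreal (f t powr N)) \<Otimes>\<^sub>M M = density L (\<lambda>q. ennreal (f (fst q) powr N))"
    by (simp add: density_1 split_beta')
  then show ?thesis
    unfolding cone_vol_def r T_def[symmetric] by (simp add: cone_pt_eq[abs_def])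
qed

lemma sets_vol: "sets (cone_vol UNIV f N M) = sets B"
  by (simp add: cone_vol_eq)

end

section \<open>Uniform measures on slabs\<close>

locale slab = warped_measure f X N M
  for f and X :: "'a::metric_space itself" and N M +
  fixes K :: "'a set" and d :: real
  assumes K: "compact K" "emeasure M K \<noteq> 0" and d: "0 < d"
begin

definition mK :: real where "mK = measure M K"

lemma K_sets [measurable]: "K \<in> sets M"
  using K by (simp add: sets_M compact_imp_closed)

lemma emeasure_K: "emeasure M K = ennreal mK"
  unfolding mK_def using emeasure_compact[OF K(1)] by (intro emeasure_eq_ennreal_measure) (auto simp: less_top)

lemma mK_pos: "0 < mK"
proof -
  have "ennreal mK \<noteq> 0" using emeasure_K K(2) by simp
  moreover have "0 \<le> mK" by (simp add: mK_def)
  ultimately show ?thesis by (cases "mK = 0") auto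
qed

definition A0 :: "real \<Rightarrow> (real \<times> 'a) set" where "A0 a = {a..a+d} \<times> K"

definition A :: "real \<Rightarrow> (real \<times> 'a) set set" where "A a = pt ` A0 a"

text \<open>Normalized for dt times m; weighting with f^N here would destroy the invariance under
  time translation.\<close>

definition dens :: "real \<Rightarrow> real \<times> 'a \<Rightarrow> real" where
  "dens a q = indicator (A0 a) q / (d * mK)"

definition Q :: "real \<Rightarrow> (real \<times> 'a) measure" where
  "Q a = density L (\<lambda>q. ennreal (dens a q))"

text \<open>Dividing by f^N gives the density of the same measure with respect to the cone
  volume.\<close>

definition rho :: "real \<Rightarrow> (real \<times> 'a) set \<Rightarrow> real" where
  "rho a y = dens a (the_elem y) / f (tm y) powr N"

definition mu :: "real \<Rightarrow> (real \<times> 'a) set measure" where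
  "mu a = density (cone_vol UNIV f N M) (\<lambda>y. ennreal (rho a y))"

definition sh :: "real \<Rightarrow> real \<times> 'a \<Rightarrow> real \<times> 'a" where "sh \<Delta> q = (fst q + \<Delta>, snd q)"

lemma measurable_pt_Q [measurable]: "pt \<in> measurable (Q a) B"
  using measurable_pt_L by (simp add: Q_def)

lemma A0_sets [measurable]: "A0 a \<in> sets L"
  unfolding A0_def by measurable

lemma A_sets [measurable]: "A a \<in> sets B"
proof -
  have "A a = the_elem -` A0 a \<inter> space B" by (auto simp: A_def topspace_T)
  then show ?thesis using measurable_sets[OF measurable_the_elem_L A0_sets] by simp
qed

lemma measurable_dens [measurable]: "dens a \<in> borel_measurable L"
  unfolding dens_def by measurable

lemma measurable_sh [measurable]: "sh \<Delta> \<in> measurable L L"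
  unfolding sh_def by measurable

lemma sets_Q [simp, measurable_cong]: "sets (Q a) = sets L"
  by (simp add: Q_def)

lemma measurable_rho [measurable]: "rho a \<in> borel_measurable B"
  unfolding rho_def by measurable

lemma dens_nonneg: "0 \<le> dens a q"
  using d mK_pos by (simp add: dens_def)

lemma prob_Q: "prob_space (Q a)"
proof
  have "emeasure (Q a) (space (Q a)) = (\<integral>\<^sup>+q. ennreal (dens a q) \<partial>L)"
    unfolding Q_def space_density
    by (subst emeasure_density[OF _ sets.top]) (auto intro!: nn_integral_cong)
  also have "\<dots> = (\<integral>\<^sup>+q. ennreal (1 / (d * mK)) * indicator (A0 a) q \<partial>L)"
    by (intro nn_integral_cong) (auto simp: dens_def indicator_def)
  also have "\<dots> = ennreal (1 / (d * mK)) * emeasure L (A0 a)" by (rule nn_integral_cmult_indicator) measurable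
  also have "emeasure L (A0 a) = ennreal d * ennreal mK"
    unfolding A0_def using d by (simp add: M.emeasure_pair_measure_Times emeasure_K)
  also have "ennreal (1 / (d * mK)) * (ennreal d * ennreal mK) = 1"
    using d mK_pos by (simp add: ennreal_mult[symmetric] ennreal_1[symmetric] del: ennreal_1)
  finally show "emeasure (Q a) (space (Q a)) = 1" .
qed

lemma Q_A0: "AE q in Q a. q \<in> A0 a"
  unfolding Q_def by (subst AE_density) (auto simp: dens_def indicator_def)

lemma Q_shift: "Q (a + \<Delta>) = distr (Q a) L (sh \<Delta>)"
proof -
  have "L = distr L L (sh \<Delta>)"
  proof -
    have "distr lborel borel ((+) \<Delta>) \<Otimes>\<^sub>M distr M M (\<lambda>x. x) =
        distr L (borel \<Otimes>\<^sub>M M) (\<lambda>(t, x). (\<Delta> + t, x))"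
      by (rule pair_measure_distr) (auto simp: sigma_finite_M)
    moreover have "distr L (borel \<Otimes>\<^sub>M M) (\<lambda>(t, x). (\<Delta> + t, x)) = distr L L (sh \<Delta>)"
      by (rule distr_cong) (auto simp: sh_def add.commute intro: sets_pair_measure_cong)
    ultimately show ?thesis by (simp add: lborel_distr_plus)
  qed
  then have "Q (a + \<Delta>) = density (distr L L (sh \<Delta>)) (\<lambda>q. ennreal (dens (a + \<Delta>) q))"
    by (simp add: Q_def)
  also have "\<dots> = distr (density L (\<lambda>q. ennreal (dens (a + \<Delta>) (sh \<Delta> q)))) L (sh \<Delta>)"
    by (rule density_distr) measurable
  also have "(\<lambda>q. dens (a + \<Delta>) (sh \<Delta> q)) = dens a"
    by (auto simp: dens_def sh_def A0_def indicator_def fun_eq_iff)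
  finally show ?thesis by (simp add: Q_def)
qed

lemma mu_eq: "mu a = distr (Q a) B pt"
proof -
  have "mu a = distr (density (density L (\<lambda>q. ennreal (f (fst q) powr N))) (\<lambda>q. ennreal (rho a (pt q)))) B pt"
    unfolding mu_def cone_vol_eq by (rule density_distr) measurable
  also have "density (density L (\<lambda>q. ennreal (f (fst q) powr N))) (\<lambda>q. ennreal (rho a (pt q))) =
      density L (\<lambda>q. ennreal (f (fst q) powr N) * ennreal (rho a (pt q)))"
    by (rule density_density_eq) measurable
  also have "(\<lambda>q. ennreal (f (fst q) powr N) * ennreal (rho a (pt q))) = (\<lambda>q. ennreal (dens a q))"
  proof
    fix q :: "real \<times> 'a"
    have "0 < f (fst q) powr N" using pos[of "fst q"] by simp
    then show "ennreal (f (fst q) powr N) * ennreal (rho a (pt q)) = ennreal (dens a q)"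
      using dens_nonneg[of a q] by (simp add: rho_def tm_def ennreal_mult[symmetric])
  qed
  finally show ?thesis by (simp add: Q_def)
qed

lemma sets_mu [simp, measurable_cong]: "sets (mu a) = sets B"
  by (simp add: mu_eq)

lemma prob_mu: "prob_space (mu a)"
  unfolding mu_eq by (rule prob_space.prob_space_distr[OF prob_Q]) measurable

lemma mu_A: "AE y in mu a. y \<in> A a"
proof -
  have "(AE y in distr (Q a) B pt. y \<in> A a) \<longleftrightarrow> (AE q in Q a. pt q \<in> A a)"
  proof (rule AE_distr_iff)
    have "{y \<in> space B. y \<in> A a} = A a" using sets.sets_into_space[OF A_sets] by auto
    then show "{y \<in> space B. y \<in> A a} \<in> sets B" by simp
  qed measurable
  then show ?thesis unfolding mu_eq using Q_A0[of a] by (auto simp: A_def elim: eventually_mono)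
qed

lemma compactin_A: "compactin T (A a)"
proof -
  have "continuous_map euclidean T pt"
    unfolding continuous_map_def by (auto simp: topspace_T openin_T)
  moreover have "compactin euclidean (A0 a)"
    unfolding A0_def using K by (simp add: compact_Times)
  ultimately show ?thesis unfolding A_def by (rule image_compactin[rotated])
qed

lemma compactly_supported_mu: "compactly_supported_density S (mu a) (rho a)"
  unfolding compactly_supported_density_def
proof (intro conjI allI)
  show "rho a \<in> borel_measurable (vol S)" using measurable_rho by (simp add: measurable_cong_sets[OF sets_vol refl])
  show "0 \<le> rho a y" for y using dens_nonneg by (simp add: rho_def)
  show "mu a = density (vol S) (\<lambda>y. ennreal (rho a y))" by (simp add: mu_def)
  show "\<exists>C. compactin (top_of S) C \<and> (AE y in mu a. y \<in> C)" using compactin_A mu_A by auto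
qed (rule prob_mu)

text \<open>Mean times of the marginals are all that enters the integral of \<open>tangent\<close>,
  as it is affine in the two times.\<close>

lemma tm_mu: "integrable (mu a) tm" "(\<integral>y. tm y \<partial>mu (a + \<Delta>)) = (\<integral>y. tm y \<partial>mu a) + \<Delta>"
proof -
  interpret Q: prob_space "Q a" by (rule prob_Q)
  have tp: "tm (pt q) = fst q" for q by (simp add: tm_def)
  have i: "integrable (Q a) fst"
  proof (rule Q.integrable_const_bound)
    show "AE q in Q a. norm (fst q) \<le> \<bar>a\<bar> + d"
      using Q_A0[of a] by eventually_elim (auto simp: A0_def)
  qed measurable
  show "integrable (mu a) tm" unfolding mu_eq by (subst integrable_distr_eq) (use i in \<open>auto simp: tp\<close>)
  have "(\<integral>y. tm y \<partial>mu (a + \<Delta>)) = (\<integral>q. fst q \<partial>Q (a + \<Delta>))"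
    unfolding mu_eq by (subst integral_distr) (auto simp: tp)
  also have "\<dots> = (\<integral>q. fst q + \<Delta> \<partial>Q a)"
    unfolding Q_shift by (subst integral_distr) (auto simp: sh_def)
  also have "\<dots> = (\<integral>q. fst q \<partial>Q a) + \<Delta>" using i by (simp add: Q.prob_space)
  also have "(\<integral>q. fst q \<partial>Q a) = (\<integral>y. tm y \<partial>mu a)"
    unfolding mu_eq by (subst integral_distr) (auto simp: tp)
  finally show "(\<integral>y. tm y \<partial>mu (a + \<Delta>)) = (\<integral>y. tm y \<partial>mu a) + \<Delta>" .
qed

text \<open>The tangent of \<open>r\<^sup>p\<close> at \<open>\<Delta>\<close> bounds the cost from above and is an affine function of the
  marginals, so it has the same integral for all couplings.\<close>

definition tangent :: "real \<Rightarrow> real \<Rightarrow> (real \<times> 'a) set \<times> (real \<times> 'a) set \<Rightarrow> real" where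
  "tangent p \<Delta> z = \<Delta> powr p + p * \<Delta> powr (p - 1) * (tm (snd z) - tm (fst z) - \<Delta>)"

section \<open>Cost of an arbitrary causal coupling\<close>

context
  fixes p a \<Delta> :: real and \<pi> :: "((real \<times> 'a) set \<times> (real \<times> 'a) set) measure"
  assumes p: "0 < p" "p < 1" and \<Delta>: "0 < \<Delta>" and cc: "causal_coupling S (mu a) (mu (a + \<Delta>)) \<pi>"
begin

lemma coup: "sets \<pi> = sets (mu a \<Otimes>\<^sub>M mu (a + \<Delta>))" "distr \<pi> (mu a) fst = mu a"
    "distr \<pi> (mu (a + \<Delta>)) snd = mu (a + \<Delta>)"
  using cc by (auto simp: causal_coupling_def coupling_def)

lemma sets_coupling [measurable_cong]: "sets \<pi> = sets (B \<Otimes>\<^sub>M B)"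
  unfolding coup(1) by (rule sets_pair_measure_cong) auto

lemma space_coupling: "space \<pi> = range pt \<times> range pt"
  using sets_eq_imp_space_eq[OF sets_coupling] by (simp add: space_pair_measure topspace_T)

lemma meas_coupling [measurable]: "fst \<in> measurable \<pi> (mu a)" "snd \<in> measurable \<pi> (mu (a + \<Delta>))"
  using measurable_cong_sets[OF coup(1) refl] by auto

lemma prob_coupling: "prob_space \<pi>"
  using prob_space_distrD[OF meas_coupling(1)] prob_mu[of a] coup(2) by simp

lemma tangent_integral: "integrable \<pi> (tangent p \<Delta>)" "(\<integral>z. tangent p \<Delta> z \<partial>\<pi>) = \<Delta> powr p"
proof -
  interpret P: prob_space \<pi> by (rule prob_coupling)
  have 1: "integrable \<pi> (\<lambda>z. tm (fst z))" "(\<integral>z. tm (fst z) \<partial>\<pi>) = (\<integral>y. tm y \<partial>mu a)"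
    using integrable_distr_eq[OF meas_coupling(1), of tm] integral_distr[OF meas_coupling(1), of tm] tm_mu(1)[of a]
    by (simp_all add: coup(2))
  have 2: "integrable \<pi> (\<lambda>z. tm (snd z))" "(\<integral>z. tm (snd z) \<partial>\<pi>) = (\<integral>y. tm y \<partial>mu (a + \<Delta>))"
    using integrable_distr_eq[OF meas_coupling(2), of tm] integral_distr[OF meas_coupling(2), of tm] tm_mu(1)[of "a + \<Delta>"]
    by (simp_all add: coup(3))
  show "integrable \<pi> (tangent p \<Delta>)" unfolding tangent_def using 1(1) 2(1) by simp
  show "(\<integral>z. tangent p \<Delta> z \<partial>\<pi>) = \<Delta> powr p"
    unfolding tangent_def using 1 2 tm_mu(2)[of a \<Delta>] by (simp add: P.prob_space)
qed

lemma AE_in_A: "AE z in \<pi>. fst z \<in> A a \<and> snd z \<in> A (a + \<Delta>)"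
proof -
  have "AE z in \<pi>. fst z \<in> A a"
    by (rule AE_distrD[OF meas_coupling(1)]) (unfold coup(2), rule mu_A)
  moreover have "AE z in \<pi>. snd z \<in> A (a + \<Delta>)"
    by (rule AE_distrD[OF meas_coupling(2)]) (unfold coup(3), rule mu_A)
  ultimately show ?thesis by eventually_elim auto
qed

text \<open>Two separate losses: the time separation falls short of the time difference for
  non-vertical motion, and the power of the time difference falls short of its tangent when the
  difference is not \<Delta>.\<close>

lemma AE_tsep_le: "AE z in \<pi>. tm (fst z) \<le> tm (snd z) \<and> 0 \<le> tsep S (fst z) (snd z) \<and>
    tsep S (fst z) (snd z) \<le> tm (snd z) - tm (fst z) \<and>
    (tm (snd z) - tm (fst z)) powr p \<le> tangent p \<Delta> z"
proof -
  have "AE z in \<pi>. caus S (fst z) (snd z)" using cc by (simp add: causal_coupling_def split_beta')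
  then show ?thesis using AE_space
  proof eventually_elim
    case (elim z)
    then obtain s x t y where z: "z = (pt (s, x), pt (t, y))" unfolding space_coupling by auto
    have st: "s \<le> t" using elim(1) cone_caus_imp_le[of f s x t y] by (simp add: z)
    have "0 \<le> cone_tsep UNIV f (pt (s, x)) (pt (t, y))" by (rule cone_tsep_nonneg)
    then show ?case using st cone_tsep_le[OF st, of f x y] powr_tangent_bound[OF p \<Delta>, of "t - s"]
      by (simp add: z tm_def tangent_def)
  qed
qed

lemma nn_integral_tangent: "(\<integral>\<^sup>+z. ennreal (tangent p \<Delta> z) \<partial>\<pi>) = ennreal (\<Delta> powr p)"
proof -
  have "AE z in \<pi>. 0 \<le> tangent p \<Delta> z"
    using AE_tsep_le by eventually_elim (metis order_trans powr_ge_zero)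
  then show ?thesis using nn_integral_eq_integral[OF tangent_integral(1)] tangent_integral(2) by simp
qed

lemma AE_tsep_powr_le:
  "AE z in \<pi>. ennreal (tsep S (fst z) (snd z) powr p) \<le> ennreal (tangent p \<Delta> z)"
  using AE_tsep_le
proof eventually_elim
  case (elim z)
  then have "tsep S (fst z) (snd z) powr p \<le> (tm (snd z) - tm (fst z)) powr p"
    using p by (intro powr_mono2) auto
  then show ?case using elim by (intro ennreal_leI) linarith
qed

lemma coupling_cost_le: "(\<integral>\<^sup>+(x, y). ennreal (tsep S x y powr p) \<partial>\<pi>) \<le> ennreal (\<Delta> powr p)"
  using nn_integral_mono_AE[OF AE_tsep_powr_le] nn_integral_tangent by (simp add: split_beta')

text \<open>If the cost attains the integral of the tangent, every inequality in tsep^p <= (time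
  difference)^p <= tangent is an equality almost everywhere; strict monotonicity of the power
  removes the exponent.\<close>

lemma coupling_cost_eq_imp:
  assumes "ennreal (\<Delta> powr p) \<le> (\<integral>\<^sup>+(x, y). ennreal (tsep S x y powr p) \<partial>\<pi>)"
  shows "AE z in \<pi>. tsep S (fst z) (snd z) = tm (snd z) - tm (fst z)"
proof -
  have "AE z in \<pi>. ennreal (tangent p \<Delta> z) \<le> ennreal (tsep S (fst z) (snd z) powr p)"
  proof (rule nn_integral_eq_imp_AE_le[OF _ AE_tsep_powr_le])
    show "(\<lambda>z. ennreal (tangent p \<Delta> z)) \<in> borel_measurable \<pi>"
      using tangent_integral(1) by measurable
    show "(\<integral>\<^sup>+z. ennreal (tangent p \<Delta> z) \<partial>\<pi>) \<le> (\<integral>\<^sup>+z. ennreal (tsep S (fst z) (snd z) powr p) \<partial>\<pi>)"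
      using assms by (simp add: nn_integral_tangent split_beta')
    show "(\<integral>\<^sup>+z. ennreal (tangent p \<Delta> z) \<partial>\<pi>) < \<infinity>" by (simp add: nn_integral_tangent)
  qed
  then show ?thesis using AE_tsep_le
  proof eventually_elim
    case (elim z)
    let ?\<tau> = "tsep S (fst z) (snd z)" and ?r = "tm (snd z) - tm (fst z)"
    have "tangent p \<Delta> z \<le> ?\<tau> powr p" using elim(1) by (subst (asm) ennreal_le_iff) auto
    then have "?r powr p \<le> ?\<tau> powr p" using elim(2) by linarith
    then have "?r \<le> ?\<tau>" using elim(2) p powr_less_mono2[of p ?\<tau> ?r] by (meson not_le)
    then show ?case using elim(2) by linarith
  qed
qed

end

end

section \<open>Concavity of the warping function\<close>

text \<open>Jensen's inequality through a tangent. Only mass at most 1 of the absolutely continuous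
  part and its concentration on E enter, so a singular part of \<nu> does no harm.\<close>

lemma nn_integral_ac_density_le:
  assumes ac: "ac_density V \<nu> \<rho>" and \<nu>: "prob_space \<nu>" "sets \<nu> = sets V"
    and E: "E \<in> sets V" "AE y in \<nu>. y \<in> E" and v: "emeasure V E \<le> ennreal v" "0 < v"
    and \<theta>: "0 < \<theta>" "\<theta> < 1"
  shows "(\<integral>\<^sup>+y. ennreal (\<rho> y powr \<theta>) \<partial>V) \<le> ennreal (v powr (1 - \<theta>))"
proof -
  interpret \<nu>: prob_space \<nu> by (rule \<nu>(1))
  have sp: "space \<nu> = space V" by (rule sets_eq_imp_space_eq[OF \<nu>(2)])
  have [measurable]: "\<rho> \<in> borel_measurable V" and \<rho>0: "\<And>y. 0 \<le> \<rho> y" using ac by (auto simp: ac_density_def)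
  obtain Z where Z: "Z \<in> null_sets V"
    "\<And>C. C \<in> sets V \<Longrightarrow> emeasure \<nu> (C - Z) = (\<integral>\<^sup>+y\<in>C. ennreal (\<rho> y) \<partial>V)"
    using ac unfolding ac_density_def by blast
  have [measurable]: "E \<in> sets V" "Z \<in> sets V" using E Z by auto
  define C where "C = space V - E"
  have [measurable]: "C \<in> sets V" unfolding C_def by measurable
  \<comment> \<open>The measure does not charge the complement of E, hence \<rho> vanishes there
    almost everywhere and the tangent is used only on E.\<close>
  have "C \<in> null_sets \<nu>"
  proof -
    have "AE y in \<nu>. y \<notin> C" using E(2) by eventually_elim (auto simp: C_def)
    then show ?thesis using \<open>C \<in> sets V\<close> \<nu>(2) by (subst AE_iff_null_sets) auto
  qed
  then have "emeasure \<nu> (C - Z) = 0"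
    using emeasure_mono[of "C - Z" C \<nu>] \<open>C \<in> sets V\<close> \<nu>(2) by (auto simp: null_sets_def)
  then have "(\<integral>\<^sup>+y. ennreal (\<rho> y) * indicator C y \<partial>V) = 0" using Z(2)[of C] by simp
  then have "AE y in V. ennreal (\<rho> y) * indicator C y = 0" by (subst (asm) nn_integral_0_iff_AE) measurable
  then have out: "AE y in V. y \<notin> E \<longrightarrow> \<rho> y = 0" using AE_space
    by eventually_elim (auto simp: C_def indicator_def ennreal_eq_0_iff antisym[OF _ \<rho>0])
  have total: "(\<integral>\<^sup>+y. ennreal (\<rho> y) \<partial>V) \<le> 1"
  proof -
    have "(\<integral>\<^sup>+y. ennreal (\<rho> y) \<partial>V) = (\<integral>\<^sup>+y\<in>space V. ennreal (\<rho> y) \<partial>V)"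
      by (intro nn_integral_cong) simp
    also have "\<dots> = emeasure \<nu> (space V - Z)" using Z(2)[of "space V"] by simp
    also have "\<dots> \<le> 1" by (rule \<nu>.emeasure_le_1)
    finally show ?thesis .
  qed
  \<comment> \<open>The uniform density on a set of volume v. Tangency there gives the bound (1 -
    \<theta>) c^\<theta> v + \<theta> c^(\<theta> - 1) = v^(1 - \<theta>).\<close>
  define c where "c = 1 / v"
  have c: "0 < c" "c * v = 1" using v by (auto simp: c_def)
  have "(\<integral>\<^sup>+y. ennreal (\<rho> y powr \<theta>) \<partial>V) \<le>
      (\<integral>\<^sup>+y. ennreal ((1 - \<theta>) * c powr \<theta>) * indicator E y + ennreal (\<theta> * c powr (\<theta> - 1)) * ennreal (\<rho> y) \<partial>V)"
  proof (rule nn_integral_mono_AE)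
    show "AE y in V. ennreal (\<rho> y powr \<theta>) \<le>
      ennreal ((1 - \<theta>) * c powr \<theta>) * indicator E y + ennreal (\<theta> * c powr (\<theta> - 1)) * ennreal (\<rho> y)"
      using out
    proof eventually_elim
      case (elim y)
      show ?case
      proof (cases "y \<in> E")
        case True
        have "c powr \<theta> = c powr (\<theta> - 1) * c" using c by (simp add: powr_diff)
        then have "\<rho> y powr \<theta> \<le> (1 - \<theta>) * c powr \<theta> + \<theta> * c powr (\<theta> - 1) * \<rho> y"
          using powr_tangent_bound[OF \<theta> c(1) \<rho>0[of y]] by (simp add: algebra_simps)
        then have "ennreal (\<rho> y powr \<theta>) \<le> ennreal ((1 - \<theta>) * c powr \<theta> + \<theta> * c powr (\<theta> - 1) * \<rho> y)"
          by (rule ennreal_leI)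
        also have "\<dots> = ennreal ((1 - \<theta>) * c powr \<theta>) + ennreal (\<theta> * c powr (\<theta> - 1)) * ennreal (\<rho> y)"
          using \<theta> \<rho>0[of y] by (simp add: ennreal_plus ennreal_mult)
        finally show ?thesis using True by simp
      qed (use elim in simp)
    qed
  qed
  also have "\<dots> = ennreal ((1 - \<theta>) * c powr \<theta>) * emeasure V E + ennreal (\<theta> * c powr (\<theta> - 1)) * (\<integral>\<^sup>+y. ennreal (\<rho> y) \<partial>V)"
    by (subst nn_integral_add) (auto simp: nn_integral_cmult_indicator nn_integral_cmult)
  also have "\<dots> \<le> ennreal ((1 - \<theta>) * c powr \<theta>) * ennreal v + ennreal (\<theta> * c powr (\<theta> - 1)) * 1"
    by (intro add_mono mult_left_mono v total) auto
  also have "\<dots> = ennreal ((1 - \<theta>) * c powr \<theta> * v + \<theta> * c powr (\<theta> - 1))"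
    using \<theta> v c by (simp add: ennreal_plus ennreal_mult)
  also have "(1 - \<theta>) * c powr \<theta> * v + \<theta> * c powr (\<theta> - 1) = v powr (1 - \<theta>)"
  proof -
    have 1: "c powr (\<theta> - 1) = v powr (1 - \<theta>)"
      using v by (simp add: c_def powr_divide powr_minus_divide[symmetric])
    have "c powr \<theta> = c powr (\<theta> - 1) * c" using c by (simp add: powr_diff)
    then have "c powr \<theta> * v = c powr (\<theta> - 1)" using c(2) by simp
    then have "(1 - \<theta>) * c powr \<theta> * v = (1 - \<theta>) * c powr (\<theta> - 1)" by (simp add: mult.assoc)
    then show ?thesis unfolding 1 by (simp add: algebra_simps)
  qed
  finally show ?thesis .
qed

text \<open>Along the arithmetic progression starting x, y the increments of g do not increase. If
  the first one were negative, g would drop at least linearly and become negative. The point y may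
  lie on either side of x, so equality follows by symmetry; continuity does not enter.\<close>

lemma midpoint_concave_positive_constant:
  fixes g :: "real \<Rightarrow> real"
  assumes mid: "\<And>a b. a < b \<Longrightarrow> (g a + g b) / 2 \<le> g ((a + b) / 2)" and pos: "\<And>x. 0 < g x"
  shows "g x = g y"
proof -
  have le: "g x \<le> g y" for x y
  proof (rule ccontr)
    assume less: "\<not> g x \<le> g y"
    define h where "h = y - x"
    define u where "u n = g (x + real n * h)" for n :: nat
    have mid': "(g a + g b) / 2 \<le> g ((a + b) / 2)" for a b
      using mid[of a b] mid[of b a] by (cases a b rule: linorder_cases) (auto simp: add.commute)
    have step: "u (Suc (Suc n)) - u (Suc n) \<le> u (Suc n) - u n" for n
      using mid'[of "x + real n * h" "x + real (Suc (Suc n)) * h"]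
      by (simp add: u_def algebra_simps add_divide_distrib)
    have dec: "u (Suc n) - u n \<le> u 1 - u 0" for n
    proof (induction n)
      case (Suc n)
      then show ?case using step[of n] by linarith
    qed simp
    have lin: "u n \<le> u 0 + real n * (u 1 - u 0)" for n
    proof (induction n)
      case (Suc n)
      have "real (Suc n) * (u 1 - u 0) = real n * (u 1 - u 0) + (u 1 - u 0)" by (simp add: algebra_simps)
      then show ?case using dec[of n] Suc by linarith
    qed simp
    have "u 1 - u 0 < 0" using less by (simp add: u_def h_def)
    then obtain n :: nat where "u 0 / (u 0 - u 1) < real n" using reals_Archimedean2 by blast
    then have "u 0 < real n * (u 0 - u 1)" using \<open>u 1 - u 0 < 0\<close> by (simp add: pos_divide_less_eq)
    then have "u n < 0" using lin[of n] by (simp add: algebra_simps)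
    then show False using pos[of "x + real n * h"] by (simp add: u_def)
  qed
  show ?thesis using le[of x y] le[of y x] by simp
qed

lemma cone_chron_imp_caus: "cone_chron I f y y' \<Longrightarrow> cone_caus I f y y'"
  unfolding cone_chron_def cone_caus_def using fd_timelike_imp_causal by blast

section \<open>Time translation as an optimal coupling, and the halfway slab\<close>

context slab
begin

definition shift_coupling :: "real \<Rightarrow> real \<Rightarrow> ((real \<times> 'a) set \<times> (real \<times> 'a) set) measure" where
  "shift_coupling a \<Delta> = distr (Q a) (B \<Otimes>\<^sub>M B) (\<lambda>q. (pt q, pt (sh \<Delta> q)))"

lemma measurable_sh_Q [measurable]: "sh \<Delta> \<in> measurable (Q a) L"
  using measurable_sh by (simp add: Q_def)

lemma measurable_shift_pair [measurable]: "(\<lambda>q. (pt q, pt (sh \<Delta> q))) \<in> measurable (Q a) (B \<Otimes>\<^sub>M B)"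
  by (intro measurable_Pair measurable_pt_Q measurable_compose[OF measurable_sh_Q measurable_pt_L])

lemma coupling_shift: "coupling (mu a) (mu (a + \<Delta>)) (shift_coupling a \<Delta>)"
  unfolding coupling_def
proof (intro conjI)
  show "sets (shift_coupling a \<Delta>) = sets (mu a \<Otimes>\<^sub>M mu (a + \<Delta>))"
    unfolding shift_coupling_def sets_distr by (rule sets_pair_measure_cong) auto
  \<comment> \<open>Only the \<sigma>-algebra of the target matters for \<open>distr\<close>, so the
    marginal measure may be exchanged for B.\<close>
  have "distr (shift_coupling a \<Delta>) (mu a) fst = distr (shift_coupling a \<Delta>) B fst" by (rule distr_cong) auto
  also have "\<dots> = distr (Q a) B pt"
    unfolding shift_coupling_def by (subst distr_distr) (auto simp: comp_def)
  finally show "distr (shift_coupling a \<Delta>) (mu a) fst = mu a" by (simp add: mu_eq)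
  have "distr (shift_coupling a \<Delta>) (mu (a + \<Delta>)) snd = distr (shift_coupling a \<Delta>) B snd" by (rule distr_cong) auto
  also have "\<dots> = distr (Q a) B (\<lambda>q. pt (sh \<Delta> q))"
    unfolding shift_coupling_def by (subst distr_distr) (auto simp: comp_def)
  also have "\<dots> = distr (distr (Q a) L (sh \<Delta>)) B pt"
    by (subst distr_distr) (auto simp: comp_def)
  finally show "distr (shift_coupling a \<Delta>) (mu (a + \<Delta>)) snd = mu (a + \<Delta>)" by (simp add: mu_eq Q_shift)
qed

text \<open>Transferring an almost-everywhere statement to an image measure requires a measurable
  predicate. Having the same component in X is therefore expressed by a vanishing distance, which is
  measurable on the product because X is separable.\<close>

lemma AE_shift_coupling:
  "AE z in shift_coupling a \<Delta>. \<exists>s x. z = (pt (s, x), pt (s + \<Delta>, x))"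
proof -
  obtain C :: "'a set" where C: "countably_dense C" by (rule proper_space_countably_dense[OF proper])
  have "sets (M \<Otimes>\<^sub>M M) = sets (borel \<Otimes>\<^sub>M borel :: ('a \<times> 'a) measure)"
    by (rule sets_pair_measure_cong) (simp_all add: sets_M)
  then have sMM: "sets (M \<Otimes>\<^sub>M M) = sets (borel :: ('a \<times> 'a) measure)"
    using sets_borel_pair_countably_dense[OF C C] by simp
  have "(\<lambda>z. dist (fst z) (snd z)) \<in> borel_measurable (borel :: ('a \<times> 'a) measure)"
    by (intro borel_measurable_continuous_onI continuous_intros)
  then have dm: "(\<lambda>z. dist (fst z) (snd z)) \<in> borel_measurable (M \<Otimes>\<^sub>M M)"
    by (simp add: measurable_cong_sets[OF sMM refl])
  define xc where "xc y = snd (the_elem y)" for y :: "(real \<times> 'a) set"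
  have "snd \<in> measurable L M" by measurable
  then have [measurable]: "xc \<in> measurable B M"
    unfolding xc_def by (rule measurable_compose[OF measurable_the_elem_L])
  have "(\<lambda>z. (xc (fst z), xc (snd z))) \<in> measurable (B \<Otimes>\<^sub>M B) (M \<Otimes>\<^sub>M M)" by measurable
  from measurable_compose[OF this dm]
  have [measurable]: "(\<lambda>z. dist (xc (fst z)) (xc (snd z))) \<in> borel_measurable (B \<Otimes>\<^sub>M B)" by simp
  define G where "G z \<longleftrightarrow> tm (snd z) = tm (fst z) + \<Delta> \<and> dist (xc (fst z)) (xc (snd z)) = 0" for z
  have "AE z in shift_coupling a \<Delta>. G z"
    unfolding shift_coupling_def
  proof (subst AE_distr_iff)
    show "{z \<in> space (B \<Otimes>\<^sub>M B). G z} \<in> sets (B \<Otimes>\<^sub>M B)" unfolding G_def by measurable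
    show "AE q in Q a. G (pt q, pt (sh \<Delta> q))" by (simp add: G_def tm_def xc_def sh_def)
  qed measurable
  then show ?thesis using AE_space
  proof eventually_elim
    case (elim z)
    then obtain s x t y where "z = (pt (s, x), pt (t, y))"
      by (auto simp: shift_coupling_def space_pair_measure topspace_T)
    then show ?case using elim(1) by (auto simp: G_def tm_def xc_def)
  qed
qed

lemma shift_coupling_chronological:
  assumes "0 < \<Delta>"
  shows "chronological_coupling S (mu a) (mu (a + \<Delta>)) (shift_coupling a \<Delta>)"
    and "causal_coupling S (mu a) (mu (a + \<Delta>)) (shift_coupling a \<Delta>)"
proof -
  have chr: "AE z in shift_coupling a \<Delta>. chron S (fst z) (snd z)"
    using AE_shift_coupling
  proof eventually_elim
    case (elim z)
    then obtain s x where z: "z = (pt (s, x), pt (s + \<Delta>, x))" by blast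
    show ?case using cone_chron_vertical[of s "s + \<Delta>" f x] assms by (simp add: z)
  qed
  from chr show "chronological_coupling S (mu a) (mu (a + \<Delta>)) (shift_coupling a \<Delta>)"
    by (simp add: chronological_coupling_def coupling_shift split_beta')
  have "AE z in shift_coupling a \<Delta>. caus S (fst z) (snd z)"
    using chr by eventually_elim (simp add: cone_chron_imp_caus)
  then show "causal_coupling S (mu a) (mu (a + \<Delta>)) (shift_coupling a \<Delta>)"
    by (simp add: causal_coupling_def coupling_shift split_beta')
qed

lemma shift_coupling_cost:
  assumes "0 < \<Delta>"
  shows "(\<integral>\<^sup>+(x, y). ennreal (tsep S x y powr p) \<partial>shift_coupling a \<Delta>) = ennreal (\<Delta> powr p)"
proof -
  interpret prob_space "shift_coupling a \<Delta>"
    unfolding shift_coupling_def by (rule prob_space.prob_space_distr[OF prob_Q]) measurable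
  have "(\<integral>\<^sup>+(x, y). ennreal (tsep S x y powr p) \<partial>shift_coupling a \<Delta>) = (\<integral>\<^sup>+z. ennreal (\<Delta> powr p) \<partial>shift_coupling a \<Delta>)"
  proof (rule nn_integral_cong_AE)
    show "AE z in shift_coupling a \<Delta>. (case z of (x, y) \<Rightarrow> ennreal (tsep S x y powr p)) = ennreal (\<Delta> powr p)"
      using AE_shift_coupling
    proof eventually_elim
      case (elim z)
      then obtain s x where z: "z = (pt (s, x), pt (s + \<Delta>, x))" by blast
      show ?case using cone_tsep_vertical[of s "s + \<Delta>" f x] assms by (simp add: z)
    qed
  qed
  then show ?thesis by (simp add: emeasure_space_1)
qed

lemma shift_coupling_optimal:
  assumes "0 < \<Delta>" "0 < p" "p < 1"
  shows "p_optimal p S (mu a) (mu (a + \<Delta>)) (shift_coupling a \<Delta>)"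
  unfolding p_optimal_def shift_coupling_cost[OF assms(1)]
  using shift_coupling_chronological(2)[OF assms(1)] coupling_cost_le[OF assms(2,3,1)] by blast

text \<open>Each half has time separation (t - s)/2, which is at most its time difference; the
  differences add up to t - s, so the midpoint has time exactly (s + t)/2. The first half then
  attains the bound and is vertical. Averaging the time intervals of the end slabs gives that of the
  halfway slab.\<close>

lemma geodesic_midpoint:
  assumes \<gamma>: "\<gamma> \<in> TGeo S" and eq: "tsep S (\<gamma> 0) (\<gamma> 1) = tm (\<gamma> 1) - tm (\<gamma> 0)"
    and ends: "\<gamma> 0 \<in> A a" "\<gamma> 1 \<in> A (a + \<Delta>)"
  shows "\<gamma> (1/2) \<in> A (a + \<Delta>/2)"
proof -
  have rng: "\<exists>s x. \<gamma> t = pt (s, x)" if "t \<in> {0..1}" for t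
  proof -
    have "\<gamma> \<in> topspace (path_space (metr S))" using \<gamma> unfolding TGeo_def by blast
    then have "\<gamma> \<in> {0..1} \<rightarrow> range pt" unfolding path_space_def by (simp add: mspace_cone)
    then have "\<gamma> t \<in> range pt" using that by (rule funcset_mem)
    then show ?thesis by auto
  qed
  obtain s x where g0: "\<gamma> 0 = pt (s, x)" using rng[of 0] by auto
  obtain t y where g1: "\<gamma> 1 = pt (t, y)" using rng[of 1] by auto
  obtain u z where g2: "\<gamma> (1/2) = pt (u, z)" using rng[of "1/2"] by auto
  note g = g0 g1 g2
  let ?\<tau> = "cone_tsep UNIV f"
  have ts: "?\<tau> (pt (s, x)) (pt (t, y)) = t - s" using eq by (simp add: g tm_def)
  have geo: "0 < ?\<tau> (\<gamma> 0) (\<gamma> 1)" using \<gamma> unfolding TGeo_def S_simps by blast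
  have geo2: "?\<tau> (\<gamma> s) (\<gamma> t) = (t - s) * ?\<tau> (\<gamma> 0) (\<gamma> 1)" if "s \<in> {0..1}" "t \<in> {0..1}" "s < t" for s t
    using \<gamma> that unfolding TGeo_def S_simps by blast
  have st: "0 < t - s" using geo ts g by simp
  have 1: "?\<tau> (pt (s, x)) (pt (u, z)) = (t - s) / 2" using geo2[of 0 "1/2"] ts by (simp add: g)
  have 2: "?\<tau> (pt (u, z)) (pt (t, y)) = (t - s) / 2" using geo2[of "1/2" 1] ts by (simp add: g)
  have su: "s < u" using cone_tsep_pos_imp_less[of f s x u z] 1 st by simp
  have ut: "u < t" using cone_tsep_pos_imp_less[of f u z t y] 2 st by simp
  have "(t - s) / 2 \<le> u - s" "(t - s) / 2 \<le> t - u"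
    using cone_tsep_le[of s u f x z] cone_tsep_le[of u t f z y] 1 2 su ut by simp_all
  then have u: "u = (s + t) / 2" by (simp add: field_simps)
  then have "?\<tau> (pt (s, x)) (pt (u, z)) = u - s" using 1 by (simp add: field_simps)
  then have "x = z" by (rule cone_tsep_eq_imp_vertical[OF pos cont _ su])
  then show ?thesis using ends u by (auto simp: g A_def A0_def image_iff field_simps)
qed

lemma emeasure_vol_A_le:
  assumes F: "\<And>t. t \<in> {a..a+d} \<Longrightarrow> f t \<le> F"
  shows "emeasure (cone_vol UNIV f N M) (A a) \<le> ennreal (F powr N * (d * mK))"
proof -
  have vim: "pt -` A a \<inter> space L = A0 a"
    by (auto simp: A_def space_pair_measure)
  have "emeasure (cone_vol UNIV f N M) (A a) = (\<integral>\<^sup>+q. ennreal (f (fst q) powr N) * indicator (A0 a) q \<partial>L)"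
  proof -
    have fm: "(\<lambda>q. ennreal (f (fst q) powr N)) \<in> borel_measurable L" by measurable
    show ?thesis unfolding cone_vol_eq
      by (subst emeasure_distr) (auto simp: vim emeasure_density[OF fm A0_sets])
  qed
  also have "\<dots> \<le> (\<integral>\<^sup>+q. ennreal (F powr N) * indicator (A0 a) q \<partial>L)"
  proof (intro nn_integral_mono)
    fix q
    have "f (fst q) powr N \<le> F powr N" if "q \<in> A0 a"
      using that F[of "fst q"] pos[of "fst q"] N by (intro powr_mono2) (auto simp: A0_def)
    then show "ennreal (f (fst q) powr N) * indicator (A0 a) q \<le> ennreal (F powr N) * indicator (A0 a) q"
      by (auto simp: indicator_def intro: ennreal_leI)
  qed
  also have "\<dots> = ennreal (F powr N) * (ennreal d * ennreal mK)"
    unfolding A0_def using d by (simp add: nn_integral_cmult_indicator M.emeasure_pair_measure_Times emeasure_K)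
  also have "\<dots> = ennreal (F powr N * (d * mK))"
    using d mK_pos by (simp add: ennreal_mult)
  finally show ?thesis .
qed

text \<open>On the slab the density is 1/(d * mK * f^N), and the negative power turns a lower bound
  for f into one for the left-hand side of the curvature inequality's integrand.\<close>

lemma rho_powr_ge:
  assumes y: "y \<in> A a" and c: "0 \<le> c" "\<And>t. t \<in> {a..a+d} \<Longrightarrow> c \<le> f t"
  shows "(d * mK) powr (1 / (N + 1)) * c powr (N / (N + 1)) \<le> rho a y powr (- 1 / (N + 1))"
proof -
  obtain t x where q: "y = pt (t, x)" "t \<in> {a..a+d}" "x \<in> K" using y by (auto simp: A_def A0_def)
  have ft: "0 < f t" by (rule pos)
  have dm: "0 < d * mK" using d mK_pos by simp
  have "rho a y = 1 / (d * mK * f t powr N)"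
    using q by (simp add: rho_def dens_def tm_def A0_def)
  then have "rho a y powr (- 1 / (N + 1)) = (d * mK * f t powr N) powr (1 / (N + 1))"
    using dm ft by (simp add: powr_divide powr_minus_divide)
  also have "\<dots> = (d * mK) powr (1 / (N + 1)) * f t powr (N / (N + 1))"
    using dm ft by (simp add: powr_mult powr_powr)
  finally have "rho a y powr (- 1 / (N + 1)) = (d * mK) powr (1 / (N + 1)) * f t powr (N / (N + 1))" .
  moreover have "c powr (N / (N + 1)) \<le> f t powr (N / (N + 1))"
    using c q N by (intro powr_mono2) auto
  ultimately show ?thesis by (simp add: mult_left_mono)
qed

text \<open>The curvature condition between two translated slabs: the midpoint measure is carried by the
  slab halfway, so by Jensen its Renyi entropy is bounded by the volume of that slab.\<close>

lemma slab_concavity: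
  assumes tcd: "TCD_zero p (N + 1) S" and p: "0 < p" "p < 1" and \<Delta>: "0 < \<Delta>"
    and c1: "0 \<le> c1" "\<And>t. t \<in> {a..a+d} \<Longrightarrow> c1 \<le> f t"
    and c2: "0 \<le> c2" "\<And>t. t \<in> {a+\<Delta>..a+\<Delta>+d} \<Longrightarrow> c2 \<le> f t"
    and F: "\<And>t. t \<in> {a+\<Delta>/2..a+\<Delta>/2+d} \<Longrightarrow> f t \<le> F"
  shows "(c1 powr (N / (N + 1)) + c2 powr (N / (N + 1))) / 2 \<le> F powr (N / (N + 1))"
proof -
  let ?b = "a + \<Delta>" and ?e = "1 / (N + 1)" and ?m = "a + \<Delta>/2"
  have dual: "timelike_p_dualizable p S (mu a) (mu ?b)"
    unfolding timelike_p_dualizable_def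
    using shift_coupling_optimal[OF \<Delta> p] shift_coupling_chronological(1)[OF \<Delta>] by blast
  obtain P where P: "P \<in> prob_measures_on (path_space (metr S)) (TGeo S)"
    and opt: "p_optimal p S (mu a) (mu ?b) (distr P (B \<Otimes>\<^sub>M B) (\<lambda>\<gamma>. (\<gamma> 0, \<gamma> 1)))"
    and conc: "\<forall>t\<in>{0..1}. \<exists>\<rho>. ac_density (vol S) (distr P B (\<lambda>\<gamma>. \<gamma> t)) \<rho> \<and>
      (\<forall>N'\<ge>N + 1. (\<integral>\<^sup>+y. ennreal (\<rho> y powr (1 - 1 / N')) \<partial>vol S) \<ge>
         (\<integral>\<^sup>+(x\<^sub>0, x\<^sub>1). ennreal ((1 - t) * rho a x\<^sub>0 powr (- 1 / N') + t * rho ?b x\<^sub>1 powr (- 1 / N'))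
            \<partial>distr P (B \<Otimes>\<^sub>M B) (\<lambda>\<gamma>. (\<gamma> 0, \<gamma> 1))))"
    using tcd[unfolded TCD_zero_def Let_def, rule_format, OF conjI[OF compactly_supported_mu conjI[OF compactly_supported_mu dual]]]
    by auto
  define \<pi> where "\<pi> = distr P (B \<Otimes>\<^sub>M B) (\<lambda>\<gamma>. (\<gamma> 0, \<gamma> 1))"
  interpret P: prob_space P using P by (simp add: prob_measures_on_def)
  have ev: "(\<lambda>\<gamma>. \<gamma> t) \<in> measurable P B" if "t \<in> {0..1}" for t
    using path_space_evaluation_measurable[OF P that] by (simp add: T_def)
  have ev01: "(\<lambda>\<gamma>. (\<gamma> 0, \<gamma> 1)) \<in> measurable P (B \<Otimes>\<^sub>M B)"
    by (intro measurable_Pair ev) auto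
  have spP: "space P \<subseteq> TGeo S"
  proof -
    have "sets P = sets (borel_of (subtopology (path_space (metr S)) (TGeo S)))"
      using P by (simp add: prob_measures_on_def)
    from sets_eq_imp_space_eq[OF this] show ?thesis by auto
  qed
  have cc: "causal_coupling S (mu a) (mu ?b) \<pi>" using opt by (simp add: p_optimal_def \<pi>_def)
  \<comment> \<open>The coupling supplied by the curvature condition is optimal, so it costs at
    least as much as the translation and attains the maximal value.\<close>
  have cost: "ennreal (\<Delta> powr p) \<le> (\<integral>\<^sup>+(x, y). ennreal (tsep S x y powr p) \<partial>\<pi>)"
  proof -
    have "(\<integral>\<^sup>+(x, y). ennreal (tsep S x y powr p) \<partial>shift_coupling a \<Delta>) \<le> (\<integral>\<^sup>+(x, y). ennreal (tsep S x y powr p) \<partial>\<pi>)"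
      using opt[unfolded p_optimal_def] shift_coupling_chronological(2)[OF \<Delta>, of a] unfolding \<pi>_def by blast
    then show ?thesis by (simp only: shift_coupling_cost[OF \<Delta>])
  qed
  have inA: "AE z in \<pi>. fst z \<in> A a \<and> snd z \<in> A ?b" by (rule AE_in_A[OF p \<Delta> cc])
  have "AE \<gamma> in P. tsep S (\<gamma> 0) (\<gamma> 1) = tm (\<gamma> 1) - tm (\<gamma> 0)"
    using AE_distrD[OF ev01 coupling_cost_eq_imp[OF p \<Delta> cc cost, unfolded \<pi>_def]] by simp
  moreover have "AE \<gamma> in P. \<gamma> 0 \<in> A a \<and> \<gamma> 1 \<in> A ?b"
    using AE_distrD[OF ev01 inA[unfolded \<pi>_def]] by simp
  ultimately have mid: "AE \<gamma> in P. \<gamma> (1/2) \<in> A ?m" using AE_space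
    by eventually_elim (use spP geodesic_midpoint in blast)
  define \<nu> where "\<nu> = distr P B (\<lambda>\<gamma>. \<gamma> (1/2))"
  have half: "(1/2::real) \<in> {0..1}" by simp
  have \<nu>: "prob_space \<nu>" "sets \<nu> = sets (cone_vol UNIV f N M)"
    unfolding \<nu>_def using P.prob_space_distr[OF ev[OF half]] by (auto simp: sets_vol)
  have \<nu>A: "AE y in \<nu>. y \<in> A ?m" unfolding \<nu>_def
  proof (subst AE_distr_iff[OF ev[OF half]])
    have "{y \<in> space B. y \<in> A ?m} = A ?m" using sets.sets_into_space[OF A_sets] by auto
    then show "{y \<in> space B. y \<in> A ?m} \<in> sets B" by simp
  qed (rule mid)
  obtain \<rho> where \<rho>: "ac_density (vol S) \<nu> \<rho>"
    "(\<integral>\<^sup>+(x\<^sub>0, x\<^sub>1). ennreal ((1 - 1/2) * rho a x\<^sub>0 powr (- 1 / (N + 1)) + 1/2 * rho ?b x\<^sub>1 powr (- 1 / (N + 1))) \<partial>\<pi>)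
      \<le> (\<integral>\<^sup>+y. ennreal (\<rho> y powr (1 - 1 / (N + 1))) \<partial>vol S)"
    using bspec[OF conc half] unfolding \<nu>_def \<pi>_def by blast
  \<comment> \<open>This factor appears on both sides of the final inequality and cancels, so the
    dimensions of the slab survive only through the windows for c1, c2 and F.\<close>
  define W where "W = (d * mK) powr ?e"
  have dm: "0 < d * mK" using d mK_pos by simp
  have W: "0 < W" using d mK_pos by (simp add: W_def)
  have F0: "0 < F" using F[of ?m] pos[of ?m] d by auto
  define v where "v = F powr N * (d * mK)"
  have v: "0 < v" using F0 dm by (simp add: v_def)
  have vm: "emeasure (cone_vol UNIV f N M) (A ?m) \<le> ennreal v"
    unfolding v_def by (rule emeasure_vol_A_le[OF F])
  have Am: "A ?m \<in> sets (cone_vol UNIV f N M)" using A_sets sets_vol by simp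
  \<comment> \<open>Jensen with \<theta> = 1 - 1/(N + 1), leaving the power 1/(N + 1) of the
    volume.\<close>
  have "(\<integral>\<^sup>+y. ennreal (\<rho> y powr (1 - ?e)) \<partial>vol S) \<le> ennreal (v powr (1 - (1 - ?e)))"
    using nn_integral_ac_density_le[OF \<rho>(1)[simplified] \<nu> Am \<nu>A vm v, of "1 - ?e"] N by simp
  also have "v powr (1 - (1 - ?e)) = W * F powr (N / (N + 1))"
    using F0 dm by (simp add: v_def W_def powr_mult powr_powr)
  finally have up: "(\<integral>\<^sup>+y. ennreal (\<rho> y powr (1 - ?e)) \<partial>vol S) \<le> ennreal (W * F powr (N / (N + 1)))" .
  define lo where "lo = W * ((c1 powr (N / (N + 1)) + c2 powr (N / (N + 1))) / 2)"
  interpret \<pi>: prob_space \<pi> unfolding \<pi>_def by (rule P.prob_space_distr[OF ev01])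
  have "ennreal lo = (\<integral>\<^sup>+z. ennreal lo \<partial>\<pi>)" by (simp add: \<pi>.emeasure_space_1)
  also have "\<dots> \<le> (\<integral>\<^sup>+(x\<^sub>0, x\<^sub>1). ennreal ((1 - 1/2) * rho a x\<^sub>0 powr (- 1 / (N + 1)) + 1/2 * rho ?b x\<^sub>1 powr (- 1 / (N + 1))) \<partial>\<pi>)"
  proof (rule nn_integral_mono_AE)
    show "AE z in \<pi>. ennreal lo \<le> (case z of (x\<^sub>0, x\<^sub>1) \<Rightarrow>
        ennreal ((1 - 1/2) * rho a x\<^sub>0 powr (- 1 / (N + 1)) + 1/2 * rho ?b x\<^sub>1 powr (- 1 / (N + 1))))"
      using inA
    proof eventually_elim
      case (elim z)
      have "lo \<le> (1 - 1/2) * rho a (fst z) powr (- 1 / (N + 1)) + 1/2 * rho ?b (snd z) powr (- 1 / (N + 1))"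
        using rho_powr_ge[of "fst z" a c1] rho_powr_ge[of "snd z" ?b c2] elim c1 c2
        unfolding lo_def W_def by (simp add: algebra_simps add_divide_distrib)
      then show ?case unfolding split_beta' by (rule ennreal_leI)
    qed
  qed
  also note \<rho>(2)
  also note up
  finally have "lo \<le> W * F powr (N / (N + 1))" using W by (subst (asm) ennreal_le_iff) auto
  then show ?thesis unfolding lo_def using W by (simp only: mult_le_cancel_left_pos)
qed

end

section \<open>Thin slabs and the conclusion\<close>

context warped_measure
begin

lemma TCD_imp_constant:
  assumes tcd: "TCD_zero p (N + 1) S" and p: "0 < p" "p < 1" and nz: "emeasure M UNIV \<noteq> 0"
  shows "f x = f y"
proof -
  define \<kappa> where "\<kappa> = N / (N + 1)"
  have \<kappa>: "0 < \<kappa>" using N by (simp add: \<kappa>_def)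
  obtain K where K: "compact K" "emeasure M K \<noteq> 0" using ex_compact_nonnull[OF nz] by blast
  \<comment> \<open>The slab thickness is replaced by a relative error \<eta>, which is then sent to
    0.\<close>
  have near: "\<exists>d>0. \<forall>u\<in>{t..t+d}. (1 - \<eta>) * f t \<le> f u \<and> f u \<le> (1 + \<eta>) * f t" if "0 < \<eta>" for t \<eta>
  proof -
    have "isCont f t" using cont by (simp add: continuous_on_eq_continuous_at)
    moreover have "0 < \<eta> * f t" using that pos[of t] by simp
    ultimately obtain e where e: "0 < e" "\<And>u. dist u t < e \<Longrightarrow> dist (f u) (f t) < \<eta> * f t"
      unfolding continuous_at_eps_delta by blast
    show ?thesis
    proof (intro exI[of _ "e/2"] conjI ballI)
      fix u assume "u \<in> {t..t+e/2}"
      then have "dist u t < e" using e(1) by (auto simp: dist_real_def)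
      from e(2)[OF this] show "(1 - \<eta>) * f t \<le> f u" "f u \<le> (1 + \<eta>) * f t"
        by (auto simp: dist_real_def algebra_simps)
    qed (use e in auto)
  qed
  have mid: "(f a powr \<kappa> + f b powr \<kappa>) / 2 \<le> f ((a + b) / 2) powr \<kappa>" if ab: "a < b" for a b
  proof (rule tendsto_le[of "at_right (0::real)"])
    have bound: "((((1 - \<eta>) * f a) powr \<kappa> + ((1 - \<eta>) * f b) powr \<kappa>) / 2) \<le> ((1 + \<eta>) * f ((a + b) / 2)) powr \<kappa>"
      if \<eta>: "0 < \<eta>" "\<eta> < 1" for \<eta>
    proof -
      obtain d1 where d1: "0 < d1" "\<forall>u\<in>{a..a+d1}. (1 - \<eta>) * f a \<le> f u" using near[OF \<eta>(1)] by blast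
      obtain d2 where d2: "0 < d2" "\<forall>u\<in>{b..b+d2}. (1 - \<eta>) * f b \<le> f u" using near[OF \<eta>(1)] by blast
      obtain d3 where d3: "0 < d3" "\<forall>u\<in>{(a+b)/2..(a+b)/2+d3}. f u \<le> (1 + \<eta>) * f ((a+b)/2)" using near[OF \<eta>(1)] by blast
      \<comment> \<open>Translation requires all slabs to have the same thickness, so the smallest
        of the three windows is taken.\<close>
      define r where "r = min d1 (min d2 d3)"
      have r: "0 < r" "r \<le> d1" "r \<le> d2" "r \<le> d3" using d1 d2 d3 by (auto simp: r_def)
      interpret slab f X N M K r by standard (use K r in auto)
      have m: "a + (b - a) / 2 = (a + b) / 2" by (simp add: field_simps)
      show ?thesis unfolding \<kappa>_def
        by (rule slab_concavity[OF tcd p, of "b - a" _ a])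
          (use ab \<eta> pos[of a] pos[of b] r d1(2) d2(2) d3(2) in \<open>auto simp: m\<close>)
    qed
    show "\<forall>\<^sub>F \<eta> in at_right 0. ((((1 - \<eta>) * f a) powr \<kappa> + ((1 - \<eta>) * f b) powr \<kappa>) / 2) \<le> ((1 + \<eta>) * f ((a + b) / 2)) powr \<kappa>"
      unfolding eventually_at_right_field using bound by (intro exI[of _ 1]) auto
    have "((\<lambda>\<eta>. ((1 + \<eta>) * f ((a + b) / 2)) powr \<kappa>) \<longlongrightarrow> ((1 + 0) * f ((a + b) / 2)) powr \<kappa>) (at_right 0)"
      using pos[of "(a + b) / 2"] by (intro tendsto_intros) auto
    then show "((\<lambda>\<eta>. ((1 + \<eta>) * f ((a + b) / 2)) powr \<kappa>) \<longlongrightarrow> f ((a + b) / 2) powr \<kappa>) (at_right 0)" by simp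
    have "((\<lambda>\<eta>. (((1 - \<eta>) * f a) powr \<kappa> + ((1 - \<eta>) * f b) powr \<kappa>) / 2) \<longlongrightarrow>
       (((1 - 0) * f a) powr \<kappa> + ((1 - 0) * f b) powr \<kappa>) / 2) (at_right 0)"
      using pos[of a] pos[of b] by (intro tendsto_intros) auto
    then show "((\<lambda>\<eta>. (((1 - \<eta>) * f a) powr \<kappa> + ((1 - \<eta>) * f b) powr \<kappa>) / 2) \<longlongrightarrow> (f a powr \<kappa> + f b powr \<kappa>) / 2) (at_right 0)"
      by simp
  qed simp
  have "f x powr \<kappa> = f y powr \<kappa>"
    by (rule midpoint_concave_positive_constant[where g="\<lambda>x. f x powr \<kappa>"])
      (use mid pos in \<open>auto simp: less_imp_neq[symmetric]\<close>)
  then show ?thesis using \<kappa> pos[of x] pos[of y] by (metis less_imp_le linorder_neqE_linordered_idom powr_less_mono2 less_irrefl)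
qed

end

lemma smooth_on_interval_continuous:
  assumes "smooth_on_interval I f"
  shows "continuous_on I f"
proof -
  obtain D where D: "\<And>t. t \<in> I \<Longrightarrow> D 0 t = f t"
    "\<And>n t. t \<in> I \<Longrightarrow> (D n has_real_derivative D (Suc n) t) (at t within I)"
    using assms unfolding smooth_on_interval_def by metis
  have "continuous_on I (D 0)"
    by (rule DERIV_continuous_on) (rule D(2))
  then show ?thesis using D(1) by (simp cong: continuous_on_cong)
qed

theorem corollary7p6:
  fixes N :: real and \<mm> :: "'a::metric_space measure"
    and I :: "real set" and f :: "real \<Rightarrow> real"
  assumes "N > 1"
    and "proper_space TYPE('a)" and "complete (UNIV :: 'a set)" and "geodesic_space TYPE('a)"
    and "radon_measure \<mm>" and "emeasure \<mm> UNIV \<noteq> 0"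
    and "essentially_nonbranching \<mm>"
    and "is_interval I" and "\<forall>t\<in>I. 0 \<le> f t" and "smooth_on_interval I f"
    and "frontier I = {t \<in> I. f t = 0}"
    and "inverse_nonintegrable_at_zeros I f"
    and "\<exists>p. 0 < p \<and> p < 1 \<and> TCD_zero p (N + 1) (lorentz_cone I f N \<mm>)"
    and "\<exists>\<gamma> :: real \<Rightarrow> (real \<times> 'a) set. fd_timelike_line I f \<gamma>"
  shows "I = UNIV \<and>
    (\<exists>c>0. (\<forall>t. f t = c) \<and> lorentz_cone I f N \<mm> = lorentz_product c N \<mm>)"
proof -
  have cont: "continuous_on I f" by (rule smooth_on_interval_continuous) fact
  obtain \<gamma> :: "real \<Rightarrow> (real \<times> 'a) set" where \<gamma>: "fd_timelike_line I f \<gamma>" using assms(14) by blast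
  have I: "I = UNIV"
  proof (intro equalityI subsetI UNIV_I)
    fix C
    obtain u v where "u \<in> I" "u < C" "v \<in> I" "C < v"
      using fd_timelike_line_unbounded[OF \<gamma> cont] by blast
    then show "C \<in> I" using assms(8) unfolding is_interval_1 by (meson less_imp_le)
  qed
  \<comment> \<open>The frontier of the whole line is empty, so f has no zeros.\<close>
  have pos: "0 < f t" for t
    using assms(9,11) I by (auto simp: less_le)
  interpret warped_measure f "TYPE('a)" N \<mm>
    by standard (use assms cont I pos in auto)
  obtain p where "0 < p" "p < 1" "TCD_zero p (N + 1) S" using assms(13) I by (auto simp: S_def)
  then have const: "f t = f 0" for t using TCD_imp_constant assms(6) by blast
  then have "f = (\<lambda>_. f 0)" by blast
  then have "lorentz_cone I f N \<mm> = lorentz_product (f 0) N \<mm>" unfolding lorentz_product_def I by metis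
  then show ?thesis using I pos const by blast
qed

end
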